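(* Let $G$ be a finitely generated group with polynomial volume growth of degree $D>0$. Let $\rho:[0,\infty)\to[1,\infty)$ be a continuous increasing function with $$\rho(t)\simeq\left(\int_t^\infty\frac{ds}{(1+s)\ell(s)}\right)^{-1}$$ where $\ell:[0,\infty)\to[1,\infty)$ is continuous, increasing and regularly varying of index $\alpha\ge0$, with $\int_0^\infty\frac{ds}{(1+s)\ell(s)}<\infty$. Set $M(t)=t^2/\int_0^t\frac{s\,ds}{\rho(s)}$ and let $M^{-1}$ be its inverse function. 1. Assume that $\alpha>0$. Then $\widetilde\Phi_{G,\rho}(n)\simeq 1/(M^{-1}(n))^D$. 2. Assume that $\rho$ is slowly varying and satisfies $\rho\circ\exp(u)\simeq u^{1/\gamma}\kappa(u)$ with $\gamma\in(0,\infty)$, $\kappa$ slowly varying at infinity and $\kappa(t^a)\simeq\kappa(t)$ for any $a>0$. Then $$\widetilde\Phi_{G,\rho}(n)\simeq\exp\left(-[n/\kappa(n)]^{\gamma/(1+\gamma)}\right).$$ 3. Assume that the function $\kappa=\rho\circ\exp$ is slowly varying and satisfies $s\kappa^{-1}(s)\simeq\kappa^{-1}(s)$ at infinity, where $\kappa^{-1}$ is the inverse function of $\kappa$. Then $$\widetilde\Phi_{G,\rho}(n)\simeq\exp(-n/\kappa(n)).$$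
   Context: $G$ is equipped with a fixed finite symmetric generating set and the associated word length $|\cdot|$; polynomial volume growth of degree $D$ means $|\{g:|g|\le r\}|\simeq r^D$. For a probability measure $\mu$ on $G$, $W(\rho,\mu)=\sup_{s>0}\{s\,\mu(\{g:\rho(|g|)>s\})\}$ and $$\widetilde\Phi_{G,\rho}(n)=\inf\{\phi^{(2n)}(e):\phi\text{ symmetric probability measure on }G,\ W(\rho,\phi)\le2\rho(0)\},$$ where $\phi^{(n)}$ is the $n$-fold convolution power. For monotone functions near infinity (on integers extended to reals by integer parts), $f\simeq g$ means there are constants $c_i\in(0,\infty)$ with $c_1f(c_2t)\le g(t)\le c_3f(c_4t)$. *)

theory Defs
  imports "HOL-Probability.Probability" "HOL-Algebra.Generated_Groups"
begin

text \<open>Groups are multiplicative with explicit carrier; probability measures on the (countable)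
  group \<open>G\<close> are pmfs supported in \<open>carrier G\<close>. Functions on \<open>[0,\<infinity>)\<close> are functions on \<open>real\<close>
  whose values at negative arguments are irrelevant.\<close>

definition sim_infinity :: "(real \<Rightarrow> real) \<Rightarrow> (real \<Rightarrow> real) \<Rightarrow> bool"
    (infix "\<simeq>\<^sub>\<infinity>" 50) where
  "f \<simeq>\<^sub>\<infinity> g \<longleftrightarrow> (\<exists>c1>0. \<exists>c2>0. \<exists>c3>0. \<exists>c4>0.
     \<forall>\<^sub>F t in at_top. c1 * f (c2 * t) \<le> g t \<and> g t \<le> c3 * f (c4 * t))"

definition sim_infinity_nat :: "(nat \<Rightarrow> real) \<Rightarrow> (nat \<Rightarrow> real) \<Rightarrow> bool"
    (infix "\<simeq>\<^sub>\<nat>" 50) where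
  "f \<simeq>\<^sub>\<nat> g \<longleftrightarrow> (\<lambda>t. f (nat \<lfloor>t\<rfloor>)) \<simeq>\<^sub>\<infinity> (\<lambda>t. g (nat \<lfloor>t\<rfloor>))"

text \<open>Regular variation at infinity in the sense of Karamata; as usual, positivity and
  measurability are only required on a neighbourhood of infinity.\<close>

definition regularly_varying :: "real \<Rightarrow> (real \<Rightarrow> real) \<Rightarrow> bool" where
  "regularly_varying \<alpha> f \<longleftrightarrow>
     (\<exists>a. (\<forall>t\<ge>a. f t > 0) \<and> f \<in> borel_measurable (restrict_space borel {a..})) \<and>
     (\<forall>x>0. ((\<lambda>t. f (x * t) / f t) \<longlongrightarrow> x powr \<alpha>) at_top)"

abbreviation slowly_varying :: "(real \<Rightarrow> real) \<Rightarrow> bool" where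
  "slowly_varying \<equiv> regularly_varying 0"

text \<open>\<open>g\<close> is the inverse of \<open>f : [0,\<infinity>) \<rightarrow> \<real>\<close> near infinity. If \<open>f\<close> is continuous, strictly
  increasing and unbounded, this determines \<open>g\<close> near infinity. If \<open>f\<close> is merely nondecreasing,
  \<open>g\<close> may be any right inverse.\<close>

definition inverse_near_infinity :: "(real \<Rightarrow> real) \<Rightarrow> (real \<Rightarrow> real) \<Rightarrow> bool" where
  "inverse_near_infinity f g \<longleftrightarrow> (\<forall>\<^sub>F s in at_top. 0 \<le> g s \<and> f (g s) = s)"

definition symmetric_generating_set :: "('a, 'b) monoid_scheme \<Rightarrow> 'a set \<Rightarrow> bool" where
  "symmetric_generating_set G S \<longleftrightarrow>
     S \<subseteq> carrier G \<and> (\<forall>s\<in>S. inv\<^bsub>G\<^esub> s \<in> S) \<and> generate G S = carrier G"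

definition word_length :: "('a, 'b) monoid_scheme \<Rightarrow> 'a set \<Rightarrow> 'a \<Rightarrow> nat" where
  "word_length G S g =
     (LEAST n. \<exists>xs. length xs = n \<and> set xs \<subseteq> S \<and> foldr (\<otimes>\<^bsub>G\<^esub>) xs \<one>\<^bsub>G\<^esub> = g)"

definition polynomial_growth :: "('a, 'b) monoid_scheme \<Rightarrow> 'a set \<Rightarrow> real \<Rightarrow> bool" where
  "polynomial_growth G S D \<longleftrightarrow>
     (\<lambda>r. real (card {g \<in> carrier G. real (word_length G S g) \<le> r})) \<simeq>\<^sub>\<infinity> (\<lambda>r. r powr D)"

definition symmetric_pmf :: "('a, 'b) monoid_scheme \<Rightarrow> 'a pmf \<Rightarrow> bool" where
  "symmetric_pmf G \<phi> \<longleftrightarrow>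
     set_pmf \<phi> \<subseteq> carrier G \<and> (\<forall>g\<in>carrier G. pmf \<phi> (inv\<^bsub>G\<^esub> g) = pmf \<phi> g)"

definition convolution_pmf ::
    "('a, 'b) monoid_scheme \<Rightarrow> 'a pmf \<Rightarrow> 'a pmf \<Rightarrow> 'a pmf" where
  "convolution_pmf G \<mu> \<nu> = map_pmf (\<lambda>(x, y). x \<otimes>\<^bsub>G\<^esub> y) (pair_pmf \<mu> \<nu>)"

primrec convolution_power :: "('a, 'b) monoid_scheme \<Rightarrow> 'a pmf \<Rightarrow> nat \<Rightarrow> 'a pmf" where
  "convolution_power G \<phi> 0 = return_pmf \<one>\<^bsub>G\<^esub>"
| "convolution_power G \<phi> (Suc n) = convolution_pmf G (convolution_power G \<phi> n) \<phi>"

definition weak_moment ::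
    "('a, 'b) monoid_scheme \<Rightarrow> 'a set \<Rightarrow> (real \<Rightarrow> real) \<Rightarrow> 'a pmf \<Rightarrow> ennreal" where
  "weak_moment G S \<rho> \<mu> =
     (SUP s\<in>{0<..}. ennreal
        (s * measure_pmf.prob \<mu> {g \<in> carrier G. \<rho> (real (word_length G S g)) > s}))"

definition Phi_tilde ::
    "('a, 'b) monoid_scheme \<Rightarrow> 'a set \<Rightarrow> (real \<Rightarrow> real) \<Rightarrow> nat \<Rightarrow> real" where
  "Phi_tilde G S \<rho> n =
     (INF \<phi>\<in>{\<phi>. symmetric_pmf G \<phi> \<and> weak_moment G S \<rho> \<phi> \<le> ennreal (2 * \<rho> 0)}.
        pmf (convolution_power G \<phi> (2 * n)) \<one>\<^bsub>G\<^esub>)"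

definition scale_M :: "(real \<Rightarrow> real) \<Rightarrow> real \<Rightarrow> real" where
  "scale_M \<rho> t = t\<^sup>2 / integral {0..t} (\<lambda>s. s / \<rho> s)"

end

theory Submission imports Defs begin

text \<open>The return probability after \<open>2n\<close> steps is the squared
\<open>\<ell>\<^sup>2\<close> norm of the density after \<open>n\<close> steps, so the task is
to see how fast convolution with a symmetric measure \<open>\<phi>\<close> can shrink an
\<open>\<ell>\<^sup>2\<close> norm if \<open>\<phi>\<close> obeys the weak moment condition. Up
to constants, the answer at spatial scale \<open>r\<close> is a relative loss of
\<open>1/M(r)\<close> per step, where \<open>M(r) = r\<^sup>2 / I(r)\<close> and
\<open>I(r)\<close> is the integral of \<open>s / \<rho>(s)\<close> over \<open>[0,r]\<close>.
This part rests on the monotonicity and unboundedness of \<open>\<rho>\<close> and on the volume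
growth.

No admissible \<open>\<phi>\<close> is faster (lemma \<open>return_probability_ge\<close>): the
moment condition says that jumps longer than \<open>t\<close> have probability at most
\<open>4\<rho>(0)/\<rho>(t)\<close>, so the truncated jump length \<open>min |y| m\<close> has
second moment at most a constant times \<open>I(m)\<close>. The test density proportional to
\<open>(m - |x|)\<^sub>+\<close> is Lipschitz and therefore has Rayleigh quotient at least
\<open>1 - C/M(m)\<close>. Log-convexity of the moments of a self-adjoint operator turns this
into \<open>(1 - C/M(m))\<^bsup>2n\<^esup>\<close>, and dividing by the volume of the ball gives
the bound for the return probability.

One admissible \<open>\<phi>\<close> is as fast (lemma \<open>ex_spread_out_walk\<close>):
choose a scale \<open>k\<close> such that scales above \<open>k\<close> have total mass
\<open>1/\<rho>(2\<^sup>k)\<close>, and jump uniformly in the ball of radius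
\<open>2\<^sup>k\<close>. A jump in a ball whose volume exceeds
\<open>2/\<parallel>f\<parallel>\<^sup>2\<close> destroys half of
\<open>\<parallel>f\<parallel>\<^sup>2\<close>; a jump at a smaller scale
\<open>2\<^sup>k\<close> destroys, up to constants, the fraction
\<open>4\<^bsup>k-K\<^esup>\<close> of that, because an element of the ball of radius
\<open>2\<^sup>K\<close> is a product of about \<open>2\<^bsup>K-k\<^esup>\<close> elements of
the small ball. Summation by parts over the scales gives the loss \<open>c/M(2\<^sup>K)\<close>.

The three asymptotic regimes then follow by choosing the scale. If \<open>\<alpha> > 0\<close>,
a fixed dilation at least doubles \<open>M\<close>, so the times needed to pass from one scale
to the next form a geometric series and the density has norm of order
\<open>r\<^bsup>-D\<^esup>\<close> after a time of order \<open>M(r)\<close>. If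
\<open>\<rho>\<close> is slowly varying, \<open>M\<close> is comparable with
\<open>\<rho>\<close>, and with \<open>r = e\<^sup>u\<close> the logarithm of the return
probability is minus the balance of \<open>D u\<close> against \<open>n /
\<rho>(e\<^sup>u)\<close>; the balance is reached when \<open>u \<rho>(e\<^sup>u)\<close> is of
order \<open>n\<close> (lemma \<open>Phi_sim_exp\<close>). It remains to solve this relation,
which is where the hypotheses on \<open>\<kappa>\<close> are used.\<close>


section \<open>Overlaps of densities and symmetric random walks\<close>

text \<open>The \<open>\<ell>\<^sup>2\<close> inner product of two densities, written as the probability
that two independent samples agree. In this form translations and mixtures pass through it by
the laws of the probability monad.\<close>

definition overlap :: "'a pmf \<Rightarrow> 'a pmf \<Rightarrow> real" where
  "overlap \<mu> \<nu> = pmf (bind_pmf \<mu> (\<lambda>x. map_pmf ((=) x) \<nu>)) True"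

lemma overlap_eq_expectation: "overlap \<mu> \<nu> = measure_pmf.expectation \<mu> (pmf \<nu>)"
proof -
  have "pmf (map_pmf ((=) x) \<nu>) True = pmf \<nu> x" for x
    by (simp add: pmf_map vimage_def measure_pmf_single)
  then show ?thesis by (simp add: overlap_def pmf_bind)
qed

lemma overlap_eq_integral: "overlap \<mu> \<nu> = (\<integral>x. pmf \<mu> x * pmf \<nu> x \<partial>count_space UNIV)"
  unfolding overlap_eq_expectation measure_pmf_eq_density
  by (subst integral_density) (auto simp: pmf_nonneg)

lemma overlap_commute: "overlap \<mu> \<nu> = overlap \<nu> \<mu>"
  by (simp add: overlap_eq_integral mult.commute)

lemma integrable_pmf_mult: "integrable (count_space UNIV) (\<lambda>x. pmf \<mu> x * pmf \<nu> x)"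
proof (rule Bochner_Integration.integrable_bound[OF integrable_pmf[of UNIV \<mu>]])
  show "AE x in count_space UNIV. norm (pmf \<mu> x * pmf \<nu> x) \<le> norm (pmf \<mu> x)"
    by (auto simp: pmf_le_1 mult_left_le)
qed simp

lemma overlap_nonneg: "0 \<le> overlap \<mu> \<nu>"
  by (simp add: overlap_def)

lemma overlap_le_1: "overlap \<mu> \<nu> \<le> 1"
  by (simp add: overlap_def pmf_le_1)

lemma overlap_le:
  assumes "\<And>x. pmf \<nu> x \<le> c"
  shows "overlap \<mu> \<nu> \<le> c"
proof -
  have "measure_pmf.expectation \<mu> (pmf \<nu>) \<le> measure_pmf.expectation \<mu> (\<lambda>_. c)"
    by (intro integral_mono) (auto intro!: measure_pmf.integrable_const_bound[where B=1] simp: pmf_le_1 assms)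
  then show ?thesis by (simp add: overlap_eq_expectation)
qed

lemma overlap_self_pos: "0 < overlap \<mu> \<mu>"
proof -
  obtain x where x: "x \<in> set_pmf \<mu>" using set_pmf_not_empty by fastforce
  have "0 < pmf \<mu> x * pmf \<mu> x" using x by (simp add: pmf_positive)
  also have "\<dots> = (\<integral>y. pmf \<mu> y * pmf \<mu> y * indicator {x} y \<partial>count_space UNIV)"
    using x by (subst lebesgue_integral_count_space_finite_support)
      (auto simp: indicator_def set_pmf_iff conj_commute cong: conj_cong intro: finite_subset[of _ "{x}"])
  also have "\<dots> \<le> (\<integral>y. pmf \<mu> y * pmf \<mu> y \<partial>count_space UNIV)"
    by (intro integral_mono integrable_pmf_mult integrable_real_mult_indicator) (auto simp: indicator_def)
  finally show ?thesis by (simp add: overlap_eq_integral)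
qed

lemma overlap_bind_left:
  "overlap (bind_pmf q F) \<nu> = measure_pmf.expectation q (\<lambda>k. overlap (F k) \<nu>)"
  unfolding overlap_def bind_assoc_pmf by (rule pmf_bind)

lemma overlap_return: "overlap \<mu> (return_pmf x) = pmf \<mu> x"
  by (subst overlap_commute) (simp add: overlap_eq_expectation)

text \<open>The form is the integral of the square of \<open>a \<mu> + b \<nu> + c \<xi>\<close>. Particular
coefficients give the Cauchy--Schwarz inequality, the non-negativity of the squared distance and
its quasi-triangle inequality.\<close>

lemma overlap_quadratic_form_nonneg:
  "0 \<le> a\<^sup>2 * overlap \<mu> \<mu> + b\<^sup>2 * overlap \<nu> \<nu> + c\<^sup>2 * overlap \<xi> \<xi>
       + 2 * a * b * overlap \<mu> \<nu> + 2 * a * c * overlap \<mu> \<xi> + 2 * b * c * overlap \<nu> \<xi>"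
proof -
  have "0 \<le> (\<integral>x. (a * pmf \<mu> x + b * pmf \<nu> x + c * pmf \<xi> x)\<^sup>2 \<partial>count_space UNIV)"
    by simp
  also have "\<dots> = (\<integral>x. a\<^sup>2 * (pmf \<mu> x * pmf \<mu> x) + b\<^sup>2 * (pmf \<nu> x * pmf \<nu> x)
       + c\<^sup>2 * (pmf \<xi> x * pmf \<xi> x) + 2 * a * b * (pmf \<mu> x * pmf \<nu> x)
       + 2 * a * c * (pmf \<mu> x * pmf \<xi> x) + 2 * b * c * (pmf \<nu> x * pmf \<xi> x) \<partial>count_space UNIV)"
    by (intro Bochner_Integration.integral_cong) (auto simp: power2_eq_square algebra_simps)
  also have "\<dots> = a\<^sup>2 * overlap \<mu> \<mu> + b\<^sup>2 * overlap \<nu> \<nu> + c\<^sup>2 * overlap \<xi> \<xi>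
       + 2 * a * b * overlap \<mu> \<nu> + 2 * a * c * overlap \<mu> \<xi> + 2 * b * c * overlap \<nu> \<xi>"
    by (simp add: overlap_eq_integral integrable_pmf_mult)
  finally show ?thesis .
qed

definition sqdist :: "'a pmf \<Rightarrow> 'a pmf \<Rightarrow> real" where
  "sqdist \<mu> \<nu> = overlap \<mu> \<mu> + overlap \<nu> \<nu> - 2 * overlap \<mu> \<nu>"

lemma sqdist_nonneg: "0 \<le> sqdist \<mu> \<nu>"
  using overlap_quadratic_form_nonneg[of 1 \<mu> "-1" \<nu> 0 \<nu>] by (simp add: sqdist_def)

lemma overlap_le_average: "2 * overlap \<mu> \<nu> \<le> overlap \<mu> \<mu> + overlap \<nu> \<nu>"
  using sqdist_nonneg[of \<mu> \<nu>] by (simp add: sqdist_def)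

lemma overlap_Cauchy_Schwarz: "(overlap \<mu> \<nu>)\<^sup>2 \<le> overlap \<mu> \<mu> * overlap \<nu> \<nu>"
proof -
  define t where "t = overlap \<mu> \<nu> / overlap \<nu> \<nu>"
  note p = overlap_self_pos[of \<nu>]
  have "0 \<le> overlap \<mu> \<mu> + t\<^sup>2 * overlap \<nu> \<nu> - 2 * t * overlap \<mu> \<nu>"
    using overlap_quadratic_form_nonneg[of 1 \<mu> "-t" \<nu> 0 \<nu>] by simp
  also have "\<dots> = overlap \<mu> \<mu> - (overlap \<mu> \<nu>)\<^sup>2 / overlap \<nu> \<nu>"
    using p by (simp add: t_def field_simps power2_eq_square)
  finally show ?thesis using p by (simp add: field_simps)
qed

lemma sqdist_triangle: "sqdist \<mu> \<xi> \<le> 2 * sqdist \<mu> \<nu> + 2 * sqdist \<nu> \<xi>"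
  using overlap_quadratic_form_nonneg[of 1 \<mu> "-2" \<nu> 1 \<xi>] by (simp add: sqdist_def)

lemma sqdist_eq_integral: "sqdist \<mu> \<nu> = (\<integral>x. (pmf \<mu> x - pmf \<nu> x)\<^sup>2 \<partial>count_space UNIV)"
proof -
  have "(\<integral>x. (pmf \<mu> x - pmf \<nu> x)\<^sup>2 \<partial>count_space UNIV) =
     (\<integral>x. pmf \<mu> x * pmf \<mu> x + pmf \<nu> x * pmf \<nu> x - 2 * (pmf \<mu> x * pmf \<nu> x) \<partial>count_space UNIV)"
    by (intro Bochner_Integration.integral_cong) (auto simp: power2_eq_square algebra_simps)
  then show ?thesis
    by (simp add: sqdist_def overlap_eq_integral integrable_pmf_mult)
qed

definition rtrans :: "('a, 'b) monoid_scheme \<Rightarrow> 'a \<Rightarrow> 'a pmf \<Rightarrow> 'a pmf" where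
  "rtrans G y \<mu> = map_pmf (\<lambda>x. x \<otimes>\<^bsub>G\<^esub> y) \<mu>"

text \<open>A convolution is a mixture of right translates; statements about convolution operators are
averages of statements about single translations.\<close>

lemma convolution_eq_bind: "convolution_pmf G \<mu> \<phi> = bind_pmf \<phi> (\<lambda>y. rtrans G y \<mu>)"
  unfolding convolution_pmf_def pair_pmf_def rtrans_def map_bind_pmf map_pmf_def bind_assoc_pmf
  by (subst bind_commute_pmf) (simp add: bind_return_pmf)

lemma overlap_convolution_left:
  "overlap (convolution_pmf G \<mu> \<phi>) \<nu> = measure_pmf.expectation \<phi> (\<lambda>y. overlap (rtrans G y \<mu>) \<nu>)"
  by (simp add: convolution_eq_bind overlap_bind_left)

abbreviation walk :: "('a, 'b) monoid_scheme \<Rightarrow> 'a pmf \<Rightarrow> nat \<Rightarrow> 'a pmf \<Rightarrow> 'a pmf" where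
  "walk G \<phi> n \<equiv> (\<lambda>\<mu>. convolution_pmf G \<mu> \<phi>) ^^ n"

lemma convolution_power_eq_walk: "convolution_power G \<phi> n = walk G \<phi> n (return_pmf \<one>\<^bsub>G\<^esub>)"
  by (induction n) auto

lemma convolution_bind: "convolution_pmf G (bind_pmf q F) \<phi> = bind_pmf q (\<lambda>k. convolution_pmf G (F k) \<phi>)"
  unfolding convolution_eq_bind rtrans_def map_bind_pmf by (rule bind_commute_pmf)

lemma walk_bind: "walk G \<phi> n (bind_pmf q F) = bind_pmf q (\<lambda>k. walk G \<phi> n (F k))"
  by (induction n) (auto simp: convolution_bind)

context group
begin

lemma set_rtrans: "set_pmf \<mu> \<subseteq> carrier G \<Longrightarrow> y \<in> carrier G \<Longrightarrow> set_pmf (rtrans G y \<mu>) \<subseteq> carrier G"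
  by (auto simp: rtrans_def)

lemma set_convolution:
  "set_pmf \<mu> \<subseteq> carrier G \<Longrightarrow> set_pmf \<phi> \<subseteq> carrier G \<Longrightarrow> set_pmf (convolution_pmf G \<mu> \<phi>) \<subseteq> carrier G"
  by (auto simp: convolution_pmf_def)

lemma set_walk:
  "set_pmf \<mu> \<subseteq> carrier G \<Longrightarrow> set_pmf \<phi> \<subseteq> carrier G \<Longrightarrow> set_pmf (walk G \<phi> n \<mu>) \<subseteq> carrier G"
  by (induction n) (simp_all add: set_convolution)

lemma overlap_rtrans:
  assumes "set_pmf \<mu> \<subseteq> carrier G" "set_pmf \<nu> \<subseteq> carrier G" "y \<in> carrier G"
  shows "overlap (rtrans G y \<mu>) (rtrans G y \<nu>) = overlap \<mu> \<nu>"
  unfolding overlap_def rtrans_def bind_map_pmf pmf.map_comp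
  by (intro arg_cong2[where f=pmf] bind_pmf_cong map_pmf_cong refl) (use assms in \<open>auto simp: subset_iff\<close>)

lemma overlap_rtrans_left:
  assumes "set_pmf \<mu> \<subseteq> carrier G" "set_pmf \<nu> \<subseteq> carrier G" "y \<in> carrier G"
  shows "overlap (rtrans G y \<mu>) \<nu> = overlap \<mu> (rtrans G (inv y) \<nu>)"
  unfolding overlap_def rtrans_def bind_map_pmf pmf.map_comp
  by (intro arg_cong2[where f=pmf] bind_pmf_cong map_pmf_cong refl)
     (use assms in \<open>auto simp: subset_iff inv_solve_right\<close>)

lemma rtrans_rtrans:
  assumes "set_pmf \<mu> \<subseteq> carrier G" "y \<in> carrier G" "z \<in> carrier G"
  shows "rtrans G z (rtrans G y \<mu>) = rtrans G (y \<otimes> z) \<mu>"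
  unfolding rtrans_def pmf.map_comp
  by (intro map_pmf_cong refl) (use assms in \<open>auto simp: subset_iff m_assoc\<close>)

lemma rtrans_one: "set_pmf \<mu> \<subseteq> carrier G \<Longrightarrow> rtrans G \<one> \<mu> = \<mu>"
  unfolding rtrans_def by (intro map_pmf_idI) auto

lemma sqdist_rtrans:
  assumes "set_pmf \<mu> \<subseteq> carrier G" "set_pmf \<nu> \<subseteq> carrier G" "y \<in> carrier G"
  shows "sqdist (rtrans G y \<mu>) (rtrans G y \<nu>) = sqdist \<mu> \<nu>"
  using assms by (simp add: sqdist_def overlap_rtrans)

lemma map_inv_symmetric_pmf:
  assumes "symmetric_pmf G \<phi>"
  shows "map_pmf (\<lambda>x. inv x) \<phi> = \<phi>"
proof (rule pmf_eqI)
  fix x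
  have sub: "set_pmf \<phi> \<subseteq> carrier G" using assms by (simp add: symmetric_pmf_def)
  show "pmf (map_pmf (\<lambda>x. inv x) \<phi>) x = pmf \<phi> x"
  proof (cases "x \<in> carrier G")
    case True
    have "pmf (map_pmf (\<lambda>x. inv x) \<phi>) (inv (inv x)) = pmf \<phi> (inv x)"
    proof (cases "inv x \<in> set_pmf \<phi>")
      case True
      have "inj_on (\<lambda>x. inv x) (set_pmf \<phi>)" using sub by (meson inj_on_subset inv_inj)
      then show ?thesis using True by (rule pmf_map_inj)
    next
      case False
      then have "inv (inv x) \<notin> set_pmf (map_pmf (\<lambda>x. inv x) \<phi>)"
        using sub \<open>x \<in> carrier G\<close> by auto
      then show ?thesis using False by (metis pmf_eq_0_set_pmf)
    qed
    then show ?thesis using True assms by (simp add: symmetric_pmf_def)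
  next
    case False
    then have "x \<notin> set_pmf \<phi>" "x \<notin> set_pmf (map_pmf (\<lambda>x. inv x) \<phi>)" using sub by auto
    then show ?thesis by (metis pmf_eq_0_set_pmf)
  qed
qed

text \<open>Convolution with a symmetric measure is self-adjoint: the adjoint of translation by
\<open>y\<close> is translation by its inverse, and both have the same weight.\<close>

lemma overlap_convolution_right:
  assumes \<phi>: "symmetric_pmf G \<phi>" and s: "set_pmf \<mu> \<subseteq> carrier G" "set_pmf \<nu> \<subseteq> carrier G"
  shows "overlap (convolution_pmf G \<mu> \<phi>) \<nu> = overlap \<mu> (convolution_pmf G \<nu> \<phi>)"
proof -
  have sub: "set_pmf \<phi> \<subseteq> carrier G" using assms by (simp add: symmetric_pmf_def)
  have "overlap (convolution_pmf G \<mu> \<phi>) \<nu> = measure_pmf.expectation \<phi> (\<lambda>y. overlap (rtrans G y \<mu>) \<nu>)"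
    by (rule overlap_convolution_left)
  also have "\<dots> = measure_pmf.expectation \<phi> (\<lambda>y. overlap (rtrans G (inv y) \<nu>) \<mu>)"
    by (intro integral_cong_AE)
       (use sub s in \<open>auto simp: AE_measure_pmf_iff overlap_rtrans_left overlap_commute[of \<mu>]\<close>)
  also have "\<dots> = measure_pmf.expectation (map_pmf (\<lambda>x. inv x) \<phi>) (\<lambda>y. overlap (rtrans G y \<nu>) \<mu>)"
    by simp
  also have "\<dots> = overlap (convolution_pmf G \<nu> \<phi>) \<mu>"
    by (simp add: map_inv_symmetric_pmf[OF \<phi>] overlap_convolution_left)
  finally show ?thesis by (simp add: overlap_commute)
qed

lemma overlap_walk_shift:
  assumes \<phi>: "symmetric_pmf G \<phi>" and s: "set_pmf \<mu> \<subseteq> carrier G" "set_pmf \<nu> \<subseteq> carrier G"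
  shows "overlap (walk G \<phi> (m + n) \<mu>) \<nu> = overlap (walk G \<phi> m \<mu>) (walk G \<phi> n \<nu>)"
  using s(2)
proof (induction n arbitrary: \<nu>)
  case (Suc n)
  have sub: "set_pmf \<phi> \<subseteq> carrier G" using assms by (simp add: symmetric_pmf_def)
  have "overlap (walk G \<phi> (m + Suc n) \<mu>) \<nu> = overlap (convolution_pmf G (walk G \<phi> (m + n) \<mu>) \<phi>) \<nu>"
    by simp
  also have "\<dots> = overlap (walk G \<phi> (m + n) \<mu>) (convolution_pmf G \<nu> \<phi>)"
    using \<phi> set_walk[OF s(1) sub] Suc.prems by (rule overlap_convolution_right)
  also have "\<dots> = overlap (walk G \<phi> m \<mu>) (walk G \<phi> n (convolution_pmf G \<nu> \<phi>))"
    using Suc.IH[OF set_convolution[OF Suc.prems sub]] .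
  also have "walk G \<phi> n (convolution_pmf G \<nu> \<phi>) = walk G \<phi> (Suc n) \<nu>"
    using funpow_swap1[of "\<lambda>\<mu>. convolution_pmf G \<mu> \<phi>" n \<nu>] by simp
  finally show ?case .
qed simp

lemma return_probability_eq_overlap:
  assumes \<phi>: "symmetric_pmf G \<phi>"
  shows "pmf (convolution_power G \<phi> (2 * n)) \<one> =
    overlap (walk G \<phi> n (return_pmf \<one>)) (walk G \<phi> n (return_pmf \<one>))"
  using overlap_walk_shift[OF \<phi>, of "return_pmf \<one>" "return_pmf \<one>" n n]
  by (simp add: convolution_power_eq_walk overlap_return mult_2)

lemma walk_return:
  assumes "set_pmf \<phi> \<subseteq> carrier G" "x \<in> carrier G"
  shows "walk G \<phi> n (return_pmf x) = map_pmf (\<lambda>z. x \<otimes> z) (walk G \<phi> n (return_pmf \<one>))"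
proof (induction n)
  case (Suc n)
  have w: "set_pmf (walk G \<phi> n (return_pmf \<one>)) \<subseteq> carrier G"
    using set_walk assms(1) by simp
  have "convolution_pmf G (map_pmf (\<lambda>z. x \<otimes> z) \<mu>) \<phi> = map_pmf (\<lambda>z. x \<otimes> z) (convolution_pmf G \<mu> \<phi>)"
    if "set_pmf \<mu> \<subseteq> carrier G" for \<mu>
    unfolding convolution_eq_bind map_bind_pmf rtrans_def pmf.map_comp
    by (intro bind_pmf_cong map_pmf_cong refl) (use that assms in \<open>auto simp: subset_iff m_assoc\<close>)
  from this[OF w] show ?case using Suc by simp
qed (use assms in simp)

lemma overlap_ltrans:
  assumes "set_pmf \<mu> \<subseteq> carrier G" "set_pmf \<nu> \<subseteq> carrier G" "y \<in> carrier G"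
  shows "overlap (map_pmf (\<lambda>z. y \<otimes> z) \<mu>) (map_pmf (\<lambda>z. y \<otimes> z) \<nu>) = overlap \<mu> \<nu>"
  unfolding overlap_def bind_map_pmf pmf.map_comp
  by (intro arg_cong2[where f=pmf] bind_pmf_cong map_pmf_cong refl) (use assms in \<open>auto simp: subset_iff\<close>)

text \<open>Walks started at \<open>x\<close> and at \<open>y\<close> overlap at most as much as two walks
started at the identity: the mixed overlap is at most the mean of the two diagonal ones, which
are equal by left invariance. An arbitrary initial law averages over such pairs.\<close>

lemma overlap_walk_le_return_probability:
  assumes \<phi>: "symmetric_pmf G \<phi>" and \<nu>: "set_pmf \<nu> \<subseteq> carrier G"
  shows "overlap (walk G \<phi> n \<nu>) (walk G \<phi> n \<nu>) \<le> pmf (convolution_power G \<phi> (2 * n)) \<one>"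
proof -
  have sub: "set_pmf \<phi> \<subseteq> carrier G" using assms by (simp add: symmetric_pmf_def)
  let ?w = "\<lambda>x. walk G \<phi> n (return_pmf x)"
  let ?p = "pmf (convolution_power G \<phi> (2 * n)) \<one>"
  have w1: "set_pmf (?w \<one>) \<subseteq> carrier G"
    using set_walk sub by simp
  have diag: "overlap (?w x) (?w x) = ?p" if x: "x \<in> carrier G" for x
    unfolding return_probability_eq_overlap[OF \<phi>] walk_return[OF sub x] by (rule overlap_ltrans[OF w1 w1 x])
  have le: "overlap (?w x) (?w y) \<le> ?p" if "x \<in> carrier G" "y \<in> carrier G" for x y
    using overlap_le_average[of "?w x" "?w y"] that by (simp add: diag)
  have b: "walk G \<phi> n \<nu> = bind_pmf \<nu> ?w"
    using walk_bind[of n G \<phi> \<nu> return_pmf] by (simp add: bind_return_pmf')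
  have avg: "measure_pmf.expectation \<nu> f \<le> ?p" if "\<And>x. x \<in> carrier G \<Longrightarrow> f x \<le> ?p" "\<And>x. 0 \<le> f x" "\<And>x. f x \<le> 1" for f
  proof -
    have "measure_pmf.expectation \<nu> f \<le> measure_pmf.expectation \<nu> (\<lambda>_. ?p)"
      by (intro integral_mono_AE)
         (use that \<nu> in \<open>auto intro!: measure_pmf.integrable_const_bound[where B=1] simp: AE_measure_pmf_iff\<close>)
    then show ?thesis by simp
  qed
  have 1: "overlap (?w x) (walk G \<phi> n \<nu>) \<le> ?p" if "x \<in> carrier G" for x
    unfolding overlap_commute[of "?w x"] unfolding b overlap_bind_left
    by (rule avg) (auto simp: le that overlap_nonneg overlap_le_1)
  show ?thesis
    by (subst (1) b, unfold overlap_bind_left, rule avg) (auto simp: 1 overlap_nonneg overlap_le_1)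
qed

end

section \<open>Word length and the tent test density\<close>

locale word_metric = group G for G (structure) +
  fixes S :: "'a set"
  assumes finite_generators: "finite S"
    and generators: "symmetric_generating_set G S"
begin

abbreviation len :: "'a \<Rightarrow> nat" where "len \<equiv> word_length G S"

definition ball :: "nat \<Rightarrow> 'a set" where "ball n = {g \<in> carrier G. len g \<le> n}"

abbreviation volume :: "nat \<Rightarrow> nat" where "volume n \<equiv> card (ball n)"

abbreviation eval_word :: "'a list \<Rightarrow> 'a" where "eval_word xs \<equiv> foldr (\<otimes>) xs \<one>"

lemma generators_carrier: "S \<subseteq> carrier G"
  using generators by (simp add: symmetric_generating_set_def)

lemma eval_word_closed: "set xs \<subseteq> S \<Longrightarrow> eval_word xs \<in> carrier G"
  using generators_carrier by (induction xs) auto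

lemma eval_word_append:
  "set xs \<subseteq> S \<Longrightarrow> set ys \<subseteq> S \<Longrightarrow> eval_word (xs @ ys) = eval_word xs \<otimes> eval_word ys"
  using generators_carrier by (induction xs) (auto simp: eval_word_closed m_assoc)

lemma eval_word_inv:
  "set xs \<subseteq> S \<Longrightarrow> inv (eval_word xs) = eval_word (rev (map (\<lambda>x. inv x) xs)) \<and> set (rev (map (\<lambda>x. inv x) xs)) \<subseteq> S"
proof (induction xs)
  case (Cons x xs)
  have x: "x \<in> carrier G" "inv x \<in> S" "inv x \<in> carrier G" using Cons.prems generators_carrier generators
    by (auto simp: symmetric_generating_set_def)
  let ?ys = "rev (map (\<lambda>x. inv x) xs)"
  have ys: "inv (eval_word xs) = eval_word ?ys" "set ?ys \<subseteq> S" using Cons by auto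
  have "eval_word (?ys @ [inv x]) = eval_word ?ys \<otimes> inv x"
    using eval_word_append[OF ys(2), of "[inv x]"] x by simp
  then show ?case using Cons.prems x ys
    by (simp add: inv_mult_group eval_word_closed)
qed simp

lemma ex_word: "g \<in> carrier G \<Longrightarrow> \<exists>xs. set xs \<subseteq> S \<and> eval_word xs = g"
proof -
  assume "g \<in> carrier G"
  then have "g \<in> generate G S" using generators by (simp add: symmetric_generating_set_def)
  then show ?thesis
  proof induction
    case one
    show ?case by (rule exI[of _ "[]"]) simp
  next
    case (incl h)
    then show ?case using generators_carrier by (intro exI[of _ "[h]"]) auto
  next
    case (inv h)
    then show ?case using generators_carrier generators
      by (intro exI[of _ "[inv h]"]) (auto simp: symmetric_generating_set_def)
  next
    case (eng h1 h2)
    then obtain xs ys where "set xs \<subseteq> S" "eval_word xs = h1" "set ys \<subseteq> S" "eval_word ys = h2" by blast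
    then show ?case by (intro exI[of _ "xs @ ys"]) (simp only: eval_word_append, simp)
  qed
qed

lemma len_le: "set xs \<subseteq> S \<Longrightarrow> len (eval_word xs) \<le> length xs"
  unfolding word_length_def by (rule Least_le) auto

lemma geodesic_word:
  assumes "g \<in> carrier G"
  obtains xs where "length xs = len g" "set xs \<subseteq> S" "eval_word xs = g"
proof -
  have "\<exists>n xs. length xs = n \<and> set xs \<subseteq> S \<and> eval_word xs = g" using ex_word[OF assms] by blast
  from LeastI_ex[OF this] that show ?thesis unfolding word_length_def by blast
qed

lemma len_one: "len \<one> = 0"
  using len_le[of "[]"] by simp

lemma len_mult: "x \<in> carrier G \<Longrightarrow> y \<in> carrier G \<Longrightarrow> len (x \<otimes> y) \<le> len x + len y"
proof -
  assume "x \<in> carrier G" "y \<in> carrier G"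
  then obtain xs ys where w: "length xs = len x" "set xs \<subseteq> S" "eval_word xs = x"
    "length ys = len y" "set ys \<subseteq> S" "eval_word ys = y" by (metis geodesic_word)
  have "len (eval_word (xs @ ys)) \<le> length (xs @ ys)" using w by (intro len_le) auto
  then show ?thesis using w by (simp only: eval_word_append length_append)
qed

lemma len_inv_le: "x \<in> carrier G \<Longrightarrow> len (inv x) \<le> len x"
proof -
  assume "x \<in> carrier G"
  then obtain xs where w: "length xs = len x" "set xs \<subseteq> S" "eval_word xs = x"
    by (metis geodesic_word)
  then show ?thesis using eval_word_inv[OF w(2)] len_le[of "rev (map (\<lambda>x. inv x) xs)"] by simp
qed

lemma len_inv: "x \<in> carrier G \<Longrightarrow> len (inv x) = len x"
  using len_inv_le[of x] len_inv_le[of "inv x"] by simp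

lemma len_le_right_translate:
  assumes "x \<in> carrier G" "y \<in> carrier G"
  shows "len x \<le> len (x \<otimes> y) + len y"
  using len_mult[of "x \<otimes> y" "inv y"] assms by (simp add: len_inv m_assoc)

lemma one_in_ball: "\<one> \<in> ball n"
  by (simp add: ball_def len_one)

lemma ball_carrier: "ball n \<subseteq> carrier G"
  by (auto simp: ball_def)

lemma ball_mono: "m \<le> n \<Longrightarrow> ball m \<subseteq> ball n"
  by (auto simp: ball_def)

lemma inv_in_ball: "x \<in> ball n \<Longrightarrow> inv x \<in> ball n"
  by (simp add: ball_def len_inv)

lemma finite_ball: "finite (ball n)"
proof (rule finite_subset)
  show "ball n \<subseteq> eval_word ` {xs. set xs \<subseteq> S \<and> length xs \<le> n}"
    unfolding ball_def by (auto elim!: geodesic_word)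
qed (simp add: finite_lists_length_le finite_generators)

lemma volume_pos: "0 < volume n"
  using one_in_ball finite_ball by (auto simp: card_gt_0_iff)

lemma volume_mono: "m \<le> n \<Longrightarrow> volume m \<le> volume n"
  by (intro card_mono finite_ball ball_mono)

lemma ball_mult: "x \<in> ball m \<Longrightarrow> y \<in> ball n \<Longrightarrow> x \<otimes> y \<in> ball (m + n)"
  using len_mult[of x y] by (auto simp: ball_def)

text \<open>A shortest word is cut after \<open>m\<close> letters. Products of small-ball elements fill
large balls, which is the only metric property of the group behind the comparison of scales.\<close>

lemma ball_split:
  assumes "g \<in> ball (m + n)"
  obtains x y where "x \<in> ball m" "y \<in> ball n" "g = x \<otimes> y"
proof -
  obtain xs where xs: "length xs = len g" "set xs \<subseteq> S" "eval_word xs = g"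
    using assms geodesic_word by (auto simp: ball_def)
  have s: "set (take m xs) \<subseteq> S" "set (drop m xs) \<subseteq> S"
    using xs(2) set_take_subset[of m xs] set_drop_subset[of m xs] by auto
  show ?thesis
  proof (rule that)
    show "eval_word (take m xs) \<in> ball m" "eval_word (drop m xs) \<in> ball n"
      using len_le[OF s(1)] len_le[OF s(2)] assms xs(1) s by (auto simp: ball_def eval_word_closed)
    show "g = eval_word (take m xs) \<otimes> eval_word (drop m xs)"
      using eval_word_append[OF s] xs(3) by simp
  qed
qed

text \<open>The numbers \<open>a\<^sub>k\<close>, the squared norms of the densities started from
\<open>\<nu>\<close>, are moments of a self-adjoint operator. By Cauchy--Schwarz they are
log-convex, so their successive ratios never fall below the first one, which the Rayleigh
quotient of \<open>\<nu>\<close> bounds from below. This replaces the spectral theorem.\<close>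

lemma return_probability_ge_Rayleigh:
  assumes \<phi>: "symmetric_pmf G \<phi>" and \<nu>: "set_pmf \<nu> \<subseteq> carrier G"
    and E: "overlap \<nu> \<nu> - overlap (convolution_pmf G \<nu> \<phi>) \<nu> \<le> \<epsilon> * overlap \<nu> \<nu>" and \<epsilon>: "\<epsilon> \<le> 1"
  shows "overlap \<nu> \<nu> * (1 - \<epsilon>) ^ (2 * n) \<le> pmf (convolution_power G \<phi> (2 * n)) \<one>"
proof -
  have sub: "set_pmf \<phi> \<subseteq> carrier G" using \<phi> by (simp add: symmetric_pmf_def)
  define w where "w k = walk G \<phi> k \<nu>" for k
  define a where "a k = overlap (w k) (w k)" for k
  define q where "q = (1 - \<epsilon>)\<^sup>2"
  have w: "set_pmf (w k) \<subseteq> carrier G" for k unfolding w_def by (rule set_walk[OF \<nu> sub])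
  have shift: "overlap (w (j + k)) \<nu> = overlap (w j) (w k)" for j k
    unfolding w_def by (rule overlap_walk_shift[OF \<phi> \<nu> \<nu>])
  have apos: "0 < a k" for k by (simp add: a_def overlap_self_pos)
  \<comment> \<open>Self-adjointness allows the \<open>2k+2\<close> steps to be split as \<open>k\<close> and
    \<open>k+2\<close>.\<close>
  have logconvex: "(a (Suc k))\<^sup>2 \<le> a k * a (Suc (Suc k))" for k
    using overlap_Cauchy_Schwarz[of "w k" "w (Suc (Suc k))"] shift[of "Suc k" "Suc k"] shift[of k "Suc (Suc k)"]
    by (simp add: a_def)
  have step: "q * a k \<le> a (Suc k)" for k
  proof (induction k)
    case 0
    have "0 \<le> (1 - \<epsilon>) * a 0" using \<epsilon> apos[of 0] by simp
    moreover have "(1 - \<epsilon>) * a 0 \<le> overlap (w 1) (w 0)"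
      using E by (simp add: a_def w_def algebra_simps)
    ultimately have "((1 - \<epsilon>) * a 0)\<^sup>2 \<le> (overlap (w 1) (w 0))\<^sup>2" by (intro power_mono)
    also have "\<dots> \<le> a 1 * a 0" using overlap_Cauchy_Schwarz by (simp add: a_def)
    finally have "(q * a 0) * a 0 \<le> a 1 * a 0" by (simp add: q_def power2_eq_square algebra_simps)
    then show ?case using apos[of 0] by simp
  next
    case (Suc k)
    have "(q * a (Suc k)) * a k = (q * a k) * a (Suc k)" by simp
    also have "\<dots> \<le> a (Suc k) * a (Suc k)" using Suc apos[of "Suc k"] by (intro mult_right_mono) auto
    also have "\<dots> \<le> a (Suc (Suc k)) * a k" using logconvex[of k] by (simp add: power2_eq_square mult.commute)
    finally show ?case using apos[of k] by simp
  qed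
  have "q ^ n * a 0 \<le> a n"
  proof (induction n)
    case (Suc n)
    have "q ^ Suc n * a 0 = q * (q ^ n * a 0)" by simp
    also have "\<dots> \<le> q * a n" using Suc by (intro mult_left_mono) (auto simp: q_def)
    also have "\<dots> \<le> a (Suc n)" by (rule step)
    finally show ?case .
  qed simp
  also have "a n \<le> pmf (convolution_power G \<phi> (2 * n)) \<one>"
    unfolding a_def w_def by (rule overlap_walk_le_return_probability[OF \<phi> \<nu>])
  finally show ?thesis unfolding power_mult by (simp add: a_def w_def q_def mult.commute)
qed

text \<open>A density and its translates have the same norm, so each squared distance is twice the squared
norm minus twice the overlap; the factor one half comes from here.\<close>

lemma energy_eq_expectation_sqdist:
  assumes \<phi>: "set_pmf \<phi> \<subseteq> carrier G" and \<nu>: "set_pmf \<nu> \<subseteq> carrier G"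
  shows "overlap \<nu> \<nu> - overlap (convolution_pmf G \<nu> \<phi>) \<nu>
    = measure_pmf.expectation \<phi> (\<lambda>y. sqdist \<nu> (rtrans G y \<nu>)) / 2"
proof -
  have i: "integrable (measure_pmf \<phi>) (\<lambda>y. overlap (rtrans G y \<nu>) \<nu>)"
    by (rule measure_pmf.integrable_const_bound[where B=1]) (auto simp: overlap_nonneg overlap_le_1)
  have "measure_pmf.expectation \<phi> (\<lambda>y. sqdist \<nu> (rtrans G y \<nu>))
    = measure_pmf.expectation \<phi> (\<lambda>y. 2 * overlap \<nu> \<nu> - 2 * overlap (rtrans G y \<nu>) \<nu>)"
    by (intro integral_cong_AE)
       (use \<phi> \<nu> in \<open>auto simp: AE_measure_pmf_iff sqdist_def overlap_rtrans overlap_commute[of \<nu> "rtrans G y \<nu>" for y]\<close>)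
  also have "\<dots> = 2 * overlap \<nu> \<nu> - 2 * overlap (convolution_pmf G \<nu> \<phi>) \<nu>"
    using i by (simp add: overlap_convolution_left)
  finally show ?thesis by simp
qed

definition tent_mass :: "nat \<Rightarrow> real" where
  "tent_mass m = (\<Sum>x\<in>ball m. real (m - len x))"

text \<open>A Lipschitz test density supported in a ball: moving by \<open>y\<close> changes the
unnormalised tent by at most \<open>min |y| m\<close> at every point. The indicator of the ball
would be useless here, since the boundary of a ball may carry a fixed proportion of its volume.\<close>

definition tent :: "nat \<Rightarrow> 'a pmf" where
  "tent m = embed_pmf (\<lambda>x. if x \<in> ball m then real (m - len x) / tent_mass m else 0)"

lemma tent_mass_bounds:
  assumes "1 \<le> m"
  shows "0 < tent_mass m" "tent_mass m \<le> real m * volume m"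
proof -
  have "0 < real (m - len \<one>)" using assms by (simp add: len_one)
  also have "\<dots> \<le> tent_mass m"
    unfolding tent_mass_def by (rule member_le_sum[OF one_in_ball]) (auto simp: finite_ball)
  finally show "0 < tent_mass m" .
  show "tent_mass m \<le> real m * volume m"
    unfolding tent_mass_def using sum_bounded_above[of "ball m" "\<lambda>x. real (m - len x)" "real m"] by (simp add: mult.commute)
qed

lemma pmf_tent:
  assumes "1 \<le> m"
  shows "pmf (tent m) x = (if x \<in> carrier G then real (m - len x) / tent_mass m else 0)"
proof -
  let ?f = "\<lambda>x. if x \<in> ball m then real (m - len x) / tent_mass m else 0"
  note pos = tent_mass_bounds(1)[OF assms]
  have "(\<integral>\<^sup>+x. ennreal (?f x) \<partial>count_space UNIV) = (\<Sum>x\<in>ball m. ennreal (?f x))"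
    by (rule nn_integral_count_space') (auto simp: finite_ball)
  also have "\<dots> = ennreal (\<Sum>x\<in>ball m. ?f x)"
    using pos by (intro sum_ennreal) auto
  also have "(\<Sum>x\<in>ball m. ?f x) = 1"
    using pos by (simp add: sum_divide_distrib[symmetric] tent_mass_def)
  finally have "pmf (tent m) x = ?f x"
    unfolding tent_def using pos by (intro pmf_embed_pmf) auto
  then show ?thesis by (auto simp: ball_def)
qed

lemma set_tent: "1 \<le> m \<Longrightarrow> set_pmf (tent m) \<subseteq> ball m"
  by (auto simp: set_pmf_iff pmf_tent ball_def split: if_splits)

text \<open>On the ball of half the radius the unnormalised tent is at least \<open>m/2\<close>.\<close>

lemma overlap_tent_ge:
  assumes "1 \<le> m"
  shows "(real m)\<^sup>2 / 4 * volume (m div 2) / (tent_mass m)\<^sup>2 \<le> overlap (tent m) (tent m)"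
proof -
  let ?p = "pmf (tent m)"
  note pos = tent_mass_bounds(1)[OF assms]
  have "(real m)\<^sup>2 / 4 * volume (m div 2) / (tent_mass m)\<^sup>2 = (\<Sum>x\<in>ball (m div 2). (real m / 2 / tent_mass m)\<^sup>2)"
    by (simp add: power2_eq_square)
  also have "\<dots> \<le> (\<Sum>x\<in>ball (m div 2). ?p x * ?p x)"
  proof (rule sum_mono)
    fix x assume x: "x \<in> ball (m div 2)"
    have "real m / 2 \<le> real (m - len x)" using x by (auto simp: ball_def)
    then have "real m / 2 / tent_mass m \<le> ?p x"
      using x pos assms by (simp add: pmf_tent ball_def divide_right_mono del: divide_divide_eq_left)
    then have "(real m / 2 / tent_mass m)\<^sup>2 \<le> (?p x)\<^sup>2" using pos by (intro power_mono) auto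
    then show "(real m / 2 / tent_mass m)\<^sup>2 \<le> ?p x * ?p x" by (simp add: power2_eq_square)
  qed
  also have "\<dots> \<le> (\<Sum>x\<in>ball m. ?p x * ?p x)"
    by (intro sum_mono2 finite_ball ball_mono) auto
  also have "\<dots> = (\<Sum>x\<in>{x. ?p x * ?p x \<noteq> 0}. ?p x * ?p x)"
    by (rule sum.mono_neutral_right) (use set_tent[OF assms] in \<open>auto simp: finite_ball set_pmf_iff\<close>)
  also have "\<dots> = (\<integral>x. ?p x * ?p x \<partial>count_space UNIV)"
    by (subst lebesgue_integral_count_space_finite_support, rule finite_subset[OF _ finite_ball[of m]])
       (use set_tent[OF assms] in \<open>auto simp: set_pmf_iff\<close>)
  finally show ?thesis by (simp add: overlap_eq_integral)
qed

text \<open>The difference is at most \<open>min |y| m\<close> up to normalisation, and it vanishes off the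
ball and its translate. The truncation at \<open>m\<close> is what makes long jumps affordable
although \<open>\<phi>\<close> may have no second moment.\<close>

lemma sqdist_tent_le:
  assumes m: "1 \<le> m" and y: "y \<in> carrier G"
  shows "sqdist (tent m) (rtrans G y (tent m)) \<le> 2 * volume m * (real (min (len y) m))\<^sup>2 / (tent_mass m)\<^sup>2"
proof -
  let ?p = "pmf (tent m)" and ?r = "pmf (rtrans G y (tent m))"
  let ?A = "ball m \<union> (\<lambda>x. x \<otimes> y) ` ball m"
  let ?K = "(real (min (len y) m) / tent_mass m)\<^sup>2"
  note pos = tent_mass_bounds(1)[OF m]
  have st: "set_pmf (tent m) \<subseteq> carrier G" using set_tent[OF m] ball_carrier by blast
  have fin: "finite ?A" by (simp add: finite_ball)
  have r: "?r x = ?p (x \<otimes> inv y)" if "x \<in> carrier G" for x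
  proof -
    have "?r x = overlap (rtrans G y (tent m)) (return_pmf x)" by (simp add: overlap_return)
    also have "\<dots> = overlap (tent m) (rtrans G (inv y) (return_pmf x))"
      using st that y by (intro overlap_rtrans_left) auto
    also have "\<dots> = ?p (x \<otimes> inv y)" by (simp add: rtrans_def overlap_return)
    finally show ?thesis .
  qed
  have pt: "(?p x - ?r x)\<^sup>2 \<le> ?K * indicator ?A x" for x
  proof (cases "x \<in> ?A")
    case True
    then have x: "x \<in> carrier G" using y by (auto simp: ball_def)
    then have xy: "x \<otimes> inv y \<in> carrier G" using y by simp
    have "len x \<le> len (x \<otimes> inv y) + len y" "len (x \<otimes> inv y) \<le> len x + len y"
      using len_le_right_translate[OF x, of "inv y"] len_mult[OF x, of "inv y"] y by (auto simp: len_inv)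
    then have "\<bar>real (m - len x) - real (m - len (x \<otimes> inv y))\<bar> \<le> real (min (len y) m)" by linarith
    then have "\<bar>?p x - ?r x\<bar> \<le> real (min (len y) m) / tent_mass m"
      using x xy m pos by (simp add: r pmf_tent diff_divide_distrib[symmetric] divide_right_mono)
    then have "\<bar>?p x - ?r x\<bar>\<^sup>2 \<le> ?K" by (intro power_mono) auto
    then show ?thesis using True by simp
  next
    case False
    have "?p x = 0" "?r x = 0"
      using False set_tent[OF m] by (auto simp: pmf_eq_0_set_pmf rtrans_def)
    then show ?thesis using False by simp
  qed
  have int: "integrable (count_space UNIV) (\<lambda>x. ?K * indicator ?A x)"
    using fin by (intro integrable_mult_right) (simp add: integrable_real_indicator less_top[symmetric])
  have "sqdist (tent m) (rtrans G y (tent m)) \<le> (\<integral>x. ?K * indicator ?A x \<partial>count_space UNIV)"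
    unfolding sqdist_eq_integral by (rule integral_mono'[OF int pt]) simp
  also have "\<dots> = ?K * card ?A"
    using fin by simp
  also have "\<dots> \<le> ?K * real (2 * volume m)"
  proof -
    have "card ?A \<le> card (ball m) + card ((\<lambda>x. x \<otimes> y) ` ball m)" by (rule card_Un_le)
    also have "\<dots> \<le> 2 * volume m" using card_image_le[OF finite_ball, of "\<lambda>x. x \<otimes> y" m] by simp
    finally have "real (card ?A) \<le> real (2 * volume m)" by simp
    then show ?thesis by (rule mult_left_mono) simp
  qed
  finally show ?thesis by (simp add: power_divide algebra_simps)
qed

text \<open>The layer-cake formula, with a square written as the sum of the first odd numbers.\<close>

lemma expectation_truncated_square:
  fixes N :: "'x \<Rightarrow> nat"
  shows "measure_pmf.expectation \<phi> (\<lambda>y. (real (min (N y) m))\<^sup>2)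
    = (\<Sum>j<m. (2 * real j + 1) * measure_pmf.prob \<phi> {y. j < N y})"
proof -
  have pt: "(real (min k m))\<^sup>2 = (\<Sum>j<m. (2 * real j + 1) * (if j < k then 1 else 0))" for k
  proof (induction m)
    case (Suc m)
    show ?case
    proof (cases "m < k")
      case True
      then have "min k (Suc m) = Suc m" "min k m = m" by auto
      then show ?thesis using Suc True by (simp add: power2_eq_square algebra_simps)
    next
      case False
      then have "min k (Suc m) = k" "min k m = k" by auto
      then show ?thesis using Suc False by simp
    qed
  qed simp
  have "measure_pmf.expectation \<phi> (\<lambda>y. (real (min (N y) m))\<^sup>2)
    = measure_pmf.expectation \<phi> (\<lambda>y. \<Sum>j<m. (2 * real j + 1) * indicator {y. j < N y} y)"
  proof -
    have "(\<Sum>j<m. (2 * real j + 1) * (if j < N y then 1 else 0)) = (\<Sum>j<m. (2 * real j + 1) * indicator {y. j < N y} y)" for y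
      by (intro sum.cong refl) (simp add: indicator_def)
    then show ?thesis unfolding pt by simp
  qed
  also have "\<dots> = (\<Sum>j<m. measure_pmf.expectation \<phi> (\<lambda>y. (2 * real j + 1) * indicator {y. j < N y} y))"
    by (intro Bochner_Integration.integral_sum integrable_mult_right measure_pmf.integrable_const_bound[where B=1]) 
       (simp_all add: indicator_def)
  also have "\<dots> = (\<Sum>j<m. (2 * real j + 1) * measure_pmf.prob \<phi> {y. j < N y})"
    by simp
  finally show ?thesis .
qed

end

section \<open>The lower bound at a given scale\<close>

lemma exp_le_one_minus:
  fixes x :: real
  assumes "0 \<le> x" "x \<le> 1 / 2"
  shows "exp (- (2 * x)) \<le> 1 - x"
proof -
  have "x * (2 * x) \<le> x * 1" using assms by (intro mult_left_mono) auto
  then have "1 \<le> (1 + 2 * x) * (1 - x)" by (simp add: algebra_simps)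
  also have "\<dots> \<le> exp (2 * x) * (1 - x)" using assms by (intro mult_right_mono exp_ge_add_one_self) auto
  finally show ?thesis by (simp add: exp_minus field_simps)
qed

locale moment_scale =
  fixes \<rho> :: "real \<Rightarrow> real"
  assumes rho_cont: "continuous_on {0..} \<rho>" and rho_mono_on: "mono_on {0..} \<rho>" and rho_ge_1: "\<forall>t\<ge>0. \<rho> t \<ge> 1"
begin

lemma rho_mono: "0 \<le> s \<Longrightarrow> s \<le> t \<Longrightarrow> \<rho> s \<le> \<rho> t"
  using rho_mono_on by (auto simp: mono_on_def)

lemma rho_pos: "0 \<le> t \<Longrightarrow> 0 < \<rho> t"
  using rho_ge_1 by (meson less_le_trans zero_less_one)

text \<open>With the weak moment condition, \<open>I m\<close> bounds, up to a constant, the second moment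
of a jump truncated at length \<open>m\<close>; the function \<open>M\<close> is then the
diffusive time needed to travel the distance \<open>m\<close>.\<close>

definition I :: "real \<Rightarrow> real" where "I t = integral {0..t} (\<lambda>s. s / \<rho> s)"

abbreviation "M \<equiv> scale_M \<rho>"

lemma M_eq: "M t = t\<^sup>2 / I t"
  by (simp add: scale_M_def I_def)

lemma integrand_integrable: "0 \<le> a \<Longrightarrow> (\<lambda>s. s / \<rho> s) integrable_on {a..b}"
  by (intro integrable_continuous_interval continuous_intros continuous_on_subset[OF rho_cont])
     (auto, metis rho_pos less_irrefl order_trans)

lemma I_increment: "0 \<le> a \<Longrightarrow> a \<le> b \<Longrightarrow> I b = I a + integral {a..b} (\<lambda>s. s / \<rho> s)"
  unfolding I_def using Henstock_Kurzweil_Integration.integral_combine[OF _ _ integrand_integrable[of 0 b], of a] by simp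

text \<open>On \<open>[a,b]\<close> the integrand lies between \<open>s / \<rho> b\<close> and \<open>s /
\<rho> a\<close>.\<close>

lemma I_increment_bounds:
  assumes "0 \<le> a" "a \<le> b"
  shows "(b\<^sup>2 - a\<^sup>2) / (2 * \<rho> b) \<le> I b - I a" "I b - I a \<le> (b\<^sup>2 - a\<^sup>2) / (2 * \<rho> a)"
proof -
  have 1: "((\<lambda>s. s / c) has_integral (b\<^sup>2 - a\<^sup>2) / (2 * c)) {a..b}" for c :: real
    using has_integral_divide[OF ident_has_integral[OF assms(2)], of c] by simp
  have 2: "((\<lambda>s. s / \<rho> s) has_integral (I b - I a)) {a..b}"
    using integrand_integrable[of a b] assms I_increment[of a b] by (simp add: has_integral_integral)
  show "(b\<^sup>2 - a\<^sup>2) / (2 * \<rho> b) \<le> I b - I a"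
    using assms by (intro has_integral_le[OF 1 2] divide_left_mono rho_mono mult_pos_pos rho_pos) auto
  show "I b - I a \<le> (b\<^sup>2 - a\<^sup>2) / (2 * \<rho> a)"
    using assms by (intro has_integral_le[OF 2 1] divide_left_mono rho_mono mult_pos_pos rho_pos) auto
qed

lemma I_0: "I 0 = 0"
  by (simp add: I_def)

lemma I_mono: "0 \<le> a \<Longrightarrow> a \<le> b \<Longrightarrow> I a \<le> I b"
proof -
  assume ab: "0 \<le> a" "a \<le> b"
  have "0 \<le> (b\<^sup>2 - a\<^sup>2) / (2 * \<rho> b)" using ab rho_pos[of b] by (simp add: power_mono)
  then show ?thesis using I_increment_bounds(1)[OF ab] by linarith
qed

lemma I_ge: "0 \<le> t \<Longrightarrow> t\<^sup>2 / (2 * \<rho> t) \<le> I t"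
  using I_increment_bounds(1)[of 0 t] by (simp add: I_0)

lemma I_le: "0 \<le> t \<Longrightarrow> I t \<le> t\<^sup>2 / (2 * \<rho> 0)"
  using I_increment_bounds(2)[of 0 t] by (simp add: I_0)

lemma I_pos: "0 < t \<Longrightarrow> 0 < I t"
proof -
  assume t: "0 < t"
  then have "0 < t\<^sup>2 / (2 * \<rho> t)" using rho_pos[of t] by simp
  then show ?thesis using I_ge[of t] t by linarith
qed

lemma I_scaled:
  assumes "0 < a" "0 \<le> t"
  shows "I (a * t) = a\<^sup>2 * integral {0..t} (\<lambda>s. s / \<rho> (a * s))"
proof -
  have "integral ((\<lambda>x. x / a) ` {0..a * t}) (\<lambda>x. (a * x) / \<rho> (a * x)) = I (a * t) / a"
    using integral_stretch_real[of a 0 "a * t" "\<lambda>s. s / \<rho> s"] assms by (simp add: I_def)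
  moreover have "(\<lambda>x. x / a) ` {0..a * t} = {0..t}" using assms by simp
  moreover have "integral {0..t} (\<lambda>x. (a * x) / \<rho> (a * x)) = a * integral {0..t} (\<lambda>s. s / \<rho> (a * s))"
    by (subst Henstock_Kurzweil_Integration.integral_mult_right[symmetric]) simp
  ultimately show ?thesis using assms by (simp add: power2_eq_square field_simps)
qed

lemma scaled_integrable: "0 < a \<Longrightarrow> 0 \<le> s \<Longrightarrow> (\<lambda>s. s / \<rho> (a * s)) integrable_on {s..t}"
proof (rule integrable_continuous_interval)
  assume a: "0 < a" "0 \<le> s"
  have "continuous_on {s..t} (\<lambda>s. \<rho> (a * s))"
    using a by (intro continuous_on_compose2[OF rho_cont] continuous_intros) auto
  moreover have "\<rho> (a * x) \<noteq> 0" if "x \<in> {s..t}" for x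
    using rho_pos[of "a * x"] that a by auto
  ultimately show "continuous_on {s..t} (\<lambda>s. s / \<rho> (a * s))"
    by (intro continuous_intros) auto
qed

text \<open>After the substitution the integrand is \<open>s / \<rho> (a s)\<close>, which decreases in
\<open>a\<close>. This makes \<open>M\<close> monotone.\<close>

lemma I_scaled_le:
  assumes "1 \<le> a" "0 \<le> t"
  shows "I (a * t) \<le> a\<^sup>2 * I t"
proof -
  have "integral {0..t} (\<lambda>s. s / \<rho> (a * s)) \<le> I t"
    unfolding I_def using assms
    by (intro integral_le integrand_integrable scaled_integrable divide_left_mono rho_mono mult_pos_pos rho_pos)
       (auto simp: mult_le_cancel_right1)
  then show ?thesis using assms by (simp add: I_scaled mult_left_mono)
qed

lemma M_pos: "0 < t \<Longrightarrow> 0 < M t"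
  by (simp add: M_eq I_pos)

lemma M_mono: "0 < s \<Longrightarrow> s \<le> t \<Longrightarrow> M s \<le> M t"
proof -
  assume st: "0 < s" "s \<le> t"
  have "I (t / s * s) \<le> (t / s)\<^sup>2 * I s" using st by (intro I_scaled_le) auto
  then have "s\<^sup>2 * I t \<le> t\<^sup>2 * I s" using st by (simp add: field_simps)
  then show ?thesis using st I_pos[of s] I_pos[of t] by (simp add: M_eq field_simps)
qed

lemma M_le: "0 < t \<Longrightarrow> M t \<le> 2 * \<rho> t"
  using I_ge[of t] I_pos[of t] rho_pos[of t] by (simp add: M_eq field_simps)

text \<open>The term with index \<open>j \<ge> 1\<close> is at most six times the integral over
\<open>[j-1,j]\<close>, where \<open>\<rho>\<close> is at most \<open>\<rho> j\<close>. The term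
\<open>j = 0\<close> has no interval to its left and is compared with \<open>I 1\<close>, at the
price of a factor \<open>2 \<rho> 1\<close>.\<close>

lemma sum_le_I:
  assumes "1 \<le> m"
  shows "(\<Sum>j<m. (2 * real j + 1) / \<rho> (real j)) \<le> (6 + 2 * \<rho> 1) * I (real m)"
proof -
  have "(\<Sum>j<Suc k. (2 * real j + 1) / \<rho> (real j)) \<le> 1 + 6 * I (real k)" for k
  proof (induction k)
    case 0
    then show ?case using rho_ge_1 rho_pos[of 0] by (simp add: I_0)
  next
    case (Suc k)
    have "(2 * real (Suc k) + 1) / \<rho> (real (Suc k)) \<le> 6 * (((real (Suc k))\<^sup>2 - (real k)\<^sup>2) / (2 * \<rho> (real (Suc k))))"
      using rho_pos[of "real (Suc k)"] by (simp add: field_simps power2_eq_square)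
    also have "\<dots> \<le> 6 * (I (real (Suc k)) - I (real k))"
      by (intro mult_left_mono I_increment_bounds(1)) auto
    finally show ?case using Suc by simp
  qed
  from this[of "m - 1"] have "(\<Sum>j<m. (2 * real j + 1) / \<rho> (real j)) \<le> 1 + 6 * I (real (m - 1))"
    using assms by simp
  also have "I (real (m - 1)) \<le> I (real m)" by (intro I_mono) auto
  also have "1 \<le> 2 * \<rho> 1 * I 1" using I_ge[of 1] rho_pos[of 1] by (simp add: field_simps)
  also have "I 1 \<le> I (real m)" using assms by (intro I_mono) auto
  finally show ?thesis using rho_pos[of 1] by (simp add: algebra_simps)
qed

end

locale polynomial_word_metric = word_metric +
  fixes D :: real
  assumes D_pos: "0 < D" and growth: "polynomial_growth G S D"
begin

text \<open>The hypothesis speaks about large radii and allows a dilation. A dilation only changes the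
constants of a power, and the finitely many small radii are absorbed because every ball is
finite and nonempty.\<close>

lemma volume_bounds:
  obtains c C where "0 < c" "0 < C"
    "\<And>m. 1 \<le> m \<Longrightarrow> c * real m powr D \<le> real (volume m)"
    "\<And>m. 1 \<le> m \<Longrightarrow> real (volume m) \<le> C * real m powr D"
proof -
  define v where "v r = real (card {g \<in> carrier G. real (len g) \<le> r})" for r
  have v: "v (real m) = real (volume m)" for m by (simp add: v_def ball_def)
  from growth obtain c1 c2 c3 c4 where c: "c1 > 0" "c2 > 0" "c3 > 0" "c4 > 0"
    and ev: "\<forall>\<^sub>F t in at_top. c1 * v (c2 * t) \<le> t powr D \<and> t powr D \<le> c3 * v (c4 * t)"
    unfolding polynomial_growth_def sim_infinity_def v_def by blast
  from ev obtain T where T: "T \<ge> 1" "\<And>t. t \<ge> T \<Longrightarrow> c1 * v (c2 * t) \<le> t powr D \<and> t powr D \<le> c3 * v (c4 * t)"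
    unfolding eventually_at_top_linorder by (metis max.cobounded1 max.cobounded2 order_trans)
  define K where "K = real (volume (nat \<lceil>c2 * T\<rceil>))"
  define C where "C = K + c2 powr (-D) / c1"
  define c where "c = min (c4 powr (-D) / c3) ((c4 * T) powr (-D))"
  have K: "K > 0" by (simp add: K_def volume_pos)
  show ?thesis
  proof (rule that[of c C])
    show "0 < c" using c T by (simp add: c_def)
    show "0 < C" using c K by (simp add: C_def add_pos_nonneg)
    fix m :: nat assume m: "1 \<le> m"
    have m1: "1 \<le> real m powr D" using m D_pos by (simp add: ge_one_powr_ge_zero)
    show "c * real m powr D \<le> real (volume m)"
    proof (cases "c4 * T \<le> real m")
      case True
      then have "(real m / c4) powr D \<le> c3 * v (real m)"
        using T(2)[of "real m / c4"] c by (simp add: field_simps)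
      then have "c4 powr (-D) / c3 * real m powr D \<le> real (volume m)"
        using c m by (simp add: v powr_divide powr_minus field_simps)
      moreover have "c * real m powr D \<le> c4 powr (-D) / c3 * real m powr D"
        using m1 by (intro mult_right_mono) (auto simp: c_def)
      ultimately show ?thesis by linarith
    next
      case False
      have "c * real m powr D \<le> (c4 * T) powr (-D) * real m powr D"
        using m1 by (intro mult_right_mono) (auto simp: c_def)
      also have "\<dots> \<le> (c4 * T) powr (-D) * (c4 * T) powr D"
        using False D_pos by (intro mult_left_mono powr_mono2) auto
      also have "\<dots> = 1" using c T by (simp add: powr_minus)
      also have "1 \<le> real (volume m)" using volume_pos[of m] by linarith
      finally show ?thesis .
    qed
    show "real (volume m) \<le> C * real m powr D"
    proof (cases "c2 * T \<le> real m")
      case True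
      then have "c1 * v (real m) \<le> (real m / c2) powr D"
        using T(2)[of "real m / c2"] c by (simp add: field_simps)
      then have "real (volume m) \<le> c2 powr (-D) / c1 * real m powr D"
        using c m by (simp add: v powr_divide powr_minus field_simps)
      also have "\<dots> \<le> C * real m powr D"
        using m1 K by (intro mult_right_mono) (auto simp: C_def)
      finally show ?thesis .
    next
      case False
      then have "volume m \<le> volume (nat \<lceil>c2 * T\<rceil>)" by (intro volume_mono) linarith
      then have "real (volume m) \<le> K * 1" by (simp add: K_def)
      also have "\<dots> \<le> C * real m powr D"
        using m1 K c by (intro mult_mono) (auto simp: C_def)
      finally show ?thesis .
    qed
  qed
qed

text \<open>The radius \<open>m = 1\<close> is separate because its half is rounded down to
\<open>0\<close>.\<close>

lemma volume_half_ge: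
  obtains c where "0 < c" "\<And>m. 1 \<le> m \<Longrightarrow> c * real m powr D \<le> real (volume (m div 2))"
proof -
  obtain c C where c: "0 < c" "0 < C"
    "\<And>m. 1 \<le> m \<Longrightarrow> c * real m powr D \<le> real (volume m)"
    "\<And>m. 1 \<le> m \<Longrightarrow> real (volume m) \<le> C * real m powr D" by (rule volume_bounds) blast
  define c' where "c' = min 1 (c * (1/3) powr D)"
  show ?thesis
  proof (rule that[of c'])
    show "0 < c'" using c by (simp add: c'_def)
    fix m :: nat assume m: "1 \<le> m"
    show "c' * real m powr D \<le> real (volume (m div 2))"
    proof (cases "m = 1")
      case True
      then show ?thesis using volume_pos[of 0] by (simp add: c'_def Suc_le_eq min.coboundedI1)
    next
      case False
      have "c' * real m powr D \<le> c * (1/3) powr D * real m powr D" by (intro mult_right_mono) (auto simp: c'_def)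
      also have "\<dots> = c * (real m / 3) powr D" by (simp add: powr_divide)
      also have "\<dots> \<le> c * real (m div 2) powr D"
      proof -
        have "m \<le> 3 * (m div 2)" using m False by presburger
        then have "real m / 3 \<le> real (m div 2)" by linarith
        then show ?thesis using c D_pos by (intro mult_left_mono powr_mono2) auto
      qed
      also have "\<dots> \<le> real (volume (m div 2))" using m False by (intro c(3)) auto
      finally show ?thesis .
    qed
  qed
qed

end

locale random_walk_setting = polynomial_word_metric + moment_scale
begin

text \<open>The competitors in the infimum that defines \<open>Phi_tilde\<close>.\<close>

definition admissible :: "'a pmf \<Rightarrow> bool" where
  "admissible \<phi> \<longleftrightarrow> symmetric_pmf G \<phi> \<and> weak_moment G S \<rho> \<phi> \<le> ennreal (2 * \<rho> 0)"

lemma admissible_tail: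
  assumes "admissible \<phi>"
  shows "measure_pmf.prob \<phi> {y. j < len y} \<le> 4 * \<rho> 0 / \<rho> (real j)"
proof -
  \<comment> \<open>The moment condition controls \<open>\<rho> > s\<close> strictly, and
    \<open>\<rho>\<close> may be constant to the right of \<open>j\<close>; a level below
    \<open>\<rho> j\<close> is therefore needed, and half of it costs only the factor two.\<close>
  define s where "s = \<rho> (real j) / 2"
  have s: "s > 0" "s < \<rho> (real j)" using rho_pos[of "real j"] by (auto simp: s_def)
  let ?A = "{g \<in> carrier G. \<rho> (real (len g)) > s}"
  have "ennreal (s * measure_pmf.prob \<phi> ?A) \<le> weak_moment G S \<rho> \<phi>"
    unfolding weak_moment_def using s by (intro SUP_upper) auto
  also have "\<dots> \<le> ennreal (2 * \<rho> 0)" using assms by (simp add: admissible_def)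
  finally have 1: "s * measure_pmf.prob \<phi> ?A \<le> 2 * \<rho> 0"
    using rho_pos[of 0] by (simp add: ennreal_le_iff)
  have "measure_pmf.prob \<phi> {y. j < len y} \<le> measure_pmf.prob \<phi> ?A"
  proof (rule measure_pmf.finite_measure_mono_AE)
    show "AE y in measure_pmf \<phi>. y \<in> {y. j < len y} \<longrightarrow> y \<in> ?A"
      unfolding AE_measure_pmf_iff
    proof (intro ballI impI)
      fix y assume y: "y \<in> set_pmf \<phi>" "y \<in> {y. j < len y}"
      have "s < \<rho> (real (len y))" using s(2) rho_mono[of "real j" "real (len y)"] y(2) by auto
      then show "y \<in> ?A" using y assms by (auto simp: admissible_def symmetric_pmf_def)
    qed
  qed simp
  also have "\<dots> \<le> 2 * \<rho> 0 / s" using 1 s by (simp add: field_simps)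
  finally show ?thesis by (simp add: s_def)
qed

text \<open>The tent of radius \<open>m\<close> has energy at most \<open>C / M(m)\<close> times its squared
norm: the numerator is the truncated second moment, of order \<open>I m\<close>, times the
volume of the ball, the denominator is \<open>m\<^sup>2\<close> times the volume of the half
ball, and the volumes are comparable by polynomial growth. The prefactor
\<open>m\<^bsup>-D\<^esup>\<close> is the order of the initial squared norm.\<close>

theorem return_probability_ge:
  obtains c C where "0 < c" "0 < C"
    "\<And>\<phi> m n. admissible \<phi> \<Longrightarrow> 1 \<le> m \<Longrightarrow> C / M (real m) \<le> 1 / 2 \<Longrightarrow>
       c * real m powr (-D) * exp (- (4 * C * real n / M (real m))) \<le> pmf (convolution_power G \<phi> (2 * n)) \<one>"
proof -
  obtain c0 C0 where v: "0 < c0" "0 < C0"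
    "\<And>m. 1 \<le> m \<Longrightarrow> c0 * real m powr D \<le> real (volume m)"
    "\<And>m. 1 \<le> m \<Longrightarrow> real (volume m) \<le> C0 * real m powr D" by (rule volume_bounds) blast
  obtain c' where c': "0 < c'" "\<And>m. 1 \<le> m \<Longrightarrow> c' * real m powr D \<le> real (volume (m div 2))"
    by (rule volume_half_ge) blast
  define A where "A = 4 * \<rho> 0 * (6 + 2 * \<rho> 1)"
  have A: "0 < A" using rho_pos[of 0] rho_pos[of 1] by (auto simp: A_def intro!: mult_pos_pos add_pos_pos)
  define C where "C = 4 * A * C0 / c'"
  define c where "c = c' / (4 * C0\<^sup>2)"
  have C: "0 < C" using A v c' by (simp add: C_def)
  show ?thesis
  proof (rule that[of c C])
    show "0 < c" using v c' by (simp add: c_def)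
    show "0 < C" by (rule C)
    fix \<phi> and m n :: nat
    assume \<phi>: "admissible \<phi>" and m: "1 \<le> m" and small: "C / M (real m) \<le> 1 / 2"
    have sym: "symmetric_pmf G \<phi>" and sub: "set_pmf \<phi> \<subseteq> carrier G"
      using \<phi> by (auto simp: admissible_def symmetric_pmf_def)
    have st: "set_pmf (tent m) \<subseteq> carrier G" using set_tent[OF m] ball_carrier by blast
    define F where "F = tent_mass m"
    have F: "0 < F" "F \<le> real m * volume m" using tent_mass_bounds[OF m] by (auto simp: F_def)
    define V V2 where "V = real (volume m)" and "V2 = real (volume (m div 2))"
    have V: "0 < V" "V \<le> C0 * real m powr D" "0 < V2" "c' * real m powr D \<le> V2"
      using v(4)[OF m] c'(2)[OF m] volume_pos by (auto simp: V_def V2_def)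
    let ?Q = "overlap (tent m) (tent m)"
    have Q: "(real m)\<^sup>2 / 4 * V2 / F\<^sup>2 \<le> ?Q" using overlap_tent_ge[OF m] by (simp add: V2_def F_def)
    have Im: "0 < I (real m)" using m by (simp add: I_pos)
    have int: "integrable (measure_pmf \<phi>) (\<lambda>y. (real (min (len y) m))\<^sup>2)"
      by (rule measure_pmf.integrable_const_bound[where B="(real m)\<^sup>2"]) (auto intro!: power_mono)
    have "measure_pmf.expectation \<phi> (\<lambda>y. sqdist (tent m) (rtrans G y (tent m)))
      \<le> measure_pmf.expectation \<phi> (\<lambda>y. 2 * V / F\<^sup>2 * (real (min (len y) m))\<^sup>2)"
    proof (rule integral_mono_AE')
      show "integrable (measure_pmf \<phi>) (\<lambda>y. 2 * V / F\<^sup>2 * (real (min (len y) m))\<^sup>2)"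
        by (intro integrable_mult_right int)
      show "AE y in measure_pmf \<phi>. sqdist (tent m) (rtrans G y (tent m)) \<le> 2 * V / F\<^sup>2 * (real (min (len y) m))\<^sup>2"
        unfolding AE_measure_pmf_iff using sqdist_tent_le[OF m] sub by (auto simp: V_def F_def)
      show "AE y in measure_pmf \<phi>. 0 \<le> 2 * V / F\<^sup>2 * (real (min (len y) m))\<^sup>2" using V by simp
    qed
    also have "\<dots> = 2 * V / F\<^sup>2 * (\<Sum>j<m. (2 * real j + 1) * measure_pmf.prob \<phi> {y. j < len y})"
      by (simp add: expectation_truncated_square)
    also have "(\<Sum>j<m. (2 * real j + 1) * measure_pmf.prob \<phi> {y. j < len y})
      \<le> (\<Sum>j<m. (2 * real j + 1) * (4 * \<rho> 0 / \<rho> (real j)))"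
      by (intro sum_mono mult_left_mono admissible_tail \<phi>) auto
    also have "\<dots> = 4 * \<rho> 0 * (\<Sum>j<m. (2 * real j + 1) / \<rho> (real j))"
      by (simp add: sum_distrib_left mult.commute mult.left_commute)
    also have "\<dots> \<le> A * I (real m)"
      unfolding A_def using mult_left_mono[OF sum_le_I[OF m], of "4 * \<rho> 0"] rho_pos[of 0] by (simp add: mult.assoc)
    finally have "measure_pmf.expectation \<phi> (\<lambda>y. sqdist (tent m) (rtrans G y (tent m))) / 2 \<le> V / F\<^sup>2 * (A * I (real m))"
      using V F by (simp add: mult_left_mono divide_right_mono mult.commute mult.left_commute)
    then have E: "?Q - overlap (convolution_pmf G (tent m) \<phi>) (tent m) \<le> V / F\<^sup>2 * (A * I (real m))"
      by (simp add: energy_eq_expectation_sqdist[OF sub st])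
    define \<epsilon> where "\<epsilon> = C / M (real m)"
    have eps: "0 \<le> \<epsilon>" "\<epsilon> \<le> 1 / 2" using small C M_pos[of "real m"] m by (auto simp: \<epsilon>_def)
    have "V * c' \<le> C0 * V2"
    proof -
      have "V * c' \<le> C0 * real m powr D * c'" using V c' by (intro mult_right_mono) auto
      also have "\<dots> = C0 * (c' * real m powr D)" by simp
      also have "\<dots> \<le> C0 * V2" using V v by (intro mult_left_mono) auto
      finally show ?thesis .
    qed
    then have "V \<le> C0 / c' * V2" using c' by (simp add: field_simps)
    then have "V / F\<^sup>2 * (A * I (real m)) \<le> (C0 / c' * V2) / F\<^sup>2 * (A * I (real m))"
      using F A Im by (intro mult_right_mono divide_right_mono) auto
    also have "\<dots> = \<epsilon> * ((real m)\<^sup>2 / 4 * V2 / F\<^sup>2)"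
      using m c' by (simp add: \<epsilon>_def C_def M_eq power2_eq_square)
    also have "\<dots> \<le> \<epsilon> * ?Q" using Q eps by (intro mult_left_mono) auto
    finally have "?Q - overlap (convolution_pmf G (tent m) \<phi>) (tent m) \<le> \<epsilon> * ?Q" using E by linarith
    from return_probability_ge_Rayleigh[OF sym st this, of n] eps
    have low: "?Q * (1 - \<epsilon>) ^ (2 * n) \<le> pmf (convolution_power G \<phi> (2 * n)) \<one>" by simp
    have "exp (- (4 * C * real n / M (real m))) = exp (- (2 * \<epsilon>)) ^ (2 * n)"
      by (simp add: \<epsilon>_def exp_of_nat_mult[symmetric])
    also have "\<dots> \<le> (1 - \<epsilon>) ^ (2 * n)" by (intro power_mono exp_le_one_minus eps) auto
    finally have e: "exp (- (4 * C * real n / M (real m))) \<le> (1 - \<epsilon>) ^ (2 * n)" .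
    \<comment> \<open>The mass of the tent is at most \<open>m\<close> times the volume, so its squared norm
      is at least of the order of the reciprocal volume.\<close>
    have "c * real m powr (-D) \<le> ?Q"
    proof -
      have "c * real m powr (-D) = c' * real m powr D / (4 * (C0 * real m powr D)\<^sup>2)"
        using m v by (simp add: c_def powr_minus power2_eq_square field_simps)
      also have "\<dots> \<le> V2 / (4 * V\<^sup>2)"
        using V v c' m by (intro frac_le) (auto intro!: mult_left_mono power_mono)
      also have "\<dots> = (real m)\<^sup>2 / 4 * V2 / (real m * V)\<^sup>2"
        using m V by (simp add: power2_eq_square field_simps)
      also have "\<dots> \<le> (real m)\<^sup>2 / 4 * V2 / F\<^sup>2"
        using F V m by (intro divide_left_mono power_mono mult_pos_pos) (auto simp: V_def)
      finally show ?thesis using Q by linarith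
    qed
    then have "c * real m powr (-D) * exp (- (4 * C * real n / M (real m))) \<le> ?Q * (1 - \<epsilon>) ^ (2 * n)"
      using e overlap_nonneg by (intro mult_mono) auto
    then show "c * real m powr (-D) * exp (- (4 * C * real n / M (real m))) \<le> pmf (convolution_power G \<phi> (2 * n)) \<one>"
      using low by linarith
  qed
qed

end

section \<open>Lazy walks and energies of balls\<close>

lemma ex_pmf_with_tail:
  fixes T :: "nat \<Rightarrow> real"
  assumes anti: "\<And>k. T (Suc k) \<le> T k" and T0: "T 0 = 1" and lim: "T \<longlonglongrightarrow> 0"
  obtains q :: "nat pmf" where "\<And>k. measure_pmf.prob q {k..} = T k"
proof -
  define w where "w k = T k - T (Suc k)" for k
  have w0: "0 \<le> w k" for k using anti by (simp add: w_def)
  have "w sums (T 0 - 0)" unfolding w_def by (rule telescope_sums'[OF lim])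
  then have s: "w sums 1" by (simp add: T0)
  have "(\<integral>\<^sup>+k. ennreal (w k) \<partial>count_space UNIV) = (\<Sum>k. ennreal (w k))"
    by (rule nn_integral_count_space_nat)
  also have "\<dots> = ennreal (\<Sum>k. w k)" using s w0 by (intro suminf_ennreal2) (auto simp: sums_iff)
  also have "\<dots> = 1" using s by (simp add: sums_iff)
  finally have pmf: "pmf (embed_pmf w) k = w k" for k using w0 by (intro pmf_embed_pmf) auto
  have "measure_pmf.prob (embed_pmf w) {k..} = T k" for k
  proof -
    have "measure_pmf.prob (embed_pmf w) {..<k} = (\<Sum>j<k. w j)"
      by (simp add: measure_measure_pmf_finite pmf)
    also have "\<dots> = T 0 - T k" unfolding w_def by (rule sum_lessThan_telescope')
    finally have "measure_pmf.prob (embed_pmf w) {..<k} = 1 - T k" by (simp add: T0)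
    moreover have "{k..} = UNIV - {..<k}" by auto
    ultimately show ?thesis using measure_pmf.prob_compl[of "{..<k}" "embed_pmf w"] by simp
  qed
  then show ?thesis by (rule that)
qed

lemma prob_bind_pmf:
  "measure_pmf.prob (bind_pmf q F) A = measure_pmf.expectation q (\<lambda>k. measure_pmf.prob (F k) A)"
proof -
  have "measure_pmf.prob p A = pmf (map_pmf (\<lambda>x. x \<in> A) p) True" for p
    by (simp add: pmf_map vimage_def)
  then show ?thesis by (simp add: map_bind_pmf pmf_bind)
qed

context word_metric
begin

text \<open>With \<open>X\<close> the squared norm of the convolution and \<open>A\<close> that of
\<open>\<mu>\<close>, averaging the bound by the mean over translates gives \<open>X \<le> (A +
X)/2\<close>.\<close>

lemma overlap_convolution_self_le:
  assumes \<phi>: "set_pmf \<phi> \<subseteq> carrier G" and \<mu>: "set_pmf \<mu> \<subseteq> carrier G"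
  shows "overlap (convolution_pmf G \<mu> \<phi>) (convolution_pmf G \<mu> \<phi>) \<le> overlap \<mu> \<mu>"
proof -
  let ?X = "convolution_pmf G \<mu> \<phi>"
  have "overlap ?X ?X = measure_pmf.expectation \<phi> (\<lambda>y. overlap (rtrans G y \<mu>) ?X)"
    by (rule overlap_convolution_left)
  also have "\<dots> \<le> measure_pmf.expectation \<phi> (\<lambda>y. (overlap \<mu> \<mu> + overlap ?X ?X) / 2)"
  proof (rule integral_mono_AE)
    show "integrable (measure_pmf \<phi>) (\<lambda>y. overlap (rtrans G y \<mu>) ?X)"
      by (rule measure_pmf.integrable_const_bound[where B=1]) (auto simp: overlap_nonneg overlap_le_1)
    show "AE y in measure_pmf \<phi>. overlap (rtrans G y \<mu>) ?X \<le> (overlap \<mu> \<mu> + overlap ?X ?X) / 2"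
      unfolding AE_measure_pmf_iff
    proof
      fix y assume "y \<in> set_pmf \<phi>"
      then show "overlap (rtrans G y \<mu>) ?X \<le> (overlap \<mu> \<mu> + overlap ?X ?X) / 2"
        using overlap_le_average[of "rtrans G y \<mu>" ?X] overlap_rtrans[OF \<mu> \<mu>, of y] \<phi> by auto
    qed
  qed simp
  finally show ?thesis by simp
qed

text \<open>Staying put with probability one half makes the loss of norm in one step comparable with the
Dirichlet form of \<open>\<eta>\<close> itself. For \<open>\<eta>\<close> alone it would be the
form of \<open>\<eta>\<close> convolved with itself, which can be degenerate by parity.\<close>

definition lazy :: "'a pmf \<Rightarrow> 'a pmf" where
  "lazy \<eta> = bind_pmf (bernoulli_pmf (1/2)) (\<lambda>b. if b then \<eta> else return_pmf \<one>)"

lemma pmf_lazy: "pmf (lazy \<eta>) x = (pmf \<eta> x + indicator {\<one>} x) / 2"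
  by (simp add: lazy_def pmf_bind integral_bernoulli_pmf) (simp add: indicator_def)

lemma set_lazy: "set_pmf (lazy \<eta>) = insert \<one> (set_pmf \<eta>)"
  by (auto simp: lazy_def split: if_splits)

lemma prob_lazy: "\<one> \<notin> A \<Longrightarrow> measure_pmf.prob (lazy \<eta>) A = measure_pmf.prob \<eta> A / 2"
  by (simp add: lazy_def prob_bind_pmf integral_bernoulli_pmf)

lemma symmetric_lazy:
  assumes "symmetric_pmf G \<eta>"
  shows "symmetric_pmf G (lazy \<eta>)"
  using assms by (auto simp: symmetric_pmf_def set_lazy pmf_lazy indicator_def)

lemma overlap_lazy_step:
  assumes \<eta>: "set_pmf \<eta> \<subseteq> carrier G" and \<mu>: "set_pmf \<mu> \<subseteq> carrier G"
  shows "overlap (convolution_pmf G \<mu> (lazy \<eta>)) (convolution_pmf G \<mu> (lazy \<eta>))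
    \<le> overlap \<mu> \<mu> - (overlap \<mu> \<mu> - overlap (convolution_pmf G \<mu> \<eta>) \<mu>) / 2"
proof -
  let ?X = "convolution_pmf G \<mu> \<eta>"
  have b: "convolution_pmf G \<mu> (lazy \<eta>) = bind_pmf (bernoulli_pmf (1/2)) (\<lambda>b. if b then ?X else \<mu>)"
    unfolding convolution_eq_bind lazy_def bind_assoc_pmf
    by (intro bind_pmf_cong refl) (use \<mu> in \<open>auto simp: bind_return_pmf rtrans_one\<close>)
  have h: "overlap (convolution_pmf G \<mu> (lazy \<eta>)) \<nu> = (overlap ?X \<nu> + overlap \<mu> \<nu>) / 2" for \<nu>
    unfolding b overlap_bind_left by (simp add: integral_bernoulli_pmf)
  have "overlap (convolution_pmf G \<mu> (lazy \<eta>)) (convolution_pmf G \<mu> (lazy \<eta>))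
    = (overlap ?X ?X + 2 * overlap ?X \<mu> + overlap \<mu> \<mu>) / 4"
  proof -
    have "overlap ?X (convolution_pmf G \<mu> (lazy \<eta>)) = (overlap ?X ?X + overlap ?X \<mu>) / 2"
      "overlap \<mu> (convolution_pmf G \<mu> (lazy \<eta>)) = (overlap ?X \<mu> + overlap \<mu> \<mu>) / 2"
      using h[of ?X] h[of \<mu>] by (simp_all add: overlap_commute)
    then show ?thesis unfolding h[of "convolution_pmf G \<mu> (lazy \<eta>)"] by (simp add: field_simps)
  qed
  also have "\<dots> \<le> (overlap \<mu> \<mu> + 2 * overlap ?X \<mu> + overlap \<mu> \<mu>) / 4"
    using overlap_convolution_self_le[OF \<eta> \<mu>] by (intro divide_right_mono add_right_mono) auto
  also have "\<dots> = overlap \<mu> \<mu> - (overlap \<mu> \<mu> - overlap ?X \<mu>) / 2" by (simp add: field_simps)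
  finally show ?thesis .
qed

abbreviation unif :: "nat \<Rightarrow> 'a pmf" where "unif r \<equiv> pmf_of_set (ball r)"

lemma ball_nonempty: "ball r \<noteq> {}"
  using one_in_ball by blast

lemma set_unif: "set_pmf (unif r) = ball r"
  by (simp add: finite_ball ball_nonempty)

lemma symmetric_unif: "symmetric_pmf G (unif r)"
  unfolding symmetric_pmf_def
proof (intro conjI ballI)
  fix g assume g: "g \<in> carrier G"
  have "inv g \<in> ball r \<longleftrightarrow> g \<in> ball r" using inv_in_ball[of g r] inv_in_ball[of "inv g" r] g by auto
  then show "pmf (unif r) (inv g) = pmf (unif r) g" by (simp add: finite_ball ball_nonempty indicator_def)
qed (simp add: set_unif ball_carrier)

text \<open>Averaging over a ball leaves no atom larger than the reciprocal volume. A ball that is large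
compared with the inverse squared norm of \<open>\<mu>\<close> therefore destroys half of that
norm.\<close>

lemma overlap_unif_le:
  assumes \<mu>: "set_pmf \<mu> \<subseteq> carrier G"
  shows "overlap (convolution_pmf G \<mu> (unif r)) \<mu> \<le> 1 / volume r"
proof -
  have u: "set_pmf (unif r) \<subseteq> carrier G" by (simp add: set_unif ball_carrier)
  have 1: "pmf (convolution_pmf G (return_pmf x) (unif r)) z \<le> 1 / volume r" if x: "x \<in> carrier G" for x z
  proof -
    have "convolution_pmf G (return_pmf x) (unif r) = map_pmf (\<lambda>y. x \<otimes> y) (unif r)"
      by (simp add: convolution_eq_bind rtrans_def) (simp add: map_pmf_def)
    then have "pmf (convolution_pmf G (return_pmf x) (unif r)) z = card (ball r \<inter> {y. x \<otimes> y = z}) / volume r"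
      by (simp add: pmf_map measure_pmf_of_set finite_ball ball_nonempty vimage_def)
    also have "card (ball r \<inter> {y. x \<otimes> y = z}) \<le> 1"
    proof -
      have "ball r \<inter> {y. x \<otimes> y = z} \<subseteq> {inv x \<otimes> z}"
        using x ball_carrier by (auto simp: m_assoc[symmetric] subset_iff)
      then show ?thesis using card_mono[of "{inv x \<otimes> z}"] by fastforce
    qed
    finally show ?thesis by (simp add: divide_right_mono)
  qed
  have 2: "pmf (convolution_pmf G \<mu> (unif r)) x \<le> 1 / volume r" for x
  proof (cases "x \<in> carrier G")
    case True
    have "pmf (convolution_pmf G \<mu> (unif r)) x = overlap (convolution_pmf G \<mu> (unif r)) (return_pmf x)"
      by (simp add: overlap_return)
    also have "\<dots> = overlap \<mu> (convolution_pmf G (return_pmf x) (unif r))"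
      using True \<mu> by (intro overlap_convolution_right symmetric_unif) auto
    also have "\<dots> \<le> 1 / volume r" by (rule overlap_le) (rule 1[OF True])
    finally show ?thesis .
  next
    case False
    then have "pmf (convolution_pmf G \<mu> (unif r)) x = 0"
      using set_convolution[OF \<mu> u] by (auto simp: pmf_eq_0_set_pmf)
    then show ?thesis by simp
  qed
  show ?thesis by (subst overlap_commute) (rule overlap_le[OF 2])
qed

definition displacement :: "'a pmf \<Rightarrow> 'a \<Rightarrow> real" where
  "displacement \<mu> y = sqdist \<mu> (rtrans G y \<mu>)"

definition ball_energy :: "'a pmf \<Rightarrow> nat \<Rightarrow> real" where
  "ball_energy \<mu> r = overlap \<mu> \<mu> - overlap (convolution_pmf G \<mu> (unif r)) \<mu>"

lemma ball_energy_eq: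
  assumes \<mu>: "set_pmf \<mu> \<subseteq> carrier G"
  shows "ball_energy \<mu> r = (\<Sum>y\<in>ball r. displacement \<mu> y) / (2 * volume r)"
  using energy_eq_expectation_sqdist[of "unif r" \<mu>] \<mu>
  by (simp add: ball_energy_def displacement_def set_unif ball_carrier integral_pmf_of_set finite_ball ball_nonempty)

lemma displacement_nonneg: "0 \<le> displacement \<mu> y"
  by (simp add: displacement_def sqdist_nonneg)

lemma ball_energy_nonneg: "set_pmf \<mu> \<subseteq> carrier G \<Longrightarrow> 0 \<le> ball_energy \<mu> r"
  by (simp add: ball_energy_eq sum_nonneg displacement_nonneg)

lemma displacement_mult:
  assumes \<mu>: "set_pmf \<mu> \<subseteq> carrier G" and "y \<in> carrier G" "z \<in> carrier G"
  shows "displacement \<mu> (y \<otimes> z) \<le> 2 * displacement \<mu> y + 2 * displacement \<mu> z"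
  using sqdist_triangle[of \<mu> "rtrans G (y \<otimes> z) \<mu>" "rtrans G z \<mu>"]
    sqdist_rtrans[OF \<mu> set_rtrans[OF \<mu> assms(2)] assms(3)] rtrans_rtrans[OF \<mu> assms(2,3)]
  by (simp add: displacement_def)

text \<open>Doubling the radius multiplies the squared displacement by at most four: each factor of a
product contributes twice, and there are two of them. Iterated doubling loses nothing compared
with the optimal quadratic dependence on the radius.\<close>

lemma displacement_dyadic:
  assumes \<mu>: "set_pmf \<mu> \<subseteq> carrier G" and K: "\<And>y. y \<in> ball r \<Longrightarrow> displacement \<mu> y \<le> K"
  shows "y \<in> ball (2 ^ j * r) \<Longrightarrow> displacement \<mu> y \<le> 4 ^ j * K"
proof (induction j arbitrary: y)
  case (Suc j)
  have "2 ^ Suc j * r = 2 ^ j * r + 2 ^ j * r" by simp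
  with Suc.prems have "y \<in> ball (2 ^ j * r + 2 ^ j * r)" by (simp only:)
  then obtain u v where uv: "u \<in> ball (2 ^ j * r)" "v \<in> ball (2 ^ j * r)" "y = u \<otimes> v" by (rule ball_split)
  have "displacement \<mu> y \<le> 2 * displacement \<mu> u + 2 * displacement \<mu> v"
    unfolding uv(3) using uv ball_carrier by (intro displacement_mult \<mu>) auto
  then show ?case using Suc.IH[OF uv(1)] Suc.IH[OF uv(2)] by simp
qed (use K in simp)

text \<open>From an average to a supremum: write \<open>z = w (w\<^bsup>-1\<^esup> z)\<close> and average
over \<open>w\<close> in the ball; both factors range over subsets of the ball of twice the
radius.\<close>

lemma displacement_le_ball_energy:
  assumes \<mu>: "set_pmf \<mu> \<subseteq> carrier G" and z: "z \<in> ball r"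
  shows "displacement \<mu> z \<le> 8 * (volume (2 * r) / volume r) * ball_energy \<mu> (2 * r)"
proof -
  let ?\<Delta> = "displacement \<mu>"
  let ?T = "\<Sum>y\<in>ball (2 * r). ?\<Delta> y"
  have zc: "z \<in> carrier G" using z ball_carrier by blast
  have "volume r * ?\<Delta> z = (\<Sum>w\<in>ball r. ?\<Delta> z)" by simp
  also have "\<dots> \<le> (\<Sum>w\<in>ball r. 2 * ?\<Delta> w + 2 * ?\<Delta> (inv w \<otimes> z))"
  proof (rule sum_mono)
    fix w assume "w \<in> ball r"
    then have "w \<in> carrier G" using ball_carrier by blast
    then show "?\<Delta> z \<le> 2 * ?\<Delta> w + 2 * ?\<Delta> (inv w \<otimes> z)"
      using displacement_mult[OF \<mu>, of w "inv w \<otimes> z"] zc by (simp add: m_assoc[symmetric])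
  qed
  also have "\<dots> = 2 * (\<Sum>w\<in>ball r. ?\<Delta> w) + 2 * (\<Sum>w\<in>ball r. ?\<Delta> (inv w \<otimes> z))"
    by (simp add: sum.distrib sum_distrib_left)
  also have "(\<Sum>w\<in>ball r. ?\<Delta> w) \<le> ?T"
    by (intro sum_mono2 finite_ball ball_mono) (auto simp: displacement_nonneg)
  also have "(\<Sum>w\<in>ball r. ?\<Delta> (inv w \<otimes> z)) = (\<Sum>y\<in>(\<lambda>w. inv w \<otimes> z) ` ball r. ?\<Delta> y)"
  proof (rule sum.reindex_cong[symmetric, OF _ refl])
    show "inj_on (\<lambda>w. inv w \<otimes> z) (ball r)"
    proof (rule inj_onI)
      fix x y assume xy: "x \<in> ball r" "y \<in> ball r" "inv x \<otimes> z = inv y \<otimes> z"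
      then have c: "x \<in> carrier G" "y \<in> carrier G" using ball_carrier by auto
      then have "inv x = inv y" using xy(3) zc by (simp add: right_cancel)
      then show "x = y" using c inv_inv by metis
    qed
  qed simp
  also have "\<dots> \<le> ?T"
  proof (intro sum_mono2 finite_ball displacement_nonneg subsetI)
    fix y assume "y \<in> (\<lambda>w. inv w \<otimes> z) ` ball r"
    then show "y \<in> ball (2 * r)" using ball_mult[OF inv_in_ball z] by (auto simp: mult_2)
  qed
  finally have "volume r * ?\<Delta> z \<le> 4 * ?T" by simp
  also have "?T = 2 * volume (2 * r) * ball_energy \<mu> (2 * r)"
    using volume_pos[of "2 * r"] by (simp add: ball_energy_eq[OF \<mu>])
  finally show ?thesis using volume_pos[of r] by (simp add: field_simps)
qed

end

context polynomial_word_metric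
begin

lemma volume_doubling:
  obtains C where "1 \<le> C" "\<And>r. 1 \<le> r \<Longrightarrow> real (volume (2 * r)) \<le> C * real (volume r)"
proof -
  obtain c0 C0 where v: "0 < c0" "0 < C0"
    "\<And>m. 1 \<le> m \<Longrightarrow> c0 * real m powr D \<le> real (volume m)"
    "\<And>m. 1 \<le> m \<Longrightarrow> real (volume m) \<le> C0 * real m powr D" by (rule volume_bounds) blast
  obtain c' where c': "0 < c'" "\<And>m. 1 \<le> m \<Longrightarrow> c' * real m powr D \<le> real (volume (m div 2))"
    by (rule volume_half_ge) blast
  show ?thesis
  proof (rule that[of "max 1 (C0 / c')"])
    fix r :: nat assume r: "1 \<le> r"
    have "real (volume (2 * r)) \<le> C0 / c' * (c' * real (2 * r) powr D)"
      using v(4)[of "2 * r"] c' r by simp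
    also have "\<dots> \<le> C0 / c' * real (volume (2 * r div 2))"
      using c'(1) v r by (intro mult_left_mono c'(2)) auto
    also have "\<dots> \<le> max 1 (C0 / c') * real (volume r)"
      by (intro mult_mono) auto
    finally show "real (volume (2 * r)) \<le> max 1 (C0 / c') * real (volume r)" .
  qed simp
qed

text \<open>Small jumps see a density at most quadratically worse than large ones: the supremum of the
displacement over the small ball is bounded by its average energy, and dyadic doubling carries
it to the large ball.\<close>

lemma ball_energy_scaling:
  obtains \<kappa> where "0 < \<kappa>" "\<kappa> \<le> 1"
    "\<And>\<mu> k K. set_pmf \<mu> \<subseteq> carrier G \<Longrightarrow> 1 \<le> k \<Longrightarrow> k \<le> K \<Longrightarrow>
       \<kappa> * 4 ^ k * ball_energy \<mu> (2 ^ K) \<le> 4 ^ K * ball_energy \<mu> (2 ^ k)"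
proof -
  obtain C where C: "1 \<le> C" "\<And>r. 1 \<le> r \<Longrightarrow> real (volume (2 * r)) \<le> C * real (volume r)"
    by (fact volume_doubling)
  show ?thesis
  proof (rule that[of "1 / (16 * C)"])
    fix \<mu> and k K :: nat assume \<mu>: "set_pmf \<mu> \<subseteq> carrier G" and k: "1 \<le> k" "k \<le> K"
    define r :: nat where "r = 2 ^ (k - 1)"
    define j where "j = K - k + 1"
    have r: "2 * r = 2 ^ k" "1 \<le> r" using k by (simp_all add: r_def power_Suc[symmetric] del: power_Suc)
    have jr: "2 ^ j * r = 2 ^ K" "(4::real) ^ j * 4 ^ k = 4 * 4 ^ K"
      using k by (auto simp: j_def r_def power_add[symmetric] simp flip: power_Suc)
    have e0: "0 \<le> ball_energy \<mu> (2 ^ k)" by (rule ball_energy_nonneg[OF \<mu>])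
    have "displacement \<mu> y \<le> 8 * C * ball_energy \<mu> (2 ^ k)" if "y \<in> ball r" for y
    proof -
      have "displacement \<mu> y \<le> 8 * (volume (2 * r) / volume r) * ball_energy \<mu> (2 ^ k)"
        using displacement_le_ball_energy[OF \<mu> that] r by simp
      also have "\<dots> \<le> 8 * C * ball_energy \<mu> (2 ^ k)"
        using C(2)[OF r(2)] volume_pos[of r] e0 by (intro mult_right_mono) (auto simp: field_simps)
      finally show ?thesis .
    qed
    from displacement_dyadic[OF \<mu> this, of r _ j] 
    have d: "displacement \<mu> y \<le> 4 ^ j * (8 * C * ball_energy \<mu> (2 ^ k))" if "y \<in> ball (2 ^ K)" for y
      using that jr by simp
    have "(\<Sum>y\<in>ball (2 ^ K). displacement \<mu> y) \<le> volume (2 ^ K) * (4 ^ j * (8 * C * ball_energy \<mu> (2 ^ k)))"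
      by (rule sum_bounded_above[OF d])
    then have "ball_energy \<mu> (2 ^ K) \<le> 4 ^ j * (4 * C * ball_energy \<mu> (2 ^ k))"
      using volume_pos[of "2 ^ K"] by (simp add: ball_energy_eq[OF \<mu>, of "2 ^ K"] field_simps)
    then have "4 ^ k * ball_energy \<mu> (2 ^ K) \<le> 4 ^ k * (4 ^ j * (4 * C * ball_energy \<mu> (2 ^ k)))"
      by (intro mult_left_mono) auto
    also have "\<dots> = (4 ^ j * 4 ^ k) * (4 * C * ball_energy \<mu> (2 ^ k))" by simp
    also have "\<dots> = 16 * C * (4 ^ K * ball_energy \<mu> (2 ^ k))" unfolding jr by simp
    finally show "1 / (16 * C) * 4 ^ k * ball_energy \<mu> (2 ^ K) \<le> 4 ^ K * ball_energy \<mu> (2 ^ k)"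
      using C(1) by (simp add: field_simps)
  qed (use C in auto)
qed

end

section \<open>A walk spread over all scales\<close>

context random_walk_setting
begin

text \<open>On \<open>[2\<^sup>j, 2\<^bsup>j+1\<^esup>]\<close> the integral is at most twice the
\<open>j\<close>-th term. The initial interval \<open>[0,2]\<close> contributes at most
\<open>2\<close>, which is a multiple of the first term; this explains the constant.\<close>

lemma sum_dyadic_ge_I:
  "I (2 ^ Suc K) \<le> (\<rho> 2 / 2 + 2) * (\<Sum>j\<in>{1..Suc K}. 4 ^ j / \<rho> (2 ^ j))"
proof -
  have pos: "0 \<le> 4 ^ j / \<rho> (2 ^ j)" for j :: nat using rho_pos[of "2 ^ j"] by simp
  have telescoped: "I (2 ^ Suc K) \<le> 2 + 2 * (\<Sum>j\<in>{1..K}. 4 ^ j / \<rho> (2 ^ j))"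
  proof (induction K)
    case 0
    have "I 2 \<le> 2 / \<rho> 0" using I_le[of 2] by simp
    also have "\<dots> \<le> 2 / 1" using rho_ge_1 by (intro divide_left_mono) (auto intro: rho_pos)
    finally show ?case by simp
  next
    case (Suc K)
    let ?a = "(2::real) ^ Suc K"
    have e: "(4::real) ^ Suc K = ?a\<^sup>2"
      unfolding power_even_eq[symmetric] by (simp add: power_mult)
    have "I (2 * ?a) - I ?a \<le> ((2 * ?a)\<^sup>2 - ?a\<^sup>2) / (2 * \<rho> ?a)"
      by (intro I_increment_bounds(2)) auto
    also have "\<dots> = 3 / 2 * (4 ^ Suc K / \<rho> ?a)"
      unfolding e by (simp add: power_mult_distrib)
    also have "\<dots> \<le> 2 * (4 ^ Suc K / \<rho> ?a)" using pos[of "Suc K"] by simp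
    finally show ?case using Suc by simp
  qed
  have "2 = \<rho> 2 / 2 * (4 ^ 1 / \<rho> (2 ^ 1))" using rho_pos[of 2] by simp
  also have "\<dots> \<le> \<rho> 2 / 2 * (\<Sum>j\<in>{1..Suc K}. 4 ^ j / \<rho> (2 ^ j))"
    using rho_pos[of 2] by (intro mult_left_mono member_le_sum pos) auto
  finally have "2 \<le> \<rho> 2 / 2 * (\<Sum>j\<in>{1..Suc K}. 4 ^ j / \<rho> (2 ^ j))" .
  moreover have "(\<Sum>j\<in>{1..K}. 4 ^ j / \<rho> (2 ^ j)) \<le> (\<Sum>j\<in>{1..Suc K}. 4 ^ j / \<rho> (2 ^ j))"
    using pos[of "Suc K"] by simp
  ultimately show ?thesis using telescoped unfolding distrib_right by linarith
qed

text \<open>Scale \<open>0\<close> is the trivial ball. It receives the mass \<open>1 - 1/\<rho>(2)\<close>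
that the tail condition leaves over, so that the weak moment bound holds with constant one
whatever the size of \<open>\<rho>(2)\<close>.\<close>

definition spread_ball :: "nat \<Rightarrow> nat" where "spread_ball k = (if k = 0 then 0 else 2 ^ k)"

text \<open>Before laziness, the scales from \<open>k \<ge> 1\<close> on carry mass exactly
\<open>1/\<rho>(2\<^sup>k)\<close>. Up to a constant this is the heaviest tail that the moment
condition permits: a jump with \<open>\<rho>(|g|) > s\<close> can only come from scales with
\<open>\<rho>(2\<^sup>k) > s\<close>, whose mass is at most \<open>1/s\<close>.

The loss of squared norm is at least half the average of the ball energies. Relative to the
squared norm, below the critical scale \<open>K\<close>, at which the volume exceeds the inverse
squared norm, the energy at scale \<open>k\<close> is at least of order
\<open>4\<^bsup>k-K\<^esup>\<close>, above it of order one. Summation by parts turns masses into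
tails and the average into \<open>4\<^bsup>-K\<^esup>\<close> times the sum of
\<open>4\<^sup>j/\<rho>(2\<^sup>j)\<close>, that is, into \<open>1/M(2\<^sup>K)\<close>. The
conclusion is stated with a restart time \<open>k\<close> because one of its uses proceeds
through successive scales.\<close>

theorem ex_spread_out_walk:
  assumes lim: "filterlim \<rho> at_top at_top"
  obtains \<phi> c C where "admissible \<phi>" "0 < c" "0 < C"
    "\<And>k n r. 1 \<le> r \<Longrightarrow> pmf (convolution_power G \<phi> (2 * (k + n))) \<one>
       \<le> max (C * r powr (-D)) (pmf (convolution_power G \<phi> (2 * k)) \<one> * exp (- (c * real n / M r)))"
proof -
  define T where "T k = (if k = 0 then 1 else 1 / \<rho> (2 ^ k))" for k :: nat
  have T_anti: "T (Suc k) \<le> T k" for k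
    using rho_ge_1 rho_pos rho_mono[of "2 ^ k" "2 * 2 ^ k"] by (auto simp: T_def field_simps)
  have pow_lim: "filterlim (\<lambda>k::nat. (2::real) ^ k) at_top sequentially"
    by (rule filterlim_at_infinity_imp_filterlim_at_top[OF filterlim_realpow_sequentially_gt1]) auto
  have T_lim: "T \<longlonglongrightarrow> 0"
  proof (rule Lim_transform_eventually)
    show "(\<lambda>k. inverse (\<rho> (2 ^ k))) \<longlonglongrightarrow> 0"
      by (intro tendsto_inverse_0_at_top filterlim_compose[OF lim pow_lim])
    show "\<forall>\<^sub>F k in sequentially. inverse (\<rho> (2 ^ k)) = T k"
      using eventually_gt_at_top[of 0] by eventually_elim (simp add: T_def inverse_eq_divide)
  qed
  obtain q where q: "\<And>k. measure_pmf.prob q {k..} = T k"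
    using ex_pmf_with_tail[of T] T_anti T_lim by (auto simp: T_def)
  define \<eta> where "\<eta> = bind_pmf q (\<lambda>k. unif (spread_ball k))"
  define \<phi> where "\<phi> = lazy \<eta>"
  have set_\<eta>: "set_pmf \<eta> \<subseteq> carrier G" using ball_carrier by (auto simp: \<eta>_def set_unif)
  have sym_\<eta>: "symmetric_pmf G \<eta>"
    unfolding symmetric_pmf_def
  proof (intro conjI ballI set_\<eta>)
    fix g assume "g \<in> carrier G"
    then have "pmf (unif r) (inv g) = pmf (unif r) g" for r using symmetric_unif by (auto simp: symmetric_pmf_def)
    then show "pmf \<eta> (inv g) = pmf \<eta> g" by (simp only: \<eta>_def pmf_bind)
  qed
  have sym: "symmetric_pmf G \<phi>" unfolding \<phi>_def by (rule symmetric_lazy[OF sym_\<eta>])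
  have set_\<phi>: "set_pmf \<phi> \<subseteq> carrier G" using sym by (simp add: symmetric_pmf_def)

  have tail: "s * measure_pmf.prob \<phi> {g \<in> carrier G. \<rho> (real (len g)) > s} \<le> 2 * \<rho> 0" if s: "s > 0" for s
  proof (cases "s \<le> 2 * \<rho> 0")
    case True
    then have "s * measure_pmf.prob \<phi> {g \<in> carrier G. \<rho> (real (len g)) > s} \<le> (2 * \<rho> 0) * 1"
      using s by (intro mult_mono) auto
    then show ?thesis by simp
  next
    case False
    let ?A = "{g \<in> carrier G. \<rho> (real (len g)) > s}"
    have s0: "\<rho> 0 < s" using False rho_pos[of 0] by linarith
    have "\<forall>\<^sub>F k in sequentially. s < \<rho> (2 ^ k)"
      using filterlim_compose[OF lim pow_lim] by (simp add: filterlim_at_top_dense)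
    then have ex: "\<exists>k::nat. 1 \<le> k \<and> s < \<rho> (2 ^ k)"
      by (metis (mono_tags, lifting) eventually_sequentially nle_le)
    define k0 :: nat where "k0 = (LEAST k. 1 \<le> k \<and> s < \<rho> (2 ^ k))"
    have k0: "1 \<le> k0" "s < \<rho> (2 ^ k0)" using LeastI_ex[OF ex] by (auto simp: k0_def)
    have small: "measure_pmf.prob (unif (spread_ball k)) ?A \<le> indicator {k0..} k" for k
    proof (cases "k0 \<le> k")
      case False
      have "ball (spread_ball k) \<inter> ?A = {}"
      proof (rule ccontr)
        assume "ball (spread_ball k) \<inter> ?A \<noteq> {}"
        then obtain g where g: "g \<in> ball (spread_ball k)" "\<rho> (real (len g)) > s" by auto
        have "s < \<rho> (real (spread_ball k))"
          using g rho_mono[of "real (len g)" "real (spread_ball k)"] by (auto simp: ball_def)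
        then have "1 \<le> k \<and> s < \<rho> (2 ^ k)" using s0 by (cases "k = 0") (auto simp: spread_ball_def)
        then have "k0 \<le> k" unfolding k0_def by (rule Least_le)
        then show False using False by simp
      qed
      then have "measure_pmf.prob (unif (spread_ball k)) ?A = 0"
        by (simp add: measure_pmf_of_set finite_ball ball_nonempty)
      then show ?thesis by simp
    qed simp
    have one: "\<one> \<notin> ?A" using s0 by (simp add: len_one)
    have "measure_pmf.prob \<phi> ?A \<le> measure_pmf.prob \<eta> ?A"
      by (simp add: \<phi>_def prob_lazy[OF one])
    also have "\<dots> = measure_pmf.expectation q (\<lambda>k. measure_pmf.prob (unif (spread_ball k)) ?A)"
      by (simp add: \<eta>_def prob_bind_pmf)
    also have "\<dots> \<le> measure_pmf.expectation q (\<lambda>k. indicator {k0..} k)"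
      by (intro integral_mono small) (auto intro!: measure_pmf.integrable_const_bound[where B=1])
    also have "\<dots> = T k0" using q by simp
    also have "\<dots> \<le> 1 / s" using k0 s by (simp add: T_def frac_le)
    finally have "s * measure_pmf.prob \<phi> ?A \<le> 1" using s by (simp add: field_simps)
    also have "1 \<le> 2 * \<rho> 0" using spec[OF rho_ge_1, of 0] by simp
    finally show ?thesis .
  qed
  have adm: "admissible \<phi>"
    unfolding admissible_def weak_moment_def using sym tail by (auto intro!: SUP_least ennreal_leI)

  obtain \<kappa> where \<kappa>: "0 < \<kappa>" "\<kappa> \<le> 1"
    "\<And>\<mu> k K. set_pmf \<mu> \<subseteq> carrier G \<Longrightarrow> 1 \<le> k \<Longrightarrow> k \<le> K \<Longrightarrow>
       \<kappa> * 4 ^ k * ball_energy \<mu> (2 ^ K) \<le> 4 ^ K * ball_energy \<mu> (2 ^ k)"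
    by (fact ball_energy_scaling)
  define B where "B = \<rho> 2 / 2 + 2"
  have B: "2 \<le> B" using rho_pos[of 2] by (simp add: B_def)
  define c0 where "c0 = \<kappa> * 3 / (8 * B)"
  have c0: "0 < c0" using \<kappa> B by (simp add: c0_def)

  \<comment> \<open>This replaces \<open>4\<^sup>k\<close> by a sum over scales \<open>j \<le> k\<close>,
    whose expectation involves only the tails of \<open>q\<close>.\<close>
  have geom: "3 / 4 * (\<Sum>j\<in>{1..n}. (4::real) ^ j) \<le> 4 ^ n" for n :: nat
    by (induction n) auto

  have energy: "c0 * overlap \<mu> \<mu> / M (2 ^ K) \<le> overlap \<mu> \<mu> - overlap (convolution_pmf G \<mu> \<eta>) \<mu>"
    if \<mu>: "set_pmf \<mu> \<subseteq> carrier G" and K: "1 \<le> K" and vol: "2 \<le> volume (2 ^ K) * overlap \<mu> \<mu>" for \<mu> and K :: nat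
  proof -
    define a where "a = overlap \<mu> \<mu>"
    define \<E> where "\<E> k = ball_energy \<mu> (spread_ball k)" for k
    have a0: "0 < a" by (simp add: a_def overlap_self_pos)
    have big: "a / 2 \<le> ball_energy \<mu> (2 ^ k)" if "K \<le> k" for k
    proof -
      have "2 \<le> volume (2 ^ K) * a" using vol by (simp add: a_def)
      also have "\<dots> \<le> volume (2 ^ k) * a"
        using that a0 by (intro mult_right_mono) (auto intro!: volume_mono power_increasing)
      finally have "1 / volume (2 ^ k) \<le> a / 2" using volume_pos[of "2 ^ k"] by (simp add: field_simps)
      then show ?thesis using overlap_unif_le[OF \<mu>, of "2 ^ k"] by (simp add: ball_energy_def a_def)
    qed
    have pt: "\<kappa> * 3 / 8 * a / 4 ^ K * (\<Sum>j\<in>{1..K}. 4 ^ j * indicator {j..} k) \<le> \<E> k" for k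
    proof -
      have s: "(\<Sum>j\<in>{1..K}. (4::real) ^ j * indicator {j..} k) = (\<Sum>j\<in>{1..min k K}. 4 ^ j)"
        by (intro sum.mono_neutral_cong_right) (auto simp: indicator_def)
      have "\<kappa> * 3 / 8 * a / 4 ^ K * (\<Sum>j\<in>{1..K}. 4 ^ j * indicator {j..} k)
        = \<kappa> * a / (2 * 4 ^ K) * (3 / 4 * (\<Sum>j\<in>{1..min k K}. 4 ^ j))" unfolding s by simp
      also have "\<dots> \<le> \<E> k"
      proof (cases "k = 0")
        case True
        then show ?thesis using ball_energy_nonneg[OF \<mu>, of "spread_ball k"] by (simp add: \<E>_def)
      next
        case False
        have "\<kappa> * a / (2 * 4 ^ K) * (3 / 4 * (\<Sum>j\<in>{1..min k K}. 4 ^ j)) \<le> \<kappa> * a / (2 * 4 ^ K) * 4 ^ min k K"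
          using \<kappa> a0 by (intro mult_left_mono geom) auto
        also have "\<dots> \<le> ball_energy \<mu> (2 ^ k)"
        proof (cases "k \<le> K")
          case True
          have "\<kappa> * a / (2 * 4 ^ K) * 4 ^ min k K = (\<kappa> * 4 ^ k * (a / 2)) / 4 ^ K"
            using True by simp
          also have "\<dots> \<le> (\<kappa> * 4 ^ k * ball_energy \<mu> (2 ^ K)) / 4 ^ K"
            using \<kappa> big[of K] by (intro divide_right_mono mult_left_mono) auto
          also have "\<dots> \<le> (4 ^ K * ball_energy \<mu> (2 ^ k)) / 4 ^ K"
            using \<kappa>(3)[OF \<mu>, of k K] False True by (intro divide_right_mono) auto
          finally show ?thesis by simp
        next
          case False
          have "\<kappa> * a / (2 * 4 ^ K) * 4 ^ min k K = \<kappa> * (a / 2)" using False by simp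
          also have "\<dots> \<le> 1 * (a / 2)" using \<kappa> a0 by (intro mult_right_mono) auto
          also have "\<dots> \<le> ball_energy \<mu> (2 ^ k)" using big[of k] False by simp
          finally show ?thesis .
        qed
        finally show ?thesis using False by (simp add: \<E>_def spread_ball_def)
      qed
      finally show ?thesis .
    qed
    have o_int: "integrable (measure_pmf q) (\<lambda>k. overlap (convolution_pmf G \<mu> (unif (spread_ball k))) \<mu>)"
      by (rule measure_pmf.integrable_const_bound[where B=1]) (auto simp: overlap_nonneg overlap_le_1)
    have "overlap (convolution_pmf G \<mu> \<eta>) \<mu>
      = measure_pmf.expectation q (\<lambda>k. overlap (convolution_pmf G \<mu> (unif (spread_ball k))) \<mu>)"
      unfolding \<eta>_def convolution_eq_bind bind_assoc_pmf overlap_bind_left ..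
    then have "a - overlap (convolution_pmf G \<mu> \<eta>) \<mu> = measure_pmf.expectation q \<E>"
      using o_int unfolding \<E>_def[abs_def] ball_energy_def a_def by simp
    also have "measure_pmf.expectation q (\<lambda>k. \<kappa> * 3 / 8 * a / 4 ^ K * (\<Sum>j\<in>{1..K}. 4 ^ j * indicator {j..} k)) \<le> \<dots>"
    proof (intro integral_mono pt)
      show "integrable (measure_pmf q) \<E>"
        unfolding \<E>_def ball_energy_def using o_int by simp
      show "integrable (measure_pmf q) (\<lambda>k. \<kappa> * 3 / 8 * a / 4 ^ K * (\<Sum>j\<in>{1..K}. 4 ^ j * indicator {j..} k))"
        by (intro integrable_mult_right Bochner_Integration.integrable_sum measure_pmf.integrable_const_bound[where B=1]) auto
    qed
    also have "measure_pmf.expectation q (\<lambda>k. \<kappa> * 3 / 8 * a / 4 ^ K * (\<Sum>j\<in>{1..K}. 4 ^ j * indicator {j..} k))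
      = \<kappa> * 3 / 8 * a / 4 ^ K * (\<Sum>j\<in>{1..K}. 4 ^ j * T j)"
    proof -
      have "measure_pmf.expectation q (\<lambda>k. (\<Sum>j\<in>{1..K}. (4::real) ^ j * indicator {j..} k))
        = (\<Sum>j\<in>{1..K}. measure_pmf.expectation q (\<lambda>k. 4 ^ j * indicator {j..} k))"
        by (intro Bochner_Integration.integral_sum integrable_mult_right measure_pmf.integrable_const_bound[where B=1]) auto
      also have "\<dots> = (\<Sum>j\<in>{1..K}. 4 ^ j * T j)" using q by simp
      finally show ?thesis by (subst Bochner_Integration.integral_mult_right_zero) simp
    qed
    also have "(\<Sum>j\<in>{1..K}. 4 ^ j * T j) = (\<Sum>j\<in>{1..K}. 4 ^ j / \<rho> (2 ^ j))"
      by (intro sum.cong refl) (auto simp: T_def)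
    finally have 1: "\<kappa> * 3 / 8 * a / 4 ^ K * (\<Sum>j\<in>{1..K}. 4 ^ j / \<rho> (2 ^ j)) \<le> a - overlap (convolution_pmf G \<mu> \<eta>) \<mu>" .
    have "I (2 ^ K) \<le> B * (\<Sum>j\<in>{1..K}. 4 ^ j / \<rho> (2 ^ j))"
      using sum_dyadic_ge_I[of "K - 1"] K by (simp add: B_def)
    then have "I (2 ^ K) / B \<le> (\<Sum>j\<in>{1..K}. 4 ^ j / \<rho> (2 ^ j))" using B by (simp add: field_simps)
    then have "\<kappa> * 3 / 8 * a / 4 ^ K * (I (2 ^ K) / B) \<le> \<kappa> * 3 / 8 * a / 4 ^ K * (\<Sum>j\<in>{1..K}. 4 ^ j / \<rho> (2 ^ j))"
      using \<kappa> a0 by (intro mult_left_mono) auto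
    also note 1
    also have "\<kappa> * 3 / 8 * a / 4 ^ K * (I (2 ^ K) / B) = c0 * a / M (2 ^ K)"
      by (simp add: c0_def M_eq power2_eq_square power_mult_distrib[symmetric])
    finally show ?thesis by (simp add: a_def)
  qed

  obtain v0 C0 where v: "0 < v0" "0 < C0"
    "\<And>m. 1 \<le> m \<Longrightarrow> v0 * real m powr D \<le> real (volume m)"
    "\<And>m. 1 \<le> m \<Longrightarrow> real (volume m) \<le> C0 * real m powr D" by (rule volume_bounds) blast
  define C where "C = 2 / v0"
  define c where "c = c0 / 8"
  define w where "w n = walk G \<phi> n (return_pmf \<one>)" for n
  define a where "a n = pmf (convolution_power G \<phi> (2 * n)) \<one>" for n
  have aw: "a n = overlap (w n) (w n)" for n
    unfolding a_def w_def by (rule return_probability_eq_overlap[OF sym])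
  have set_w: "set_pmf (w n) \<subseteq> carrier G" for n unfolding w_def by (rule set_walk) (use set_\<phi> in auto)
  have step: "a (Suc n) \<le> a n - (a n - overlap (convolution_pmf G (w n) \<eta>) (w n)) / 2" for n
    using overlap_lazy_step[OF set_\<eta> set_w, of n] by (simp add: aw w_def \<phi>_def)
  have anti: "a (Suc n) \<le> a n" for n
    using overlap_convolution_self_le[OF set_\<phi> set_w, of n] by (simp add: aw w_def)
  have a0: "0 < a n" for n by (simp add: aw overlap_self_pos)
  have decay: "a (Suc n) \<le> a n * exp (- (c / M r))" if r: "1 \<le> r" and ge: "C * r powr (-D) \<le> a n" for n r
  proof -
    \<comment> \<open>The dyadic scale just above \<open>r\<close>; it is at least \<open>1\<close>, as the
      trivial ball at scale \<open>0\<close> spreads nothing.\<close>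
    define K where "K = nat \<lfloor>log 2 r\<rfloor> + 1"
    have "0 \<le> log 2 r" using r by simp
    then have Kr: "log 2 r \<le> real K" "real K \<le> log 2 r + 1" unfolding K_def by linarith+
    have "r \<le> 2 powr real K" using Kr(1) r by (simp add: log_le_iff)
    then have rK: "r \<le> 2 ^ K" by (simp add: powr_realpow)
    have "2 powr real K \<le> 2 powr (log 2 r + 1)" using Kr(2) by simp
    also have "\<dots> = 2 * r" using r by (simp add: powr_add)
    finally have Kr2: "2 ^ K \<le> 2 * r" by (simp add: powr_realpow)
    have K: "1 \<le> K" by (simp add: K_def)
    have "2 = v0 * r powr D * (C * r powr (-D))" using r v by (simp add: C_def powr_minus)
    also have "\<dots> \<le> v0 * (2 ^ K) powr D * a n"
      using r rK v ge D_pos by (intro mult_mono mult_left_mono powr_mono2) (auto simp: C_def)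
    also have "\<dots> \<le> volume (2 ^ K) * a n" using v(3)[of "2 ^ K"] a0[of n] by (intro mult_right_mono) auto
    finally have "c0 * a n / M (2 ^ K) \<le> a n - overlap (convolution_pmf G (w n) \<eta>) (w n)"
      using energy[OF set_w K, of n] by (simp add: aw)
    moreover have "c0 * a n / (4 * M r) \<le> c0 * a n / M (2 ^ K)"
    proof (intro divide_left_mono mult_pos_pos)
      have "M (2 ^ K) \<le> M (2 * r)" using Kr2 by (intro M_mono) auto
      also have "\<dots> \<le> 4 * M r"
        using I_mono[of r "2 * r"] I_pos[of r] r by (simp add: M_eq power_mult_distrib divide_left_mono)
      finally show "M (2 ^ K) \<le> 4 * M r" .
    qed (use c0 a0[of n] M_pos[of r] M_pos[of "2 ^ K"] r in auto)
    ultimately have "c0 * a n / (4 * M r) \<le> a n - overlap (convolution_pmf G (w n) \<eta>) (w n)"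
      by (rule order_trans[rotated])
    from order_trans[OF step diff_left_mono[OF divide_right_mono[OF this]]]
    have "a (Suc n) \<le> a n - c0 * a n / (4 * M r) / 2" by simp
    also have "\<dots> = a n * (1 - c / M r)" by (simp add: c_def algebra_simps)
    also have "\<dots> \<le> a n * exp (- (c / M r))"
      using a0[of n] exp_ge_add_one_self[of "- (c / M r)"] by (intro mult_left_mono) auto
    finally show ?thesis .
  qed
  have main: "a (k + n) \<le> max (C * r powr (-D)) (a k * exp (- (c * real n / M r)))" if r: "1 \<le> r" for k n r
  proof (induction n)
    case (Suc n)
    show ?case
    proof (cases "C * r powr (-D) \<le> a (k + n)")
      case False
      then show ?thesis using anti[of "k + n"] by simp
    next
      case True
      have E: "exp (- (c * real (Suc n) / M r)) = exp (- (c * real n / M r)) * exp (- (c / M r))"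
        by (simp add: exp_add[symmetric] add_divide_distrib algebra_simps)
      have le1: "exp (- (c / M r)) \<le> 1" using c0 M_pos[of r] r by (simp add: c_def)
      have "a (k + Suc n) \<le> a (k + n) * exp (- (c / M r))" using decay[OF r True] by simp
      also have "\<dots> \<le> max (C * r powr (-D)) (a k * exp (- (c * real n / M r))) * exp (- (c / M r))"
        using Suc by (intro mult_right_mono) auto
      also have "\<dots> \<le> max (C * r powr (-D)) (a k * exp (- (c * real (Suc n) / M r)))"
      proof (cases "C * r powr (-D) \<le> a k * exp (- (c * real n / M r))")
        case True
        then show ?thesis unfolding E mult.assoc[symmetric] by (simp add: max.absorb2)
      next
        case False
        have "C * r powr (-D) * exp (- (c / M r)) \<le> C * r powr (-D)"
          using le1 v by (intro mult_left_le) (auto simp: C_def)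
        then show ?thesis using False by simp
      qed
      finally show ?thesis .
    qed
  qed simp
  show ?thesis
    by (rule that[of \<phi> c C]) (use adm c0 v main in \<open>auto simp: c_def C_def a_def\<close>)
qed

end

section \<open>Regularly varying kernels of positive index\<close>

text \<open>This allows improper integrals to be estimated, and substitutions to be made, on compact
intervals.\<close>

lemma integral_atLeast_le:
  fixes f :: "real \<Rightarrow> real"
  assumes f: "f integrable_on {a..}" and le: "\<And>b. a \<le> b \<Longrightarrow> integral {a..b} f \<le> K"
  shows "integral {a..} f \<le> K"
proof (rule field_le_epsilon)
  fix e :: real assume e: "0 < e"
  have "(f has_integral integral {a..} f) {a..}" using f by (rule integrable_integral)
  then obtain B where B: "B > 0" "\<And>c d. ball 0 B \<subseteq> cbox c d \<Longrightarrow>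
      norm (integral (cbox c d) (\<lambda>x. if x \<in> {a..} then f x else 0) - integral {a..} f) < e"
    using e unfolding has_integral_alt' by metis
  define d where "d = max B \<bar>a\<bar>"
  have "ball 0 B \<subseteq> cbox (- d) d" by (auto simp: d_def dist_real_def)
  from B(2)[OF this] have "norm (integral ({a..} \<inter> cbox (- d) d) f - integral {a..} f) < e"
    by (simp only: integral_restrict_Int)
  moreover have "{a..} \<inter> cbox (- d) d = {a..d}" unfolding d_def cbox_interval set_eq_iff by (auto; linarith)
  ultimately have "norm (integral {a..d} f - integral {a..} f) < e" by (simp only:)
  moreover have "integral {a..d} f \<le> K" by (intro le) (simp add: d_def)
  ultimately show "integral {a..} f \<le> K + e" by (simp add: abs_less_iff)
qed

locale tail_kernel =
  fixes \<l> :: "real \<Rightarrow> real"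
  assumes l_cont: "continuous_on {0..} \<l>" and l_mono_on: "mono_on {0..} \<l>" and l_ge_1: "\<forall>t\<ge>0. \<l> t \<ge> 1"
    and kernel_integrable: "(\<lambda>s. 1 / ((1 + s) * \<l> s)) integrable_on {0..}"
begin

definition kernel :: "real \<Rightarrow> real" where "kernel s = 1 / ((1 + s) * \<l> s)"

definition tail :: "real \<Rightarrow> real" where "tail t = integral {t..} kernel"

lemma l_pos: "0 \<le> t \<Longrightarrow> 0 < \<l> t"
  using l_ge_1 by (meson less_le_trans zero_less_one)

lemma kernel_pos: "0 \<le> s \<Longrightarrow> 0 < kernel s"
  using l_pos[of s] by (simp add: kernel_def)

lemma kernel_cont: "0 \<le> a \<Longrightarrow> continuous_on {a..b} kernel"
proof -
  assume a: "0 \<le> a"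
  have "continuous_on {a..b} \<l>" using a by (intro continuous_on_subset[OF l_cont]) auto
  moreover have "(1 + x) * \<l> x \<noteq> 0" if "x \<in> {a..b}" for x
    using that a l_pos[of x] by auto
  ultimately show ?thesis unfolding kernel_def[abs_def] by (intro continuous_intros) auto
qed

lemma kernel_integrable_tail: "0 \<le> t \<Longrightarrow> kernel integrable_on {t..}"
proof -
  assume t: "0 \<le> t"
  have "kernel absolutely_integrable_on {0..}"
    using kernel_integrable kernel_pos
    by (intro nonnegative_absolutely_integrable_1) (auto simp: kernel_def[abs_def] less_imp_le)
  then have "kernel absolutely_integrable_on {t..}"
    by (rule set_integrable_subset) (use t in auto)
  then show ?thesis by (rule set_lebesgue_integral_eq_integral)
qed

lemma integral_kernel_le_tail:
  assumes "0 \<le> t"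
  shows "integral {t..b} kernel \<le> tail t"
  unfolding tail_def using assms
  by (intro integral_subset_le kernel_integrable_tail integrable_continuous_interval kernel_cont)
     (auto intro!: less_imp_le[OF kernel_pos])

lemma tail_pos:
  assumes "0 \<le> t"
  shows "0 < tail t"
proof -
  have c: "0 < 1 / ((2 + t) * \<l> (t + 1))" using assms l_pos[of "t + 1"] by simp
  have "1 / ((2 + t) * \<l> (t + 1)) = integral {t..t + 1} (\<lambda>_. 1 / ((2 + t) * \<l> (t + 1)))" by simp
  also have "\<dots> \<le> integral {t..t + 1} kernel"
  proof (rule integral_le)
    show "kernel integrable_on {t..t + 1}" using assms by (intro integrable_continuous_interval kernel_cont)
    fix x assume x: "x \<in> {t..t + 1}"
    then have "\<l> x \<le> \<l> (t + 1)" using l_mono_on assms by (auto simp: mono_on_def)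
    then show "1 / ((2 + t) * \<l> (t + 1)) \<le> kernel x"
      unfolding kernel_def using x assms l_pos[of x] by (intro divide_left_mono mult_mono mult_pos_pos) auto
  qed auto
  also have "\<dots> \<le> tail t" by (rule integral_kernel_le_tail[OF assms])
  finally show ?thesis using c by linarith
qed

text \<open>For the dilation \<open>x\<close> with \<open>x\<^sup>\<alpha> = 4N\<close>, eventually
\<open>\<l>(x v) \<ge> 2N \<l>(v)\<close>, and substituting \<open>s = x v\<close> compares the
two tails. The extra factor two pays for replacing \<open>1/v\<close> by \<open>2/(1+v)\<close>.\<close>

lemma tail_decay:
  assumes "0 < \<alpha>" and rv: "regularly_varying \<alpha> \<l>" and N: "1 \<le> N"
  obtains x T where "1 \<le> x" "1 \<le> T" "\<And>t. T \<le> t \<Longrightarrow> tail (x * t) \<le> tail t / N"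
proof -
  define x where "x = (4 * N) powr (1 / \<alpha>)"
  have x: "1 \<le> x" unfolding x_def using N assms by (intro ge_one_powr_ge_zero) auto
  have xa: "x powr \<alpha> = 4 * N" using assms N by (simp add: x_def powr_powr)
  have "((\<lambda>t. \<l> (x * t) / \<l> t) \<longlongrightarrow> x powr \<alpha>) at_top"
    using rv x by (simp add: regularly_varying_def)
  then have "\<forall>\<^sub>F t in at_top. 2 * N < \<l> (x * t) / \<l> t"
    by (rule order_tendstoD) (use xa N in simp)
  then obtain T0 where T0: "\<And>t. T0 \<le> t \<Longrightarrow> 2 * N < \<l> (x * t) / \<l> t"
    by (auto simp: eventually_at_top_linorder)
  show ?thesis
  proof (rule that[of x "max 1 T0"])
    fix t assume t: "max 1 T0 \<le> t"
    then have t0: "0 \<le> t" "0 \<le> x * t" using x by auto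
    show "tail (x * t) \<le> tail t / N"
      unfolding tail_def[of "x * t"]
    proof (rule integral_atLeast_le[OF kernel_integrable_tail[OF t0(2)]])
      fix b assume b: "x * t \<le> b"
      have cont: "continuous_on {t..b / x} (\<lambda>v. kernel (x * v))"
        using t0 x by (intro continuous_on_compose2[OF kernel_cont[of 0 b]] continuous_intros) (auto simp: field_simps)
      have "(\<lambda>v. v / x) ` {x * t..b} = {t..b / x}" using x by (simp add: field_simps)
      then have "integral {x * t..b} kernel = x * integral {t..b / x} (\<lambda>v. kernel (x * v))"
        using integral_stretch_real[of x "x * t" b kernel] x by simp
      also have "\<dots> = integral {t..b / x} (\<lambda>v. x * kernel (x * v))" by simp
      also have "\<dots> \<le> integral {t..b / x} (\<lambda>v. kernel v / N)"
      proof (rule integral_le)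
        show "(\<lambda>v. x * kernel (x * v)) integrable_on {t..b / x}"
          by (intro integrable_continuous_interval continuous_intros cont)
        show "(\<lambda>v. kernel v / N) integrable_on {t..b / x}"
          using N t0 by (intro integrable_continuous_interval continuous_intros kernel_cont) auto
        fix v assume v: "v \<in> {t..b / x}"
        then have v1: "1 \<le> v" "T0 \<le> v" using t by auto
        have lv: "0 < \<l> v" using v1 by (simp add: l_pos)
        have ratio: "2 * N * \<l> v \<le> \<l> (x * v)" using T0[OF v1(2)] lv by (simp add: field_simps)
        have "x * kernel (x * v) \<le> x / ((x * v) * (2 * N * \<l> v))"
        proof -
          have "x * v * (2 * N * \<l> v) \<le> (1 + x * v) * \<l> (x * v)"
            using x v1 ratio lv N by (intro mult_mono) auto
          moreover have "0 < x * v * (2 * N * \<l> v)" using x v1 lv N by simp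
          ultimately have "x / ((1 + x * v) * \<l> (x * v)) \<le> x / (x * v * (2 * N * \<l> v))"
            using x by (intro frac_le) auto
          then show ?thesis by (simp add: kernel_def)
        qed
        also have "\<dots> = 1 / ((v + v) * \<l> v) / N" using x v1 N by (simp add: field_simps)
        also have "\<dots> \<le> kernel v / N"
          unfolding kernel_def using v1 lv N by (intro divide_right_mono divide_left_mono mult_mono mult_pos_pos) auto
        finally show "x * kernel (x * v) \<le> kernel v / N" .
      qed
      also have "\<dots> = integral {t..b / x} kernel / N" by simp
      also have "\<dots> \<le> tail t / N" using N t0 by (intro divide_right_mono integral_kernel_le_tail) auto
      finally show "integral {x * t..b} kernel \<le> tail t / N" .
    qed
  qed (use x in auto)
qed

end

context moment_scale
begin

text \<open>The equivalence relates \<open>\<rho>\<close> and the reciprocal tail only up to constants and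
dilations. Decay of the tail by a factor \<open>N\<close> that beats the multiplicative
constants therefore still yields growth of \<open>\<rho>\<close> by four, and the dilations are
absorbed into \<open>\<Lambda>\<close>.\<close>

lemma rho_expanding:
  assumes "tail_kernel \<l>" and "0 < \<alpha>" and "regularly_varying \<alpha> \<l>"
    and sim: "\<rho> \<simeq>\<^sub>\<infinity> (\<lambda>t. inverse (integral {t..} (\<lambda>s. 1 / ((1 + s) * \<l> s))))"
  obtains \<Lambda> T where "2 \<le> \<Lambda>" "1 \<le> T" "\<And>t. T \<le> t \<Longrightarrow> 4 * \<rho> t \<le> \<rho> (\<Lambda> * t)"
proof -
  interpret tail_kernel \<l> by fact
  have "\<rho> \<simeq>\<^sub>\<infinity> (\<lambda>t. inverse (tail t))"
    using sim by (simp add: tail_def kernel_def[abs_def])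
  then obtain c1 c2 c3 c4 T0 where c: "c1 > 0" "c2 > 0" "c3 > 0" "c4 > 0"
    and T0: "\<And>t. T0 \<le> t \<Longrightarrow> c1 * \<rho> (c2 * t) \<le> inverse (tail t) \<and> inverse (tail t) \<le> c3 * \<rho> (c4 * t)"
    unfolding sim_infinity_def eventually_at_top_linorder by metis
  define N where "N = max 1 (4 * c3 / c1)"
  obtain x T1 where x: "1 \<le> x" "1 \<le> T1" "\<And>t. T1 \<le> t \<Longrightarrow> tail (x * t) \<le> tail t / N"
    using tail_decay[OF assms(2,3), of N] by (auto simp: N_def)
  define \<Lambda> where "\<Lambda> = max 2 (c4 * x / c2)"
  define T where "T = max (max 1 c2) (max (c2 * T0) (c2 * T1))"
  show ?thesis
  proof (rule that[of \<Lambda> T])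
    fix u assume u: "T \<le> u"
    define t where "t = u / c2"
    have t: "T0 \<le> t" "T1 \<le> t" "1 \<le> t"
      using u c x by (auto simp: t_def T_def field_simps)
    have xt: "T0 \<le> x * t" "0 < x * t" using t x by (auto intro: order_trans[of _ t] simp: mult_le_cancel_right1)
    have p: "0 < tail t" "0 < tail (x * t)" using t xt by (auto intro!: tail_pos)
    have "4 * c3 * \<rho> u \<le> N * (c1 * \<rho> (c2 * t))"
    proof -
      have "4 * c3 \<le> N * c1" using c by (simp add: N_def max_def field_simps)
      then have "4 * c3 * \<rho> u \<le> N * c1 * \<rho> u" using u rho_pos[of u] by (intro mult_right_mono) (auto simp: T_def)
      then show ?thesis using c by (simp add: t_def)
    qed
    also have "\<dots> \<le> N * inverse (tail t)" using T0[OF t(1)] by (intro mult_left_mono) (auto simp: N_def)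
    also have "\<dots> \<le> inverse (tail (x * t))"
    proof -
      have "0 < N" by (simp add: N_def)
      then show ?thesis using x(3)[OF t(2)] p by (simp add: field_simps)
    qed
    also have "\<dots> \<le> c3 * \<rho> (c4 * (x * t))" using T0[OF xt(1)] by simp
    also have "\<dots> \<le> c3 * \<rho> (\<Lambda> * u)"
    proof (intro mult_left_mono rho_mono)
      have "c4 * (x * t) = c4 * x / c2 * u" by (simp add: t_def)
      also have "\<dots> \<le> \<Lambda> * u" using u by (intro mult_right_mono) (auto simp: \<Lambda>_def T_def)
      finally show "c4 * (x * t) \<le> \<Lambda> * u" .
    qed (use c xt in auto)
    finally show "4 * \<rho> u \<le> \<rho> (\<Lambda> * u)" using c by simp
  qed (auto simp: \<Lambda>_def T_def)
qed

lemma rho_at_top_if_unbounded: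
  assumes "\<And>Z. \<exists>t\<ge>0. Z \<le> \<rho> t"
  shows "filterlim \<rho> at_top at_top"
  unfolding filterlim_at_top eventually_at_top_linorder by (meson assms rho_mono order_trans)

lemma rho_at_top_if_expanding:
  assumes "2 \<le> \<Lambda>" "1 \<le> T" "\<And>t. T \<le> t \<Longrightarrow> 4 * \<rho> t \<le> \<rho> (\<Lambda> * t)"
  shows "filterlim \<rho> at_top at_top"
proof (rule rho_at_top_if_unbounded)
  fix Z :: real
  have pow: "T \<le> \<Lambda> ^ n * T" for n using assms(1,2) by (simp add: mult_le_cancel_right1)
  have "4 ^ n \<le> \<rho> (\<Lambda> ^ n * T)" for n
  proof (induction n)
    case 0
    then show ?case using rho_ge_1 assms(2) by simp
  next
    case (Suc n)
    have "4 ^ Suc n \<le> 4 * \<rho> (\<Lambda> ^ n * T)" using Suc by simp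
    also have "\<dots> \<le> \<rho> (\<Lambda> * (\<Lambda> ^ n * T))" by (rule assms(3)[OF pow])
    finally show ?case by (simp add: mult.assoc)
  qed
  moreover obtain n where "Z < 4 ^ n" using real_arch_pow[of 4 Z] by auto
  ultimately have "Z \<le> \<rho> (\<Lambda> ^ n * T)" by (meson less_imp_le order_trans)
  moreover have "0 \<le> \<Lambda> ^ n * T" using pow[of n] assms(2) by linarith
  ultimately show "\<exists>t\<ge>0. Z \<le> \<rho> t" by blast
qed

text \<open>In \<open>I(\<Lambda> t)\<close>, rescaled to \<open>[0,t]\<close>, the part beyond
\<open>T\<close> gains a factor four. The part before \<open>T\<close> equals \<open>I(\<Lambda>
T)\<close>, which is at most \<open>I(t)\<close> as soon as \<open>t \<ge> \<Lambda> T\<close>;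
since \<open>\<Lambda>\<^sup>2 \<ge> 4\<close> it is at most the same quantity. This covers
divergent and convergent \<open>I\<close> alike, so indices below, at and above \<open>2\<close>
need no distinction.\<close>

lemma M_expanding:
  assumes "2 \<le> \<Lambda>" "1 \<le> T" and exp: "\<And>t. T \<le> t \<Longrightarrow> 4 * \<rho> t \<le> \<rho> (\<Lambda> * t)"
    and t: "\<Lambda> * T \<le> t"
  shows "2 * M t \<le> M (\<Lambda> * t)"
proof -
  let ?f = "\<lambda>s. s / \<rho> (\<Lambda> * s)"
  have "1 * T \<le> \<Lambda> * T" using assms by (intro mult_right_mono) auto
  then have tT: "T \<le> t" "0 < t" using assms(2) t by linarith+
  have "integral {0..t} ?f = integral {0..T} ?f + integral {T..t} ?f"
    using Henstock_Kurzweil_Integration.integral_combine[of 0 T t ?f] scaled_integrable[of \<Lambda> 0 t] tT assms by simp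
  moreover have "\<Lambda>\<^sup>2 * integral {0..T} ?f = I (\<Lambda> * T)" "\<Lambda>\<^sup>2 * integral {0..t} ?f = I (\<Lambda> * t)"
    using I_scaled[of \<Lambda> T] I_scaled[of \<Lambda> t] assms tT by auto
  ultimately have 1: "I (\<Lambda> * t) = I (\<Lambda> * T) + \<Lambda>\<^sup>2 * integral {T..t} ?f" by (metis distrib_left)
  have "integral {T..t} ?f \<le> integral {T..t} (\<lambda>s. s / \<rho> s / 4)"
  proof (rule integral_le)
    show "?f integrable_on {T..t}" using assms by (intro scaled_integrable) auto
    show "(\<lambda>s. s / \<rho> s / 4) integrable_on {T..t}" using assms by (intro integrable_on_divide integrand_integrable) auto
    fix s assume s: "s \<in> {T..t}"
    then show "s / \<rho> (\<Lambda> * s) \<le> s / \<rho> s / 4"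
      using exp[of s] assms rho_pos[of s] frac_le[of s s "4 * \<rho> s" "\<rho> (\<Lambda> * s)"] by (simp add: mult.commute)
  qed
  also have "\<dots> = integral {T..t} (\<lambda>s. s / \<rho> s) / 4" by (rule Henstock_Kurzweil_Integration.integral_divide)
  also have "\<dots> = (I t - I T) / 4" using I_increment[of T t] tT assms by simp
  also have "\<dots> \<le> I t / 4" using I_pos[of T] assms by simp
  finally have 2: "\<Lambda>\<^sup>2 * integral {T..t} ?f \<le> \<Lambda>\<^sup>2 * (I t / 4)" by (intro mult_left_mono) auto
  have "I (\<Lambda> * T) \<le> I t" using assms by (intro I_mono) auto
  also have "\<dots> \<le> \<Lambda>\<^sup>2 * (I t / 4)"
    using power_mono[of 2 \<Lambda> 2] assms(1) I_pos[OF tT(2)] by (simp add: mult_le_cancel_right)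
  finally have "I (\<Lambda> * t) \<le> \<Lambda>\<^sup>2 * (I t / 2)" using 1 2 by simp
  then show ?thesis
    using I_pos[OF tT(2)] I_pos[of "\<Lambda> * t"] assms tT by (simp add: M_eq field_simps power_mult_distrib)
qed

end

context random_walk_setting
begin

lemma Phi_le:
  assumes "admissible \<phi>"
  shows "Phi_tilde G S \<rho> n \<le> pmf (convolution_power G \<phi> (2 * n)) \<one>"
  unfolding Phi_tilde_def using assms by (intro cINF_lower bdd_belowI[where m=0]) (auto simp: admissible_def)

lemma Phi_ge:
  assumes "admissible \<phi>" "\<And>\<phi>. admissible \<phi> \<Longrightarrow> x \<le> pmf (convolution_power G \<phi> (2 * n)) \<one>"
  shows "x \<le> Phi_tilde G S \<rho> n"
  unfolding Phi_tilde_def using assms by (intro cINF_greatest) (auto simp: admissible_def)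

text \<open>Induction over scales. At half of the available time the bound for scale
\<open>r/\<Lambda>\<close> holds, because \<open>M(r/\<Lambda>) \<le> M(r)/2\<close>; in the
remaining time the decay at scale \<open>r\<close> gains the missing factor
\<open>\<Lambda>\<^bsup>-D\<^esup>\<close>. The induction removes the logarithm that a single
application of the decay estimate would lose.\<close>

lemma return_probability_le_of_expanding:
  assumes \<Lambda>: "2 \<le> \<Lambda>" and T: "1 \<le> T" and M2: "\<And>t. T \<le> t \<Longrightarrow> 2 * M t \<le> M (\<Lambda> * t)"
    and c: "0 < c" and C: "0 < C"
    and p: "\<And>n. p n \<le> 1" and p0: "\<And>n. 0 \<le> p n"
    and decay: "\<And>k n r. 1 \<le> r \<Longrightarrow> p (k + n) \<le> max (C * r powr (-D)) (p k * exp (- (c * real n / M r)))"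
  obtains A Q where "0 < A" "0 < Q" "\<And>r n. 1 \<le> r \<Longrightarrow> Q * M r \<le> real n \<Longrightarrow> p n \<le> A * r powr (-D)"
proof -
  define A where "A = max C ((\<Lambda> * T) powr D)"
  \<comment> \<open>The first entry makes rounding of times harmless, the second makes a quarter of the time
    sufficient for the factor \<open>\<Lambda>\<^bsup>-D\<^esup>\<close>.\<close>
  define Q where "Q = max (4 / M 1) (4 * D * ln \<Lambda> / c)"
  have A: "0 < A" "C \<le> A" using C by (auto simp: A_def)
  have M1: "0 < M 1" by (simp add: M_pos)
  have Q: "0 < Q" "4 \<le> Q * M 1" "D * ln \<Lambda> \<le> c * Q / 4"
  proof -
    have "4 / M 1 \<le> Q" "4 * D * ln \<Lambda> / c \<le> Q" by (simp_all add: Q_def)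
    then show "4 \<le> Q * M 1" "D * ln \<Lambda> \<le> c * Q / 4" using M1 c by (simp_all add: field_simps)
    show "0 < Q" using M1 by (simp add: Q_def less_max_iff_disj)
  qed
  have eQ: "exp (- (c * Q / 4)) \<le> \<Lambda> powr (-D)"
    using Q(3) \<Lambda> by (simp add: powr_def)
  have "\<forall>r n. 1 \<le> r \<longrightarrow> r \<le> \<Lambda> ^ Suc j * T \<longrightarrow> Q * M r \<le> real n \<longrightarrow> p n \<le> A * r powr (-D)" for j
  proof (induction j)
    case 0
    show ?case
    proof (intro allI impI)
      fix r n assume r: "1 \<le> r" "r \<le> \<Lambda> ^ Suc 0 * T"
      have "r powr D \<le> (\<Lambda> * T) powr D" using r D_pos by (intro powr_mono2) auto
      then have "1 \<le> A * r powr (-D)" using r by (simp add: A_def powr_minus field_simps max.coboundedI2)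
      then show "p n \<le> A * r powr (-D)" using p[of n] by linarith
    qed
  next
    case (Suc j)
    show ?case
    proof (intro allI impI)
      fix r :: real and n :: nat
      assume r: "1 \<le> r" "r \<le> \<Lambda> ^ Suc (Suc j) * T" "Q * M r \<le> real n"
      show "p n \<le> A * r powr (-D)"
      proof (cases "r \<le> \<Lambda> ^ Suc j * T")
        case True
        then show ?thesis using Suc r by blast
      next
        case False
        define r' where "r' = r / \<Lambda>"
        have "1 * T \<le> \<Lambda> ^ j * T" using \<Lambda> T by (intro mult_right_mono) auto
        then have "\<Lambda> * T \<le> \<Lambda> ^ Suc j * T" using \<Lambda> mult_left_mono[of T "\<Lambda> ^ j * T" \<Lambda>] by simp
        then have "\<Lambda> * T \<le> r" using False by linarith
        then have r': "T \<le> r'" "r' \<le> \<Lambda> ^ Suc j * T" "\<Lambda> * r' = r"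
          using False r \<Lambda> by (auto simp: r'_def field_simps)
        have M: "2 * M r' \<le> M r" using M2[OF r'(1)] r' by simp
        have Mr: "M 1 \<le> M r" using r by (intro M_mono) auto
        have QM: "4 \<le> Q * M r" using Q Mr by (meson mult_left_mono less_imp_le order_trans)
        define k where "k = nat \<lceil>Q * M r / 2\<rceil>"
        have k: "Q * M r / 2 \<le> real k" "real k \<le> Q * M r / 2 + 1" using QM by (auto simp: k_def)
        have kn: "k \<le> n" "Q * M r / 4 \<le> real (n - k)" using k r QM by linarith+
        have "Q * M r' \<le> Q * (M r / 2)" using M Q by (intro mult_left_mono) auto
        then have "p k \<le> A * r' powr (-D)" using Suc r' k T by auto
        also have "r' powr (-D) = \<Lambda> powr D * r powr (-D)" using \<Lambda> r by (simp add: r'_def powr_divide powr_minus field_simps)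
        finally have pk: "p k \<le> A * (\<Lambda> powr D * r powr (-D))" .
        have Mr0: "0 < M r" using r by (intro M_pos) auto
        have "exp (- (c * real (n - k) / M r)) \<le> exp (- (c * Q / 4))"
        proof -
          have "c * (Q * M r / 4) \<le> c * real (n - k)" using kn(2) c by (intro mult_left_mono) auto
          then show ?thesis using Mr0 by (simp add: field_simps)
        qed
        also note eQ
        finally have "p k * exp (- (c * real (n - k) / M r)) \<le> A * (\<Lambda> powr D * r powr (-D)) * \<Lambda> powr (-D)"
          using pk A p0 by (intro mult_mono) auto
        also have "\<dots> = A * r powr (-D)" using \<Lambda> by (simp add: powr_minus)
        finally have 1: "p k * exp (- (c * real (n - k) / M r)) \<le> A * r powr (-D)" .
        have 2: "C * r powr (-D) \<le> A * r powr (-D)" using A by (intro mult_right_mono) auto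
        show ?thesis using decay[OF r(1), of k "n - k"] kn(1) 1 2 by simp
      qed
    qed
  qed
  moreover have "\<exists>j. r \<le> \<Lambda> ^ Suc j * T" for r
  proof -
    obtain j where "r < \<Lambda> ^ j" using real_arch_pow[of \<Lambda> r] \<Lambda> by auto
    also have "\<Lambda> ^ j * 1 \<le> \<Lambda> ^ Suc j * T" using \<Lambda> T by (intro mult_mono power_increasing) auto
    finally show ?thesis by (auto intro: less_imp_le)
  qed
  ultimately have "\<And>r n. 1 \<le> r \<Longrightarrow> Q * M r \<le> real n \<Longrightarrow> p n \<le> A * r powr (-D)" by blast
  then show ?thesis using that A Q by blast
qed

text \<open>Both bounds are taken at the scale \<open>r\<close> with \<open>M(r) = n\<close>. There the
exponential in the lower bound is of order one. In the upper bound the time \<open>Q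
M(r)\<close> is obtained by dilating \<open>t\<close>, as the relation \<open>\<simeq>\<close>
permits.\<close>

theorem Phi_regularly_varying:
  assumes \<Lambda>: "2 \<le> \<Lambda>" "1 \<le> T" "\<And>t. T \<le> t \<Longrightarrow> 4 * \<rho> t \<le> \<rho> (\<Lambda> * t)"
    and Minv: "inverse_near_infinity M Minv"
  shows "Phi_tilde G S \<rho> \<simeq>\<^sub>\<nat> (\<lambda>n. 1 / Minv (real n) powr D)"
proof -
  have lim: "filterlim \<rho> at_top at_top" by (rule rho_at_top_if_expanding[OF \<Lambda>])
  obtain \<phi> c C where adm: "admissible \<phi>" and cC: "0 < c" "0 < C"
    and decay: "\<And>k n r. 1 \<le> r \<Longrightarrow> pmf (convolution_power G \<phi> (2 * (k + n))) \<one>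
       \<le> max (C * r powr (-D)) (pmf (convolution_power G \<phi> (2 * k)) \<one> * exp (- (c * real n / M r)))"
    using ex_spread_out_walk[OF lim] by blast
  have "1 * T \<le> \<Lambda> * T" using \<Lambda> by (intro mult_right_mono) auto
  then have LT: "1 \<le> \<Lambda> * T" using \<Lambda>(2) by linarith
  obtain A Q where AQ: "0 < A" "0 < Q"
    and up: "\<And>r n. 1 \<le> r \<Longrightarrow> Q * M r \<le> real n \<Longrightarrow> pmf (convolution_power G \<phi> (2 * n)) \<one> \<le> A * r powr (-D)"
    using return_probability_le_of_expanding[OF \<Lambda>(1) LT M_expanding[OF \<Lambda>] cC, of "\<lambda>n. pmf (convolution_power G \<phi> (2 * n)) \<one>"] decay
    by (auto simp: pmf_le_1)
  obtain b B where bB: "0 < b" "0 < B"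
    and low: "\<And>\<phi> m n. admissible \<phi> \<Longrightarrow> 1 \<le> m \<Longrightarrow> B / M (real m) \<le> 1 / 2 \<Longrightarrow>
       b * real m powr (-D) * exp (- (4 * B * real n / M (real m))) \<le> pmf (convolution_power G \<phi> (2 * n)) \<one>"
    using return_probability_ge by blast
  obtain s0 where s0: "\<And>s. s0 \<le> s \<Longrightarrow> 0 \<le> Minv s \<and> M (Minv s) = s"
    using Minv unfolding inverse_near_infinity_def eventually_at_top_linorder by blast
  define n0 where "n0 = max (max s0 1) (max (M 1 + 1) (2 * B))"
  have inv: "1 \<le> Minv s" "M (Minv s) = s" if s: "n0 \<le> s" for s
  proof -
    have m: "0 \<le> Minv s" "M (Minv s) = s" using s0[of s] s by (auto simp: n0_def)
    show "M (Minv s) = s" by (rule m)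
    show "1 \<le> Minv s"
    proof (rule ccontr)
      assume "\<not> 1 \<le> Minv s"
      moreover have "Minv s \<noteq> 0" using m s by (auto simp: n0_def M_eq)
      ultimately have "M (Minv s) \<le> M 1" using m by (intro M_mono) auto
      then show False using m s by (auto simp: n0_def)
    qed
  qed
  define d where "d = b * 2 powr (-D) * exp (- (4 * B))"
  have d: "0 < d" using bB by (simp add: d_def)
  have upper: "1 / A * Phi_tilde G S \<rho> N \<le> 1 / Minv (real n) powr D" if n: "n0 \<le> real n" and N: "Q * real n \<le> real N" for n N
  proof -
    have "Phi_tilde G S \<rho> N \<le> A * Minv (real n) powr (-D)"
      using Phi_le[OF adm, of N] up[of "Minv (real n)" N] inv[OF n] N by simp
    then show ?thesis using AQ by (simp add: powr_minus field_simps)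
  qed
  have lower: "1 / Minv (real n) powr D \<le> 1 / d * Phi_tilde G S \<rho> n" if n: "n0 \<le> real n" for n
  proof -
    define r where "r = Minv (real n)"
    define m where "m = nat \<lceil>r\<rceil>"
    have r: "1 \<le> r" "M r = real n" using inv[OF n] by (auto simp: r_def)
    have m: "r \<le> real m" "real m \<le> 2 * r" "1 \<le> m" using r unfolding m_def by linarith+
    have Mm: "real n \<le> M (real m)" using M_mono[of r "real m"] r m by simp
    have n1: "1 \<le> real n" "2 * B \<le> real n" using n by (auto simp: n0_def)
    have half: "B / M (real m) \<le> 1 / 2" using Mm n1 bB by (simp add: field_simps)
    have ratio: "real n / M (real m) \<le> 1" using Mm n1 by (simp add: field_simps)
    have "d * r powr (-D) = b * (2 * r) powr (-D) * exp (- (4 * B))" using r by (simp add: d_def powr_mult)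
    also have "\<dots> \<le> b * real m powr (-D) * exp (- (4 * B * (real n / M (real m))))"
    proof (intro mult_mono mult_left_mono)
      show "(2 * r) powr (-D) \<le> real m powr (-D)" using m D_pos by (intro powr_mono2') auto
      show "exp (- (4 * B)) \<le> exp (- (4 * B * (real n / M (real m))))"
        using mult_left_mono[OF ratio, of "4 * B"] bB by simp
    qed (use bB in auto)
    finally have "d * r powr (-D) \<le> b * real m powr (-D) * exp (- (4 * B * real n / M (real m)))" by simp
    then have "d * r powr (-D) \<le> Phi_tilde G S \<rho> n"
      using low[OF _ m(3) half, of _ n] by (intro Phi_ge[OF adm]) (meson order_trans)
    then show ?thesis using d r by (simp add: r_def powr_minus field_simps)
  qed
  show ?thesis
    unfolding sim_infinity_nat_def sim_infinity_def
  proof (intro exI conjI)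
    show "\<forall>\<^sub>F t in at_top. 1 / A * Phi_tilde G S \<rho> (nat \<lfloor>(Q + 1) * t\<rfloor>) \<le> 1 / Minv (real (nat \<lfloor>t\<rfloor>)) powr D \<and>
        1 / Minv (real (nat \<lfloor>t\<rfloor>)) powr D \<le> 1 / d * Phi_tilde G S \<rho> (nat \<lfloor>1 * t\<rfloor>)"
      using eventually_ge_at_top[of "n0 + 1"]
    proof eventually_elim
      case (elim t)
      have t: "1 \<le> t" "n0 \<le> real (nat \<lfloor>t\<rfloor>)" "real (nat \<lfloor>t\<rfloor>) \<le> t" using elim unfolding n0_def by linarith+
      have "Q * real (nat \<lfloor>t\<rfloor>) \<le> Q * t" using t AQ by (intro mult_left_mono) auto
      also have "\<dots> \<le> (Q + 1) * t - 1" using t by (simp add: algebra_simps)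
      also have "\<dots> \<le> real (nat \<lfloor>(Q + 1) * t\<rfloor>)" by linarith
      finally show ?case using upper[OF t(2)] lower[OF t(2)] by simp
    qed
  qed (use AQ d in auto)
qed

end

section \<open>Slow variation on the logarithmic scale\<close>

lemma eventually_nat_floor:
  fixes \<epsilon> :: real
  assumes "\<forall>\<^sub>F n in sequentially. Q n" and "0 < \<epsilon>"
  shows "\<forall>\<^sub>F t in at_top. Q (nat \<lfloor>\<epsilon> * t\<rfloor>)"
proof -
  obtain N where N: "\<And>n. N \<le> n \<Longrightarrow> Q n" using assms(1) by (auto simp: eventually_sequentially)
  show ?thesis
    using eventually_ge_at_top[of "(real N + 1) / \<epsilon>"]
  proof eventually_elim
    case (elim t)
    then have "real N + 1 \<le> \<epsilon> * t" using assms(2) by (simp add: field_simps)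
    then show ?case by (intro N) linarith
  qed
qed

text \<open>Constants inside an exponential are not constants in front of it; they are removed by a dilation
of the argument, which changes \<open>g\<close> by an arbitrarily small, respectively large,
factor.\<close>

lemma sim_exp_of_exponential_bounds:
  fixes P g :: "nat \<Rightarrow> real"
  assumes pos: "0 < A" "0 < B" "0 < c" "0 < C"
    and bounds: "\<forall>\<^sub>F n in sequentially. A * exp (- (C * g n)) \<le> P n \<and> P n \<le> B * exp (- (c * g n))"
    and scaling: "\<And>\<delta>. 0 < \<delta> \<Longrightarrow> \<exists>\<epsilon>::real>0. \<forall>\<^sub>F t in at_top. g (nat \<lfloor>\<epsilon> * t\<rfloor>) \<le> \<delta> * g (nat \<lfloor>t\<rfloor>)"
  shows "P \<simeq>\<^sub>\<nat> (\<lambda>n. exp (- g n))"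
proof -
  obtain e1 :: real where e1: "0 < e1" "\<forall>\<^sub>F t in at_top. g (nat \<lfloor>e1 * t\<rfloor>) \<le> c * g (nat \<lfloor>t\<rfloor>)"
    using scaling[OF pos(3)] by blast
  obtain e2 :: real where e2: "0 < e2" "\<forall>\<^sub>F t in at_top. g (nat \<lfloor>e2 * t\<rfloor>) \<le> 1 / C * g (nat \<lfloor>t\<rfloor>)"
    using scaling[of "1 / C"] pos by auto
  have "LIM t at_top. (1 / e1) * t :> at_top"
    using e1 by (intro filterlim_tendsto_pos_mult_at_top[OF tendsto_const]) (auto simp: filterlim_ident)
  from eventually_compose_filterlim[OF e1(2) this]
  have e1': "\<forall>\<^sub>F t in at_top. g (nat \<lfloor>t\<rfloor>) \<le> c * g (nat \<lfloor>1 / e1 * t\<rfloor>)" using e1 by simp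
  show ?thesis
    unfolding sim_infinity_nat_def sim_infinity_def
  proof (intro exI conjI)
    show "0 < 1 / B" "0 < 1 / e1" "0 < 1 / A" "0 < e2" using pos e1 e2 by auto
    show "\<forall>\<^sub>F t in at_top. 1 / B * P (nat \<lfloor>1 / e1 * t\<rfloor>) \<le> exp (- g (nat \<lfloor>t\<rfloor>)) \<and>
        exp (- g (nat \<lfloor>t\<rfloor>)) \<le> 1 / A * P (nat \<lfloor>e2 * t\<rfloor>)"
      using e1' e2(2) eventually_nat_floor[OF bounds e2(1)] eventually_nat_floor[OF bounds \<open>0 < 1 / e1\<close>]
    proof eventually_elim
      case (elim t)
      have "P (nat \<lfloor>1 / e1 * t\<rfloor>) \<le> B * exp (- (c * g (nat \<lfloor>1 / e1 * t\<rfloor>)))" using elim by simp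
      also have "\<dots> \<le> B * exp (- g (nat \<lfloor>t\<rfloor>))" using elim(1) pos by simp
      finally have 1: "1 / B * P (nat \<lfloor>1 / e1 * t\<rfloor>) \<le> exp (- g (nat \<lfloor>t\<rfloor>))" using pos by (simp add: field_simps)
      have "C * g (nat \<lfloor>e2 * t\<rfloor>) \<le> g (nat \<lfloor>t\<rfloor>)" using elim(2) pos by (simp add: field_simps)
      then have "A * exp (- g (nat \<lfloor>t\<rfloor>)) \<le> A * exp (- (C * g (nat \<lfloor>e2 * t\<rfloor>)))" using pos by simp
      also have "\<dots> \<le> P (nat \<lfloor>e2 * t\<rfloor>)" using elim by simp
      finally have "exp (- g (nat \<lfloor>t\<rfloor>)) \<le> 1 / A * P (nat \<lfloor>e2 * t\<rfloor>)" using pos by (simp add: field_simps)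
      with 1 show ?case by simp
    qed
  qed
qed

lemma slowly_varying_eventually:
  assumes "slowly_varying f" "0 < x" "1 < \<theta>"
  shows "\<forall>\<^sub>F t in at_top. 0 < f t \<and> f (x * t) \<le> \<theta> * f t \<and> f t \<le> \<theta> * f (x * t)"
proof -
  obtain a where a: "\<And>t. a \<le> t \<Longrightarrow> 0 < f t" using assms(1) by (auto simp: regularly_varying_def)
  have lim: "((\<lambda>t. f (x * t) / f t) \<longlongrightarrow> 1) at_top"
    using assms by (simp add: regularly_varying_def)
  have "\<forall>\<^sub>F t in at_top. f (x * t) / f t < \<theta>" "\<forall>\<^sub>F t in at_top. 1 / \<theta> < f (x * t) / f t"
    using assms(3) by (auto intro!: order_tendstoD[OF lim])
  then show ?thesis using eventually_ge_at_top[of a]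
  proof eventually_elim
    case (elim t)
    then show ?case using a[of t] assms(3) by (simp add: field_simps)
  qed
qed

lemma ex_dyadic_scale:
  fixes U u :: real
  assumes "0 < U" "U \<le> u"
  obtains k :: nat where "2 ^ k * U \<le> u" "u \<le> 2 ^ Suc k * U"
proof -
  obtain n where n: "u / U < 2 ^ n" using real_arch_pow[of 2 "u / U"] by auto
  define m where "m = (LEAST n. u / U < 2 ^ n)"
  have m: "u / U < 2 ^ m" unfolding m_def by (rule LeastI[of _ n]) (rule n)
  have "m \<noteq> 0" using m assms by (cases m) (auto simp: field_simps)
  then have "\<not> u / U < 2 ^ (m - 1)" unfolding m_def by (intro not_less_Least) auto
  then show ?thesis using that[of "m - 1"] m \<open>m \<noteq> 0\<close> assms by (simp add: field_simps flip: power_Suc)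
qed

text \<open>The octave property makes \<open>\<kappa>\<close> comparable at arguments whose ratio is bounded
but varies, as happens with integer parts. A function that is monotone up to a constant after
multiplication by a power has it if it is slowly varying.\<close>

locale log_slowly_varying =
  fixes \<kappa> :: "real \<Rightarrow> real" and B U0 :: real
  assumes U0: "1 \<le> U0" and B: "1 \<le> B"
    and kappa_pos: "\<And>t. U0 \<le> t \<Longrightarrow> 0 < \<kappa> t"
    and kappa_octave: "\<And>u v. U0 \<le> u \<Longrightarrow> U0 \<le> v \<Longrightarrow> u \<le> 2 * v \<Longrightarrow> v \<le> 2 * u \<Longrightarrow> \<kappa> v \<le> B * \<kappa> u"
    and kappa_sv: "slowly_varying \<kappa>"
    and kappa_powr: "\<And>a. 0 < a \<Longrightarrow> (\<lambda>t. \<kappa> (t powr a)) \<simeq>\<^sub>\<infinity> \<kappa>"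
begin

text \<open>A dyadic chain from \<open>[U,2U]\<close> to \<open>u\<close>, each step costing the factor
\<open>2\<^sup>\<eta>\<close>; the octave property covers the initial interval.\<close>

lemma kappa_Potter:
  assumes "0 < \<eta>"
  obtains C U where "1 \<le> C" "U0 \<le> U" "\<And>u. U \<le> u \<Longrightarrow> \<kappa> u \<le> C * u powr \<eta>" "\<And>u. U \<le> u \<Longrightarrow> u powr (-\<eta>) \<le> C * \<kappa> u"
proof -
  have "1 < 2 powr \<eta>" using assms by simp
  from slowly_varying_eventually[OF kappa_sv _ this, of 2]
  obtain U1 where U1: "\<And>t. U1 \<le> t \<Longrightarrow> \<kappa> (2 * t) \<le> 2 powr \<eta> * \<kappa> t \<and> \<kappa> t \<le> 2 powr \<eta> * \<kappa> (2 * t)"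
    by (auto simp: eventually_at_top_linorder)
  define U where "U = max U0 U1"
  have U: "1 \<le> U" "U0 \<le> U" "U1 \<le> U" using U0 by (auto simp: U_def)
  have kU: "0 < \<kappa> U" using kappa_pos U by simp
  have iter: "\<kappa> (2 ^ k * v) \<le> (2 ^ k) powr \<eta> * \<kappa> v \<and> \<kappa> v \<le> (2 ^ k) powr \<eta> * \<kappa> (2 ^ k * v)" if v: "U \<le> v" for k v
  proof (induction k)
    case (Suc k)
    have "v \<le> 2 ^ k * v" using v U by (simp add: mult_le_cancel_right1)
    then have "U1 \<le> 2 ^ k * v" using v U by linarith
    then have s: "\<kappa> (2 * (2 ^ k * v)) \<le> 2 powr \<eta> * \<kappa> (2 ^ k * v)" "\<kappa> (2 ^ k * v) \<le> 2 powr \<eta> * \<kappa> (2 * (2 ^ k * v))"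
      using U1[of "2 ^ k * v"] by auto
    have p: "(2 ^ Suc k :: real) powr \<eta> = 2 powr \<eta> * (2 ^ k) powr \<eta>" by (simp add: powr_mult)
    have "\<kappa> (2 ^ Suc k * v) \<le> 2 powr \<eta> * ((2 ^ k) powr \<eta> * \<kappa> v)"
      using order_trans[OF s(1) mult_left_mono[OF Suc[THEN conjunct1], of "2 powr \<eta>"]] by (simp add: mult.assoc)
    moreover have "\<kappa> v \<le> (2 ^ k) powr \<eta> * (2 powr \<eta> * \<kappa> (2 ^ Suc k * v))"
      using order_trans[OF Suc[THEN conjunct2] mult_left_mono[OF s(2), of "(2 ^ k) powr \<eta>"]] by (simp add: mult.assoc)
    ultimately show ?case unfolding p by (simp add: mult_ac)
  qed simp
  define C where "C = max 1 (max (B * \<kappa> U) (B / \<kappa> U))"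
  have main: "\<kappa> u \<le> C * u powr \<eta> \<and> u powr (-\<eta>) \<le> C * \<kappa> u" if u: "U \<le> u" for u
  proof -
    obtain k where k: "2 ^ k * U \<le> u" "u \<le> 2 ^ Suc k * U" using ex_dyadic_scale[of U u] U u by auto
    define v where "v = u / 2 ^ k"
    have v: "U \<le> v" "v \<le> 2 * U" "u = 2 ^ k * v" using k by (auto simp: v_def field_simps)
    have "2 ^ k * 1 \<le> 2 ^ k * U" using U by (intro mult_left_mono) auto
    then have "2 ^ k \<le> u" using k by linarith
    then have pk: "(2 ^ k) powr \<eta> \<le> u powr \<eta>" using assms by (intro powr_mono2) auto
    have kv: "\<kappa> v \<le> B * \<kappa> U" "\<kappa> U \<le> B * \<kappa> v" using v U by (auto intro!: kappa_octave)
    have kv0: "0 < \<kappa> v" "0 < \<kappa> u" using v u U by (auto intro!: kappa_pos)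
    have "\<kappa> u \<le> u powr \<eta> * (B * \<kappa> U)"
    proof -
      have "\<kappa> u \<le> (2 ^ k) powr \<eta> * \<kappa> v" using iter[OF v(1), of k] v(3) by simp
      also have "\<dots> \<le> u powr \<eta> * (B * \<kappa> U)" using pk kv kv0 by (intro mult_mono) auto
      finally show ?thesis .
    qed
    also have "\<dots> \<le> u powr \<eta> * C" by (intro mult_left_mono) (auto simp: C_def)
    finally have 1: "\<kappa> u \<le> C * u powr \<eta>" by (simp add: mult.commute)
    have "\<kappa> U \<le> B * (u powr \<eta> * \<kappa> u)"
    proof -
      have "\<kappa> v \<le> (2 ^ k) powr \<eta> * \<kappa> u" using iter[OF v(1), of k] v(3) by simp
      also have "\<dots> \<le> u powr \<eta> * \<kappa> u" using pk kv0 by (intro mult_right_mono) auto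
      finally have "B * \<kappa> v \<le> B * (u powr \<eta> * \<kappa> u)" using B by (intro mult_left_mono) auto
      then show ?thesis using kv by linarith
    qed
    then have "u powr (-\<eta>) \<le> B / \<kappa> U * \<kappa> u" using kU u U by (simp add: powr_minus field_simps)
    also have "\<dots> \<le> C * \<kappa> u" using kv0 by (intro mult_right_mono) (auto simp: C_def)
    finally show ?thesis using 1 by simp
  qed
  show ?thesis by (rule that[of C U]) (use main U in \<open>auto simp: C_def\<close>)
qed

text \<open>The dilations in the relation \<open>\<simeq>\<close> act on \<open>t\<^sup>a\<close> as fixed
factors, which slow variation removes.\<close>

lemma kappa_powr_pointwise:
  assumes "0 < a"
  obtains b T where "1 \<le> b" "U0 \<le> T" "\<And>t. T \<le> t \<Longrightarrow> \<kappa> (t powr a) \<le> b * \<kappa> t" "\<And>t. T \<le> t \<Longrightarrow> \<kappa> t \<le> b * \<kappa> (t powr a)"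
proof -
  obtain c1 c2 c3 c4 where c: "c1 > 0" "c2 > 0" "c3 > 0" "c4 > 0"
    and ev: "\<forall>\<^sub>F t in at_top. c1 * \<kappa> ((c2 * t) powr a) \<le> \<kappa> t \<and> \<kappa> t \<le> c3 * \<kappa> ((c4 * t) powr a)"
    using kappa_powr[OF assms] unfolding sim_infinity_def by blast
  have pw: "LIM t at_top. t powr a :> at_top" using assms by (rule real_powr_at_top)
  have s: "\<forall>\<^sub>F t in at_top. 0 < \<kappa> (t powr a) \<and> \<kappa> (x * t powr a) \<le> 2 * \<kappa> (t powr a) \<and> \<kappa> (t powr a) \<le> 2 * \<kappa> (x * t powr a)"
    if "0 < x" for x
    by (rule eventually_compose_filterlim[OF slowly_varying_eventually[OF kappa_sv that, of 2] pw]) simp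
  define b where "b = max 1 (max (2 / c1) (2 * c3))"
  have cp: "0 < c2 powr a" "0 < c4 powr a" using c by auto
  have "\<forall>\<^sub>F t in at_top. \<kappa> (t powr a) \<le> b * \<kappa> t \<and> \<kappa> t \<le> b * \<kappa> (t powr a)"
    using ev s[OF cp(1)] s[OF cp(2)] eventually_ge_at_top[of U0]
  proof eventually_elim
    case (elim t)
    have t: "0 < \<kappa> t" "0 \<le> t" using elim U0 by (auto intro: kappa_pos)
    have pm: "(c2 * t) powr a = c2 powr a * t powr a" "(c4 * t) powr a = c4 powr a * t powr a"
      using c t by (simp_all add: powr_mult)
    have "c1 * \<kappa> (t powr a) \<le> c1 * (2 * \<kappa> (c2 powr a * t powr a))" using elim c by (intro mult_left_mono) auto
    also have "\<dots> = 2 * (c1 * \<kappa> ((c2 * t) powr a))" using pm by simp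
    also have "\<dots> \<le> 2 * \<kappa> t" using elim by simp
    finally have "\<kappa> (t powr a) \<le> 2 / c1 * \<kappa> t" using c by (simp add: field_simps)
    also have "\<dots> \<le> b * \<kappa> t" using t by (intro mult_right_mono) (auto simp: b_def)
    finally have 1: "\<kappa> (t powr a) \<le> b * \<kappa> t" .
    have "\<kappa> t \<le> c3 * \<kappa> (c4 powr a * t powr a)" using elim pm by simp
    also have "\<dots> \<le> c3 * (2 * \<kappa> (t powr a))" using elim c by (intro mult_left_mono) auto
    also have "\<dots> \<le> b * \<kappa> (t powr a)" 
    proof -
      have "2 * c3 * \<kappa> (t powr a) \<le> b * \<kappa> (t powr a)" using elim by (intro mult_right_mono) (auto simp: b_def)
      then show ?thesis by simp
    qed
    finally show ?case using 1 by simp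
  qed
  then obtain T where "\<And>t. T \<le> t \<Longrightarrow> \<kappa> (t powr a) \<le> b * \<kappa> t \<and> \<kappa> t \<le> b * \<kappa> (t powr a)"
    by (auto simp: eventually_at_top_linorder)
  then show ?thesis by (intro that[of b "max U0 T"]) (auto simp: b_def)
qed

text \<open>The hypothesis compares \<open>\<kappa>(t\<^sup>a)\<close> with \<open>\<kappa>(t)\<close> for
each exponent separately, whereas the exponents that occur later vary with \<open>t\<close>. As
in the uniform boundedness principle, the exponents that admit a common constant
\<open>k\<close> from the time \<open>k\<close> on exhaust \<open>[1,2]\<close>, so by Baire's
theorem one of these sets is dense in an interval. Density suffices, since a small change of
exponent keeps \<open>t\<^sup>a\<close> within an octave. Finally the interval is moved to
\<open>\<beta>\<close> by one further application of the pointwise statement.\<close>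

lemma kappa_powr_locally_uniform:
  assumes \<beta>: "0 < \<beta>"
  obtains \<delta> b T where "0 < \<delta>" "1 \<le> b" "U0 \<le> T"
    "\<And>t a. T \<le> t \<Longrightarrow> \<bar>a - \<beta>\<bar> \<le> \<delta> \<Longrightarrow> \<kappa> (t powr a) \<le> b * \<kappa> t"
    "\<And>t a. T \<le> t \<Longrightarrow> \<bar>a - \<beta>\<bar> \<le> \<delta> \<Longrightarrow> \<kappa> t \<le> b * \<kappa> (t powr a)"
proof -
  define E where "E k = {a \<in> {1..2}. \<forall>t\<ge>real k. \<kappa> (t powr a) \<le> real k * \<kappa> t \<and> \<kappa> t \<le> real k * \<kappa> (t powr a)}" for k :: nat
  have cover: "\<exists>k. a \<in> E k" if a: "a \<in> {1..2}" for a
  proof -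
    obtain b T where bT: "1 \<le> b" "U0 \<le> T" "\<And>t. T \<le> t \<Longrightarrow> \<kappa> (t powr a) \<le> b * \<kappa> t" "\<And>t. T \<le> t \<Longrightarrow> \<kappa> t \<le> b * \<kappa> (t powr a)"
      using kappa_powr_pointwise[of a] a by (metis atLeastAtMost_iff less_le_trans zero_less_one)
    obtain k :: nat where k: "max b T \<le> real k" using real_arch_simple by blast
    have "\<kappa> (t powr a) \<le> real k * \<kappa> t \<and> \<kappa> t \<le> real k * \<kappa> (t powr a)" if t: "real k \<le> t" for t
    proof -
      have "t powr 1 \<le> t powr a" using a t k bT U0 by (intro powr_mono) auto
      then have "0 < \<kappa> t" "0 < \<kappa> (t powr a)" using t k bT U0 by (auto intro!: kappa_pos)
      then have "b * \<kappa> t \<le> real k * \<kappa> t" "b * \<kappa> (t powr a) \<le> real k * \<kappa> (t powr a)"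
        using k by (auto intro!: mult_right_mono)
      then show ?thesis using bT(3,4)[of t] t k by auto
    qed
    then show ?thesis using a by (auto simp: E_def)
  qed
  have "\<exists>k l h. 1 \<le> l \<and> l < h \<and> h \<le> 2 \<and> {l..h} \<subseteq> closure (E k)"
  proof (rule ccontr)
    assume neg: "\<not> ?thesis"
    define \<G> where "\<G> = range (\<lambda>k. {1..2} - closure (E k))"
    have "{1..2::real} \<subseteq> closure (\<Inter>\<G>)"
    proof (rule Baire)
      show "countable \<G>" by (simp add: \<G>_def)
      fix T assume "T \<in> \<G>"
      then obtain k where T: "T = {1..2} - closure (E k)" by (auto simp: \<G>_def)
      have "openin (top_of_set {1..2}) T"
        unfolding T by (metis Diff_eq closed_closure open_Compl openin_open_Int)
      moreover have "x \<in> closure T" if x: "x \<in> {1..2}" for x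
        unfolding closure_approachable
      proof (intro allI impI)
        fix e :: real assume e: "0 < e"
        define l h where "l = max 1 (x - e / 2)" and "h = min 2 (x + e / 2)"
        have lh: "1 \<le> l" "l < h" "h \<le> 2" using x e by (auto simp: l_def h_def)
        then obtain y where y: "y \<in> {l..h}" "y \<notin> closure (E k)" using neg by blast
        have "dist y x < e" using y(1) e by (auto simp: l_def h_def dist_real_def)
        moreover have "y \<in> T" using y lh by (auto simp: T)
        ultimately show "\<exists>y\<in>T. dist y x < e" by blast
      qed
      ultimately show "openin (top_of_set {1..2}) T \<and> {1..2} \<subseteq> closure T" by blast
    qed simp
    moreover have "\<Inter>\<G> = {}"
    proof -
      have "y \<in> {1..2}" "\<And>k. y \<notin> E k" if "y \<in> \<Inter>\<G>" for y
        using that closure_subset by (auto simp: \<G>_def)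
      then show ?thesis using cover by blast
    qed
    ultimately show False by simp
  qed
  then obtain k l h where lh: "1 \<le> l" "l < h" "h \<le> 2" and sub: "{l..h} \<subseteq> closure (E k)" by blast
  define T1 where "T1 = max (max (real k) 2) U0"
  have unif: "\<kappa> (t powr a) \<le> B * real k * \<kappa> t \<and> \<kappa> t \<le> B * real k * \<kappa> (t powr a)"
    if t: "T1 \<le> t" and a: "a \<in> {l..h}" for t a
  proof -
    have t2: "2 \<le> t" "real k \<le> t" "U0 \<le> t" using t by (auto simp: T1_def)
    then have lnt: "0 < ln t" by simp
    have "a \<in> closure (E k)" using a sub by blast
    moreover have "0 < ln 2 / ln t" using lnt by simp
    ultimately obtain a' where a': "a' \<in> E k" "dist a' a < ln 2 / ln t"
      unfolding closure_approachable by blast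
    have close: "s powr p \<le> 2 * s powr q" if "s = t" "\<bar>p - q\<bar> < ln 2 / ln t" for s p q
    proof -
      have "(p - q) * ln t \<le> ln 2 / ln t * ln t" using that lnt by (intro mult_right_mono) auto
      then have "p * ln t \<le> ln 2 + q * ln t" using lnt by (simp add: algebra_simps)
      then have "exp (p * ln t) \<le> exp (ln 2 + q * ln t)" by simp
      then show ?thesis using that t2 by (simp add: powr_def exp_add)
    qed
    have near: "t powr a \<le> 2 * t powr a'" "t powr a' \<le> 2 * t powr a"
      using a'(2) by (auto intro!: close simp: dist_real_def abs_minus_commute)
    have a1: "1 \<le> a" "1 \<le> a'" using a lh a' by (auto simp: E_def)
    have "t powr 1 \<le> t powr a" "t powr 1 \<le> t powr a'" using t2 a1 by (intro powr_mono; simp)+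
    then have ge: "U0 \<le> t powr a" "U0 \<le> t powr a'" using t2 by auto
    have oct: "\<kappa> (t powr a) \<le> B * \<kappa> (t powr a')" "\<kappa> (t powr a') \<le> B * \<kappa> (t powr a)"
      using near ge by (auto intro!: kappa_octave)
    have Ek: "\<kappa> (t powr a') \<le> real k * \<kappa> t" "\<kappa> t \<le> real k * \<kappa> (t powr a')" using a'(1) t2 by (auto simp: E_def)
    have "\<kappa> (t powr a) \<le> B * (real k * \<kappa> t)" using order_trans[OF oct(1) mult_left_mono[OF Ek(1)]] B by simp
    moreover have "\<kappa> t \<le> real k * (B * \<kappa> (t powr a))" using order_trans[OF Ek(2) mult_left_mono[OF oct(2)]] by simp
    ultimately show ?thesis by (simp add: mult_ac)
  qed
  define b0 where "b0 = (l + h) / 2"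
  have b0: "0 < b0" "\<And>a. \<bar>a - b0\<bar> \<le> (h - l) / 2 \<Longrightarrow> a \<in> {l..h}"
    using lh by (auto simp: b0_def abs_le_iff field_simps)
  obtain b T where bT: "1 \<le> b" "U0 \<le> T" "\<And>t. T \<le> t \<Longrightarrow> \<kappa> (t powr (\<beta> / b0)) \<le> b * \<kappa> t" "\<And>t. T \<le> t \<Longrightarrow> \<kappa> t \<le> b * \<kappa> (t powr (\<beta> / b0))"
    using kappa_powr_pointwise[of "\<beta> / b0"] \<beta> b0 by (metis divide_pos_pos)
  define k1 where "k1 = max 1 (B * real k)"
  define T2 where "T2 = max T (T1 powr (b0 / \<beta>))"
  define \<delta> where "\<delta> = \<beta> * (h - l) / (2 * b0)"
  have main: "\<kappa> (t powr a) \<le> k1 * b * \<kappa> t \<and> \<kappa> t \<le> k1 * b * \<kappa> (t powr a)" if t: "T2 \<le> t" and a: "\<bar>a - \<beta>\<bar> \<le> \<delta>" for t a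
  proof -
    define s where "s = t powr (\<beta> / b0)"
    define a' where "a' = a * b0 / \<beta>"
    have t0: "T \<le> t" "0 < t" "T1 powr (b0 / \<beta>) \<le> t" using t bT U0 by (auto simp: T2_def)
    have T1: "0 < T1" by (simp add: T1_def less_max_iff_disj)
    have "(T1 powr (b0 / \<beta>)) powr (\<beta> / b0) \<le> s"
      unfolding s_def using t0 \<beta> b0 by (intro powr_mono2) auto
    then have s: "T1 \<le> s" using T1 \<beta> b0 by (simp add: powr_powr)
    have "a' - b0 = (a - \<beta>) * (b0 / \<beta>)" using \<beta> by (simp add: a'_def field_simps)
    then have "\<bar>a' - b0\<bar> = \<bar>a - \<beta>\<bar> * (b0 / \<beta>)" using \<beta> b0 by (simp add: abs_mult)
    also have "\<dots> \<le> \<delta> * (b0 / \<beta>)" using a \<beta> b0 by (intro mult_right_mono) auto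
    also have "\<dots> = (h - l) / 2" using \<beta> b0 by (simp add: \<delta>_def)
    finally have a': "a' \<in> {l..h}" by (rule b0(2))
    have ta: "t powr a = s powr a'" using \<beta> b0 by (simp add: s_def a'_def powr_powr)
    have 1: "\<kappa> (t powr a) \<le> B * real k * \<kappa> s" "\<kappa> s \<le> B * real k * \<kappa> (t powr a)"
      using unif[OF s a'] by (auto simp: ta)
    have 2: "\<kappa> s \<le> b * \<kappa> t" "\<kappa> t \<le> b * \<kappa> s" using bT(3,4)[OF t0(1)] by (auto simp: s_def)
    have "0 < \<kappa> s" "0 < \<kappa> t" using s t0 bT by (auto intro!: kappa_pos simp: T1_def)
    moreover have "0 < \<kappa> (t powr a)"
    proof -
      have "1 \<le> a'" "1 \<le> s" using a' lh s U0 by (auto simp: T1_def)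
      then have "s powr 1 \<le> s powr a'" by (intro powr_mono) auto
      then show ?thesis using s unfolding ta by (intro kappa_pos) (auto simp: T1_def)
    qed
    ultimately have 3: "\<kappa> (t powr a) \<le> k1 * \<kappa> s" "\<kappa> s \<le> k1 * \<kappa> (t powr a)"
      using 1 by (auto simp: k1_def max_def intro: order_trans[OF 1(1)] order_trans[OF 1(2)] mult_right_mono)
    have k1: "0 \<le> k1" by (simp add: k1_def)
    have "\<kappa> (t powr a) \<le> k1 * (b * \<kappa> t)" using order_trans[OF 3(1) mult_left_mono[OF 2(1) k1]] .
    moreover have "\<kappa> t \<le> b * (k1 * \<kappa> (t powr a))" using order_trans[OF 2(2) mult_left_mono[OF 3(2)]] bT by simp
    ultimately show ?thesis by (simp add: mult_ac)
  qed
  have kb: "1 \<le> k1 * b" using bT(1) mult_mono[of 1 k1 1 b] by (simp add: k1_def)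
  show ?thesis
  proof (rule that[of \<delta> "k1 * b" T2])
    show "0 < \<delta>" using \<beta> b0 lh by (simp add: \<delta>_def)
    show "U0 \<le> T2" using bT by (simp add: T2_def)
  qed (use main kb in auto)
qed

text \<open>For \<open>\<beta> = \<gamma>/(1+\<gamma>)\<close> this is the solution \<open>u\<close>, up to
constants, of \<open>u\<^bsup>1+1/\<gamma>\<^esup> \<kappa>(u) = x\<close>.\<close>

definition scale :: "real \<Rightarrow> real \<Rightarrow> real" where "scale \<beta> x = (x / \<kappa> x) powr \<beta>"

text \<open>Since \<open>\<kappa>(x)\<close> and its reciprocal grow more slowly than every power,
\<open>scale \<beta> x = x\<^sup>a\<close> with \<open>a\<close> as close to
\<open>\<beta>\<close> as desired; the locally uniform comparison then replaces
\<open>\<kappa>(x)\<close> by \<open>\<kappa>\<close> at the scale.\<close>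

lemma kappa_scale:
  assumes \<beta>: "0 < \<beta>"
  obtains b T where "1 \<le> b" "U0 \<le> T"
    "\<And>x. T \<le> x \<Longrightarrow> \<kappa> (scale \<beta> x) \<le> b * \<kappa> x" "\<And>x. T \<le> x \<Longrightarrow> \<kappa> x \<le> b * \<kappa> (scale \<beta> x)"
    "\<And>x. T \<le> x \<Longrightarrow> x powr (\<beta> / 2) \<le> scale \<beta> x"
proof -
  obtain \<delta> b T where \<delta>: "0 < \<delta>" "1 \<le> b" "U0 \<le> T"
    and unif: "\<And>t a. T \<le> t \<Longrightarrow> \<bar>a - \<beta>\<bar> \<le> \<delta> \<Longrightarrow> \<kappa> (t powr a) \<le> b * \<kappa> t"
    "\<And>t a. T \<le> t \<Longrightarrow> \<bar>a - \<beta>\<bar> \<le> \<delta> \<Longrightarrow> \<kappa> t \<le> b * \<kappa> (t powr a)"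
    by (rule kappa_powr_locally_uniform[OF \<beta>]) blast
  define \<eta> where "\<eta> = min (1/4) (\<delta> / (2 * \<beta>))"
  have \<eta>: "0 < \<eta>" "2 * \<eta> \<le> 1 / 2" "2 * \<eta> * \<beta> \<le> \<delta>" using \<delta> \<beta> by (auto simp: \<eta>_def min_def field_simps)
  obtain C U where C: "1 \<le> C" "U0 \<le> U" "\<And>u. U \<le> u \<Longrightarrow> \<kappa> u \<le> C * u powr \<eta>" "\<And>u. U \<le> u \<Longrightarrow> u powr (-\<eta>) \<le> C * \<kappa> u"
    by (rule kappa_Potter[OF \<eta>(1)]) blast
  define T' where "T' = max (max T U) (max 2 (exp (ln C / \<eta>)))"
  have main: "\<kappa> (scale \<beta> x) \<le> b * \<kappa> x \<and> \<kappa> x \<le> b * \<kappa> (scale \<beta> x) \<and> x powr (\<beta> / 2) \<le> scale \<beta> x" if x: "T' \<le> x" for x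
  proof -
    have x2: "T \<le> x" "U \<le> x" "2 \<le> x" "exp (ln C / \<eta>) \<le> x" using x by (auto simp: T'_def)
    have lnx: "0 < ln x" using x2 by simp
    have "ln C / \<eta> \<le> ln x" using x2 by (simp add: ln_ge_iff)
    then have lnC: "ln C \<le> \<eta> * ln x" using \<eta> by (simp add: field_simps)
    have kx: "0 < \<kappa> x" using x2 C by (auto intro!: kappa_pos)
    have "ln (\<kappa> x) \<le> ln (C * x powr \<eta>)" using C(3)[OF x2(2)] kx by simp
    also have "\<dots> = ln C + \<eta> * ln x" using C x2 by (simp add: ln_mult ln_powr)
    finally have up: "ln (\<kappa> x) \<le> 2 * \<eta> * ln x" using lnC by linarith
    have "ln (x powr (-\<eta>)) \<le> ln (C * \<kappa> x)" using C(4)[OF x2(2)] kx x2 C(1) by (subst ln_le_cancel_iff) auto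
    also have "\<dots> = ln C + ln (\<kappa> x)" using C kx by (simp add: ln_mult)
    finally have "- (\<eta> * ln x) \<le> ln C + ln (\<kappa> x)" using x2 by (simp add: ln_powr)
    then have lo: "- (2 * \<eta> * ln x) \<le> ln (\<kappa> x)" using lnC by linarith
    define q where "q = ln (\<kappa> x) / ln x"
    have q: "\<bar>q\<bar> \<le> 2 * \<eta>" "ln (\<kappa> x) = q * ln x" using up lo lnx by (auto simp: q_def abs_le_iff field_simps)
    define a where "a = \<beta> * (1 - q)"
    have "\<bar>a - \<beta>\<bar> = \<beta> * \<bar>q\<bar>" using \<beta> by (simp add: a_def algebra_simps abs_mult)
    also have "\<dots> \<le> \<beta> * (2 * \<eta>)" using q \<beta> by (intro mult_left_mono) auto
    finally have ad: "\<bar>a - \<beta>\<bar> \<le> \<delta>" using \<eta> by (simp add: mult_ac)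
    have sc: "scale \<beta> x = x powr a"
      using kx x2 q(2) by (simp add: scale_def powr_def a_def ln_div algebra_simps)
    have "\<beta> / 2 \<le> a"
    proof -
      have "\<beta> * (1 / 2) \<le> \<beta> * (1 - q)" using q(1) \<eta> \<beta> by (intro mult_left_mono) auto
      then show ?thesis by (simp add: a_def)
    qed
    then have "x powr (\<beta> / 2) \<le> x powr a" using x2 by (intro powr_mono) auto
    then show ?thesis using unif[OF x2(1) ad] by (simp add: sc)
  qed
  show ?thesis by (rule that[of b T']) (use main \<delta> in \<open>auto simp: T'_def\<close>)
qed

text \<open>Slow variation at the fixed ratio \<open>\<epsilon>\<close> costs the factor two and the integer
parts cost the octave constant \<open>B\<close>, neither depending on \<open>\<epsilon>\<close>.
Hence \<open>\<epsilon>\<close> may be chosen after them.\<close>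

lemma scale_scaling:
  assumes \<beta>: "0 < \<beta>" and \<delta>: "0 < \<delta>"
  shows "\<exists>\<epsilon>::real>0. \<forall>\<^sub>F t in at_top. scale \<beta> (real (nat \<lfloor>\<epsilon> * t\<rfloor>)) \<le> \<delta> * scale \<beta> (real (nat \<lfloor>t\<rfloor>))"
proof -
  define \<epsilon> where "\<epsilon> = \<delta> powr (1 / \<beta>) / (4 * B)"
  have \<epsilon>: "0 < \<epsilon>" using \<delta> B by (simp add: \<epsilon>_def)
  have "\<forall>\<^sub>F n in sequentially. 0 < \<kappa> (real n) \<and> \<kappa> (\<epsilon> * real n) \<le> 2 * \<kappa> (real n) \<and> \<kappa> (real n) \<le> 2 * \<kappa> (\<epsilon> * real n)"
    by (rule eventually_compose_filterlim[OF slowly_varying_eventually[OF kappa_sv \<epsilon>, of 2] filterlim_real_sequentially]) simp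
  from eventually_nat_floor[OF this zero_less_one]
  have ev: "\<forall>\<^sub>F t::real in at_top. 0 < \<kappa> (real (nat \<lfloor>t\<rfloor>)) \<and> \<kappa> (\<epsilon> * real (nat \<lfloor>t\<rfloor>)) \<le> 2 * \<kappa> (real (nat \<lfloor>t\<rfloor>)) \<and>
      \<kappa> (real (nat \<lfloor>t\<rfloor>)) \<le> 2 * \<kappa> (\<epsilon> * real (nat \<lfloor>t\<rfloor>))" by simp
  have "\<forall>\<^sub>F t in at_top. scale \<beta> (real (nat \<lfloor>\<epsilon> * t\<rfloor>)) \<le> \<delta> * scale \<beta> (real (nat \<lfloor>t\<rfloor>))"
    using ev eventually_ge_at_top[of "2 * (U0 + 2) / \<epsilon> + U0 + 2"]
  proof eventually_elim
    case (elim t)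
    define n n' where "n = real (nat \<lfloor>t\<rfloor>)" and "n' = real (nat \<lfloor>\<epsilon> * t\<rfloor>)"
    have big: "2 * (U0 + 2) / \<epsilon> \<le> t - (U0 + 2)" "0 \<le> 2 * (U0 + 2) / \<epsilon>" using elim(2) \<epsilon> U0 by auto
    have n: "n \<le> t" "t \<le> n + 1" "U0 \<le> n" "1 \<le> n" using big U0 unfolding n_def by linarith+
    have "2 * (U0 + 2) / \<epsilon> \<le> n" using big n U0 by linarith
    then have en: "2 * (U0 + 2) \<le> \<epsilon> * n" using \<epsilon> by (simp add: field_simps)
    have ent: "\<epsilon> * n \<le> \<epsilon> * t" "\<epsilon> * t \<le> \<epsilon> * (n + 1)" using n \<epsilon> by (auto intro!: mult_left_mono)
    have "\<epsilon> * (n + 1) \<le> \<epsilon> * (2 * n)" using n \<epsilon> by (intro mult_left_mono) auto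
    then have n': "n' \<le> 2 * (\<epsilon> * n)" "\<epsilon> * n \<le> 2 * n'" "U0 \<le> n'" "U0 \<le> \<epsilon> * n"
    proof -
      define y z where "y = \<epsilon> * t" and "z = \<epsilon> * n"
      have yz: "z \<le> y" "y \<le> 2 * z" "2 * (U0 + 2) \<le> z"
        using ent en \<open>\<epsilon> * (n + 1) \<le> \<epsilon> * (2 * n)\<close> by (auto simp: y_def z_def)
      have fl: "n' \<le> y" "y \<le> n' + 1" using yz U0 unfolding n'_def y_def[symmetric] by linarith+
      have "n' \<le> 2 * z" "z \<le> 2 * n'" "U0 \<le> n'" "U0 \<le> z"
        using fl yz U0 by auto
      then show "n' \<le> 2 * (\<epsilon> * n)" "\<epsilon> * n \<le> 2 * n'" "U0 \<le> n'" "U0 \<le> \<epsilon> * n"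
        by (auto simp: z_def)
    qed
    have kn: "0 < \<kappa> n" "\<kappa> n \<le> 2 * \<kappa> (\<epsilon> * n)" using elim(1) n by (auto simp: n_def)
    have "\<kappa> n \<le> 2 * (B * \<kappa> n')"
      using kn(2) kappa_octave[OF n'(3) n'(4)] n' by simp
    then have "n' / \<kappa> n' \<le> 2 * (\<epsilon> * n) / (\<kappa> n / (2 * B))"
      using n' kn B kappa_pos[OF n'(3)] \<epsilon> n by (intro frac_le) (auto simp: field_simps)
    also have "\<dots> = 4 * B * \<epsilon> * (n / \<kappa> n)" by simp
    also have "4 * B * \<epsilon> = \<delta> powr (1 / \<beta>)" using B by (simp add: \<epsilon>_def)
    finally have "scale \<beta> n' \<le> (\<delta> powr (1 / \<beta>) * (n / \<kappa> n)) powr \<beta>"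
      unfolding scale_def using \<beta> n' U0 kappa_pos[OF n'(3)] by (intro powr_mono2) auto
    also have "\<dots> = (\<delta> powr (1 / \<beta>)) powr \<beta> * (n / \<kappa> n) powr \<beta>"
      using n kn by (subst powr_mult) auto
    also have "\<dots> = \<delta> * scale \<beta> n" using \<beta> \<delta> by (simp add: scale_def powr_powr)
    finally show ?case by (simp only: n_def n'_def)
  qed
  then show ?thesis using \<epsilon> by blast
qed

end

section \<open>Balance of volume growth against long jumps\<close>

context moment_scale
begin

text \<open>If \<open>\<rho>\<close> at most doubles when its argument does, then
\<open>s\<^sup>2/\<rho>(s)\<close> at least doubles along powers of two, and the integral
\<open>I\<close> is dominated by its last dyadic block.\<close>

lemma rho_le_M_of_doubling:
  assumes T: "1 \<le> T" and dbl: "\<And>t. T \<le> t \<Longrightarrow> \<rho> (2 * t) \<le> 2 * \<rho> t"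
  obtains B where "0 < B" "\<And>R. T \<le> R \<Longrightarrow> \<rho> R \<le> B * M R"
proof -
  define J where "J k = 4 ^ k / \<rho> (2 ^ k * T)" for k :: nat
  define B where "B = max (I T * \<rho> T) (2 * T\<^sup>2)"
  have B: "2 * T\<^sup>2 \<le> B" "0 < B" using T by (auto simp: B_def less_max_iff_disj)
  have ge: "T \<le> 2 ^ k * T" for k :: nat using T by (simp add: mult_le_cancel_right1)
  have pos: "0 < \<rho> (2 ^ k * T)" for k :: nat using ge[of k] T by (intro rho_pos) linarith
  have J: "0 < J k" "2 * J k \<le> J (Suc k)" for k
  proof -
    show "0 < J k" using pos by (simp add: J_def)
    have "\<rho> (2 ^ Suc k * T) \<le> 2 * \<rho> (2 ^ k * T)" using dbl[OF ge[of k]] by (simp add: mult.assoc)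
    then have "4 ^ Suc k / (2 * \<rho> (2 ^ k * T)) \<le> 4 ^ Suc k / \<rho> (2 ^ Suc k * T)"
      by (intro divide_left_mono mult_pos_pos pos) auto
    then show "2 * J k \<le> J (Suc k)" by (simp add: J_def)
  qed
  have IJ: "I (2 ^ k * T) \<le> B * J k" for k
  proof (induction k)
    case 0
    have "I T * \<rho> T / \<rho> T \<le> B / \<rho> T" using pos[of 0] by (intro divide_right_mono) (auto simp: B_def)
    then show ?case using pos[of 0] by (simp add: J_def)
  next
    case (Suc k)
    let ?a = "2 ^ k * T"
    have a2: "?a\<^sup>2 = 4 ^ k * T\<^sup>2" 
    proof -
      have "(2 ^ k)\<^sup>2 = (4::real) ^ k" by (simp add: power2_eq_square flip: power_mult_distrib)
      then show ?thesis by (simp add: power_mult_distrib)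
    qed
    have "I (2 * ?a) - I ?a \<le> ((2 * ?a)\<^sup>2 - ?a\<^sup>2) / (2 * \<rho> ?a)"
      using ge[of k] T by (intro I_increment_bounds(2)) auto
    also have "\<dots> = 3 / 2 * ?a\<^sup>2 / \<rho> ?a" by (simp add: power_mult_distrib)
    also have "\<dots> = 3 / 2 * T\<^sup>2 * J k" unfolding a2 by (simp add: J_def)
    also have "\<dots> \<le> B * J k" using B J(1)[of k] by (intro mult_right_mono) auto
    finally have "I (2 ^ Suc k * T) \<le> B * (2 * J k)" using Suc by (simp add: mult.assoc)
    also have "\<dots> \<le> B * J (Suc k)" using B J(2)[of k] by (intro mult_left_mono) auto
    finally show ?case .
  qed
  show ?thesis
  proof (rule that[of "4 * B"])
    fix R assume R: "T \<le> R"
    obtain k where k: "2 ^ k * T \<le> R" "R \<le> 2 ^ Suc k * T" using ex_dyadic_scale[of T R] T R by auto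
    have R0: "0 < R" "0 < \<rho> R" using R T by (auto intro!: rho_pos)
    have "4 ^ k \<le> R\<^sup>2"
    proof -
      have "2 ^ k * 1 \<le> 2 ^ k * T" using T by (intro mult_left_mono) auto
      then have "2 ^ k \<le> R" using k by linarith
      then have "(2 ^ k)\<^sup>2 \<le> R\<^sup>2" by (intro power_mono) auto
      then show ?thesis by (simp add: power2_eq_square flip: power_mult_distrib)
    qed
    have "I R \<le> I (2 ^ Suc k * T)" using k R0 by (intro I_mono) auto
    also have "\<dots> \<le> B * J (Suc k)" by (rule IJ)
    also have "\<dots> = 4 * B * (4 ^ k / \<rho> (2 ^ Suc k * T))" by (simp add: J_def)
    also have "\<dots> \<le> 4 * B * (R\<^sup>2 / \<rho> R)"
      using B R0 k \<open>4 ^ k \<le> R\<^sup>2\<close> by (intro mult_left_mono frac_le rho_mono) auto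
    finally show "\<rho> R \<le> 4 * B * M R" using R0 I_pos[OF R0(1)] by (simp add: M_eq field_simps)
  qed (use B in auto)
qed

end

context random_walk_setting
begin

lemma Phi_le_exp:
  assumes lim: "filterlim \<rho> at_top at_top"
  obtains c C where "0 < c" "0 < C"
    "\<And>u n. 0 \<le> u \<Longrightarrow> Phi_tilde G S \<rho> n \<le> max (C * exp (- (D * u))) (exp (- (c * real n / \<rho> (exp u))))"
proof -
  obtain \<phi> c C where adm: "admissible \<phi>" and cC: "0 < c" "0 < C"
    and decay: "\<And>k n r. 1 \<le> r \<Longrightarrow> pmf (convolution_power G \<phi> (2 * (k + n))) \<one>
       \<le> max (C * r powr (-D)) (pmf (convolution_power G \<phi> (2 * k)) \<one> * exp (- (c * real n / M r)))"
    using ex_spread_out_walk[OF lim] by blast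
  show ?thesis
  proof (rule that[of "c / 2" C])
    fix u :: real and n :: nat assume u: "0 \<le> u"
    have r: "1 \<le> exp u" using u by simp
    have "Phi_tilde G S \<rho> n \<le> pmf (convolution_power G \<phi> (2 * (0 + n))) \<one>" using Phi_le[OF adm, of n] by simp
    also have "\<dots> \<le> max (C * exp u powr (-D)) (exp (- (c * real n / M (exp u))))"
      using decay[OF r, of 0 n] by simp
    also have "exp u powr (-D) = exp (- (D * u))" by (simp add: powr_def mult.commute)
    also have "exp (- (c * real n / M (exp u))) \<le> exp (- (c / 2 * real n / \<rho> (exp u)))"
    proof -
      have "c * real n / (2 * \<rho> (exp u)) \<le> c * real n / M (exp u)"
        using cC M_le[of "exp u"] M_pos[of "exp u"] rho_pos[of "exp u"] by (intro divide_left_mono mult_pos_pos) auto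
      then show ?thesis by simp
    qed
    finally show "Phi_tilde G S \<rho> n \<le> max (C * exp (- (D * u))) (exp (- (c / 2 * real n / \<rho> (exp u))))" by simp
  qed (use cC in auto)
qed

text \<open>The scale is \<open>r = e\<^sup>u\<close>, rounded up to an integer radius.\<close>

lemma Phi_ge_exp:
  assumes lim: "filterlim \<rho> at_top at_top"
    and T: "1 \<le> T" and dbl: "\<And>t. T \<le> t \<Longrightarrow> \<rho> (2 * t) \<le> 2 * \<rho> t"
  obtains c C u0 where "0 < c" "0 < C" "0 \<le> u0"
    "\<And>u n. u0 \<le> u \<Longrightarrow> c * exp (- (D * u + C * real n / \<rho> (exp u))) \<le> Phi_tilde G S \<rho> n"
proof -
  obtain B where B: "0 < B" "\<And>R. T \<le> R \<Longrightarrow> \<rho> R \<le> B * M R"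
    using rho_le_M_of_doubling[OF T dbl] by blast
  obtain a A where aA: "0 < a" "0 < A"
    and low: "\<And>\<phi> m n. admissible \<phi> \<Longrightarrow> 1 \<le> m \<Longrightarrow> A / M (real m) \<le> 1 / 2 \<Longrightarrow>
       a * real m powr (-D) * exp (- (4 * A * real n / M (real m))) \<le> pmf (convolution_power G \<phi> (2 * n)) \<one>"
    using return_probability_ge by blast
  obtain \<phi>0 where adm: "admissible \<phi>0" by (rule ex_spread_out_walk[OF lim]) (rule that)
  have "\<forall>\<^sub>F R in at_top. 2 * A * B \<le> \<rho> R" using lim by (simp add: filterlim_at_top)
  then obtain R0 where R0: "\<And>R. R0 \<le> R \<Longrightarrow> 2 * A * B \<le> \<rho> R" by (auto simp: eventually_at_top_linorder)
  define u0 where "u0 = ln (max T R0)"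
  have mT: "0 < max T R0" using T by simp
  show ?thesis
  proof (rule that[of "a * 2 powr (-D)" "4 * A * B" u0])
    show "0 \<le> u0" using T by (simp add: u0_def)
    fix u :: real and n :: nat assume u: "u0 \<le> u"
    have "exp u0 \<le> exp u" using u by simp
    then have R: "T \<le> exp u" "R0 \<le> exp u" using mT by (auto simp: u0_def)
    define m where "m = nat \<lceil>exp u\<rceil>"
    have e1: "1 \<le> exp u" using R T by linarith
    have m: "exp u \<le> real m" "real m \<le> 2 * exp u" "1 \<le> m" using e1 unfolding m_def by linarith+
    have MM: "M (exp u) \<le> M (real m)" "0 < M (exp u)" using m by (auto intro!: M_mono M_pos)
    have rM: "\<rho> (exp u) \<le> B * M (real m)" using B(2)[OF R(1)] mult_left_mono[OF MM(1), of B] B(1) by linarith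
    have rp: "0 < \<rho> (exp u)" by (simp add: rho_pos)
    have "2 * A * B \<le> B * M (real m)" using R0[OF R(2)] rM by linarith
    then have half: "A / M (real m) \<le> 1 / 2" using MM B aA by (simp add: field_simps)
    have "4 * A * real n / M (real m) \<le> 4 * A * B * real n / \<rho> (exp u)"
      using mult_left_mono[OF rM, of "real n"] rp MM aA B by (simp add: field_simps)
    moreover have "(2 * exp u) powr (-D) \<le> real m powr (-D)" using m D_pos by (intro powr_mono2') auto
    ultimately have "a * (2 * exp u) powr (-D) * exp (- (4 * A * B * real n / \<rho> (exp u)))
      \<le> a * real m powr (-D) * exp (- (4 * A * real n / M (real m)))"
      using aA by (intro mult_mono mult_left_mono) auto
    moreover have "(2 * exp u) powr (-D) = 2 powr (-D) * exp (- (D * u))"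
      by (subst powr_mult) (auto simp: powr_def mult.commute)
    moreover have "exp (- (D * u + 4 * A * B * real n / \<rho> (exp u))) = exp (- (D * u)) * exp (- (4 * A * B * real n / \<rho> (exp u)))"
      by (simp add: exp_add[symmetric])
    ultimately have "a * 2 powr (-D) * exp (- (D * u + 4 * A * B * real n / \<rho> (exp u)))
      \<le> a * real m powr (-D) * exp (- (4 * A * real n / M (real m)))"
      by (simp only: mult.assoc)
    then show "a * 2 powr (-D) * exp (- (D * u + 4 * A * B * real n / \<rho> (exp u))) \<le> Phi_tilde G S \<rho> n"
      using low[OF _ m(3) half, of _ n] by (intro Phi_ge[OF adm]) (meson order_trans)
  qed (use aA B in auto)
qed

text \<open>The exponents \<open>D u\<close> and \<open>n/\<rho>(e\<^sup>u)\<close> balance at \<open>u = g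
n\<close> if \<open>g n \<rho>(e\<^bsup>g n\<^esup>)\<close> is of order \<open>n\<close>. For
the upper bound \<open>u = g n\<close> itself is used; the lower bound is available only for
large \<open>u\<close>, and the shift by \<open>u0\<close> costs a constant factor.\<close>

lemma Phi_sim_exp:
  assumes lim: "filterlim \<rho> at_top at_top"
    and T: "1 \<le> T" "\<And>t. T \<le> t \<Longrightarrow> \<rho> (2 * t) \<le> 2 * \<rho> t"
    and b: "0 < b" "0 < b'"
    and up: "\<forall>\<^sub>F n in sequentially. 0 \<le> g n \<and> b * g n * \<rho> (exp (g n)) \<le> real n"
    and low: "\<forall>\<^sub>F n in sequentially. real n \<le> b' * g n * \<rho> (exp (g n))"
    and scaling: "\<And>\<delta>. 0 < \<delta> \<Longrightarrow> \<exists>\<epsilon>::real>0. \<forall>\<^sub>F t in at_top. g (nat \<lfloor>\<epsilon> * t\<rfloor>) \<le> \<delta> * g (nat \<lfloor>t\<rfloor>)"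
  shows "Phi_tilde G S \<rho> \<simeq>\<^sub>\<nat> (\<lambda>n. exp (- g n))"
proof -
  obtain c C where cC: "0 < c" "0 < C"
    "\<And>u n. 0 \<le> u \<Longrightarrow> Phi_tilde G S \<rho> n \<le> max (C * exp (- (D * u))) (exp (- (c * real n / \<rho> (exp u))))"
    by (rule Phi_le_exp[OF lim]) (rule that)
  obtain a A u0 where aA: "0 < a" "0 < A" "0 \<le> u0"
    "\<And>u n. u0 \<le> u \<Longrightarrow> a * exp (- (D * u + A * real n / \<rho> (exp u))) \<le> Phi_tilde G S \<rho> n"
    by (rule Phi_ge_exp[OF lim T]) (assumption, rule that)
  define a' where "a' = a * exp (- (D * u0))"
  show ?thesis
  proof (rule sim_exp_of_exponential_bounds[OF _ _ _ _ _ scaling])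
    show "0 < a'" "0 < max C 1" "0 < min D (c * b)" "0 < D + A * b'"
      using aA cC b D_pos by (auto simp: a'_def intro: add_pos_pos)
    show "\<forall>\<^sub>F n in sequentially. a' * exp (- ((D + A * b') * g n)) \<le> Phi_tilde G S \<rho> n \<and>
        Phi_tilde G S \<rho> n \<le> max C 1 * exp (- (min D (c * b) * g n))"
      using up low
    proof eventually_elim
      case (elim n)
      have g: "0 \<le> g n" using elim by simp
      have p: "0 < \<rho> (exp u)" for u by (simp add: rho_pos)
      have "b * g n \<le> real n / \<rho> (exp (g n))" using elim p by (simp add: field_simps)
      then have "c * (b * g n) \<le> c * (real n / \<rho> (exp (g n)))" using cC by (intro mult_left_mono) auto
      moreover have "min D (c * b) * g n \<le> c * b * g n" "min D (c * b) * g n \<le> D * g n"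
        using g by (auto intro!: mult_right_mono)
      ultimately have e: "exp (- (c * real n / \<rho> (exp (g n)))) \<le> exp (- (min D (c * b) * g n))"
        "exp (- (D * g n)) \<le> exp (- (min D (c * b) * g n))" by auto
      have "1 * exp (- (c * real n / \<rho> (exp (g n)))) \<le> max C 1 * exp (- (min D (c * b) * g n))"
        using e by (intro mult_mono) auto
      moreover have "C * exp (- (D * g n)) \<le> max C 1 * exp (- (min D (c * b) * g n))"
        using e cC by (intro mult_mono) auto
      ultimately have 1: "Phi_tilde G S \<rho> n \<le> max C 1 * exp (- (min D (c * b) * g n))"
        using cC(3)[OF g, of n] by simp
      define u where "u = u0 + g n"
      have "\<rho> (exp (g n)) \<le> \<rho> (exp u)" using aA by (intro rho_mono) (auto simp: u_def)
      then have "b' * g n * \<rho> (exp (g n)) \<le> b' * g n * \<rho> (exp u)" using b g by (intro mult_left_mono) auto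
      then have "real n \<le> b' * g n * \<rho> (exp u)" using elim by linarith
      then have "real n / \<rho> (exp u) \<le> b' * g n" using p by (simp add: field_simps)
      then have "A * (real n / \<rho> (exp u)) \<le> A * (b' * g n)" using aA by (intro mult_left_mono) auto
      then have "D * u + A * real n / \<rho> (exp u) \<le> D * u0 + (D + A * b') * g n"
        by (simp add: u_def algebra_simps)
      then have "exp (- (D * u0 + (D + A * b') * g n)) \<le> exp (- (D * u + A * real n / \<rho> (exp u)))" by simp
      then have "a * exp (- (D * u0 + (D + A * b') * g n)) \<le> a * exp (- (D * u + A * real n / \<rho> (exp u)))"
        using aA by (intro mult_left_mono) auto
      also have "\<dots> \<le> Phi_tilde G S \<rho> n" using g by (intro aA(4)) (simp add: u_def)
      finally have "a' * exp (- ((D + A * b') * g n)) \<le> Phi_tilde G S \<rho> n"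
        by (simp add: a'_def exp_add[symmetric] mult.assoc)
      with 1 show ?case by simp
    qed
  qed
qed

text \<open>Here \<open>g n = n/\<kappa>(n)\<close>, and balance means that
\<open>\<kappa>(n/\<kappa>(n))\<close> is comparable with \<open>\<kappa>(n)\<close>. One
direction is monotonicity. For the other, put \<open>\<sigma> = \<kappa>(n)/2\<close>, so that
\<open>\<kappa>inv \<sigma> \<le> n\<close>; the halving makes this true although
\<open>\<kappa>\<close> may be constant around \<open>n\<close>. The growth of the inverse gives
\<open>\<sigma> \<kappa>inv(c\<sigma>) \<le> C n\<close>, hence
\<open>\<kappa>inv(c\<sigma>)\<close> is at most a multiple \<open>X\<close> of
\<open>n/\<kappa>(n)\<close>, and applying \<open>\<kappa>\<close> gives \<open>c\<sigma> \<le>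
\<kappa>(X n/\<kappa>(n))\<close>. Slow variation removes \<open>X\<close>.\<close>

theorem Phi_rapid_inverse:
  assumes sv: "slowly_varying (\<lambda>u. \<rho> (exp u))"
    and inv: "inverse_near_infinity (\<lambda>u. \<rho> (exp u)) \<kappa>inv"
    and rapid: "(\<lambda>s. s * \<kappa>inv s) \<simeq>\<^sub>\<infinity> \<kappa>inv"
  shows "Phi_tilde G S \<rho> \<simeq>\<^sub>\<nat> (\<lambda>n. exp (- real n / \<rho> (exp (real n))))"
proof -
  define \<kappa> where "\<kappa> u = \<rho> (exp u)" for u
  have mono: "\<kappa> u \<le> \<kappa> v" if "u \<le> v" for u v using that by (auto simp: \<kappa>_def intro!: rho_mono)
  have k1: "1 \<le> \<kappa> u" for u using rho_ge_1 by (simp add: \<kappa>_def)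
  have k0: "0 < \<kappa> u" for u using k1[of u] by linarith
  have sv': "\<forall>\<^sub>F t in at_top. \<kappa> (x * t) \<le> 2 * \<kappa> t \<and> \<kappa> t \<le> 2 * \<kappa> (x * t)" if "0 < x" for x
    using slowly_varying_eventually[OF sv that, of 2] by (auto simp: \<kappa>_def elim: eventually_mono)
  obtain s0 where s0: "\<And>s. s0 \<le> s \<Longrightarrow> 0 \<le> \<kappa>inv s \<and> \<kappa> (\<kappa>inv s) = s"
    using inv unfolding inverse_near_infinity_def \<kappa>_def eventually_at_top_linorder by blast
  have klim: "filterlim \<kappa> at_top at_top"
    unfolding filterlim_at_top eventually_at_top_linorder
    by (metis mono s0 max.cobounded1 max.cobounded2 order_trans)
  have lim: "filterlim \<rho> at_top at_top"
  proof (rule rho_at_top_if_unbounded)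
    fix Z :: real
    obtain N where "Z \<le> \<kappa> N" using klim unfolding filterlim_at_top eventually_at_top_linorder by blast
    then show "\<exists>t\<ge>0. Z \<le> \<rho> t" by (intro exI[of _ "exp N"]) (simp add: \<kappa>_def)
  qed
  obtain U where U: "\<And>u. U \<le> u \<Longrightarrow> \<kappa> (2 * u) \<le> 2 * \<kappa> u"
    using sv'[of 2] by (auto simp: eventually_at_top_linorder)
  define T where "T = exp (max U 1)"
  have dbl: "\<rho> (2 * t) \<le> 2 * \<rho> t" if t: "T \<le> t" for t
  proof -
    have "0 < T" by (simp add: T_def)
    then have t0: "0 < t" using t by linarith
    have lt: "max U 1 \<le> ln t" using t t0 unfolding T_def by (metis ln_ge_iff)
    have "exp 1 \<le> T" by (simp add: T_def)
    then have "exp 1 \<le> t" using t by linarith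
    then have "2 \<le> t" using exp_ge_add_one_self[of 1] by linarith
    then have "2 * t \<le> exp (2 * ln t)" using t0 by (simp add: exp_double power2_eq_square)
    then have "\<rho> (2 * t) \<le> \<kappa> (2 * ln t)" using t0 by (auto simp: \<kappa>_def intro: rho_mono)
    also have "\<dots> \<le> 2 * \<kappa> (ln t)" using lt by (intro U) auto
    also have "\<kappa> (ln t) = \<rho> t" using t0 by (simp add: \<kappa>_def)
    finally show ?thesis .
  qed
  obtain c1 c2 c3 c4 where c: "c1 > 0" "c2 > 0" and ev0: "\<forall>\<^sub>F s in at_top.
      c1 * (c2 * s * \<kappa>inv (c2 * s)) \<le> \<kappa>inv s \<and> \<kappa>inv s \<le> c3 * (c4 * s * \<kappa>inv (c4 * s))"
    using rapid unfolding sim_infinity_def by blast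
  have ev: "\<forall>\<^sub>F s in at_top. c1 * (c2 * s * \<kappa>inv (c2 * s)) \<le> \<kappa>inv s"
    using ev0 by (rule eventually_mono) simp
  define X where "X = 2 / (c1 * c2)"
  have X: "0 < X" using c by (simp add: X_def)
  define h where "h n = real n / \<kappa> (real n)" for n :: nat
  have h0: "0 \<le> h n" for n using k0[of "real n"] by (simp add: h_def)
  have klim_n: "LIM n sequentially. \<kappa> (real n) / 2 :> at_top"
    using filterlim_compose[OF klim filterlim_real_sequentially]
    by (simp add: filterlim_at_top)
  have low: "\<forall>\<^sub>F n in sequentially. c2 / 2 * \<kappa> (real n) \<le> \<kappa> (X * h n)"
    using eventually_compose_filterlim[OF ev klim_n]
      eventually_compose_filterlim[OF eventually_ge_at_top[of "max s0 (s0 / c2)"] klim_n]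
      eventually_gt_at_top[of 0]
  proof eventually_elim
    case (elim n)
    define \<sigma> where "\<sigma> = \<kappa> (real n) / 2"
    have "max s0 (s0 / c2) \<le> \<sigma>" unfolding \<sigma>_def by (rule elim(2))
    moreover have "0 < \<sigma>" using k0[of "real n"] by (simp add: \<sigma>_def)
    ultimately have \<sigma>: "s0 \<le> \<sigma>" "s0 \<le> c2 * \<sigma>" "0 < \<sigma>" using c by (auto simp: field_simps)
    have i1: "\<kappa> (\<kappa>inv \<sigma>) = \<sigma>" and i2: "\<kappa> (\<kappa>inv (c2 * \<sigma>)) = c2 * \<sigma>" using s0 \<sigma> by auto
    have "\<sigma> < \<kappa> (real n)" using k0[of "real n"] by (simp add: \<sigma>_def)
    then have "\<kappa>inv \<sigma> \<le> real n" using mono[of "real n" "\<kappa>inv \<sigma>"] i1 by linarith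
    then have "c1 * (c2 * \<sigma> * \<kappa>inv (c2 * \<sigma>)) \<le> real n" using elim(1) by (simp add: \<sigma>_def)
    then have "\<kappa>inv (c2 * \<sigma>) \<le> X * h n"
      using c k0[of "real n"] by (simp add: X_def h_def \<sigma>_def field_simps)
    from mono[OF this] show ?case by (simp add: i2) (simp add: \<sigma>_def)
  qed
  obtain y0 where y0: "\<And>y. y0 \<le> y \<Longrightarrow> \<kappa> (X * y) \<le> 2 * \<kappa> y"
    using sv'[OF X] by (auto simp: eventually_at_top_linorder)
  have "\<forall>\<^sub>F n in sequentially. 2 / c2 * (\<kappa> (X * y0) + 1) \<le> \<kappa> (real n)"
    using filterlim_compose[OF klim filterlim_real_sequentially] by (simp add: filterlim_at_top)
  with low have low': "\<forall>\<^sub>F n in sequentially. c2 / 4 * \<kappa> (real n) \<le> \<kappa> (h n)"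
  proof eventually_elim
    case (elim n)
    \<comment> \<open>Slow variation applies only if \<open>h n\<close> is large; otherwise the left side of
      the previous estimate would be bounded, while \<open>\<kappa>(n)\<close> tends to
      infinity.\<close>
    have "\<kappa> (X * y0) + 1 \<le> c2 / 2 * \<kappa> (real n)" using elim(2) c by (simp add: field_simps)
    then have "\<kappa> (X * y0) < \<kappa> (X * h n)" using elim(1) by linarith
    then have "\<not> X * h n \<le> X * y0" using mono by (meson not_less)
    then have "y0 \<le> h n" using X by (simp add: mult_le_cancel_left)
    from y0[OF this] elim(1) show ?case by simp
  qed
  have "Phi_tilde G S \<rho> \<simeq>\<^sub>\<nat> (\<lambda>n. exp (- h n))"
  proof (rule Phi_sim_exp[OF lim _ dbl, where b = 1 and b' = "4 / c2"])
    show "1 \<le> T" by (simp add: T_def)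
    show "\<forall>\<^sub>F n in sequentially. 0 \<le> h n \<and> 1 * h n * \<rho> (exp (h n)) \<le> real n"
    proof (intro always_eventually allI conjI h0)
      fix n
      have "h n \<le> real n" using k1[of "real n"] by (simp add: h_def field_simps mult_le_cancel_left1)
      then have "h n * \<kappa> (h n) \<le> h n * \<kappa> (real n)" using h0 by (intro mult_left_mono mono) auto
      also have "\<dots> = real n" using k0[of "real n"] by (simp add: h_def)
      finally show "1 * h n * \<rho> (exp (h n)) \<le> real n" by (simp add: \<kappa>_def)
    qed
    show "\<forall>\<^sub>F n in sequentially. real n \<le> 4 / c2 * h n * \<rho> (exp (h n))"
      using low'
    proof eventually_elim
      case (elim n)
      have "real n = 4 / c2 * h n * (c2 / 4 * \<kappa> (real n))" using c k0[of "real n"] by (simp add: h_def)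
      also have "\<dots> \<le> 4 / c2 * h n * \<kappa> (h n)" using elim c h0 by (intro mult_left_mono) auto
      finally show ?case by (simp add: \<kappa>_def)
    qed
    fix \<delta> :: real assume \<delta>: "0 < \<delta>"
    define \<epsilon> where "\<epsilon> = \<delta> / 4"
    have \<epsilon>: "0 < \<epsilon>" using \<delta> by (simp add: \<epsilon>_def)
    have "\<forall>\<^sub>F t in at_top. h (nat \<lfloor>\<epsilon> * t\<rfloor>) \<le> \<delta> * h (nat \<lfloor>t\<rfloor>)"
      using sv'[OF half_gt_zero[OF \<epsilon>]] eventually_ge_at_top[of "2 / \<epsilon> + 2"]
    proof eventually_elim
      case (elim t)
      define n n' where "n = real (nat \<lfloor>t\<rfloor>)" and "n' = real (nat \<lfloor>\<epsilon> * t\<rfloor>)"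
      have q: "0 < 2 / \<epsilon>" using \<epsilon> by simp
      have n: "n \<le> t" "t \<le> 2 * n" "0 < n" using elim(2) q unfolding n_def by linarith+
      have "2 / \<epsilon> \<le> t" using elim(2) by simp
      then have et: "2 \<le> \<epsilon> * t" using \<epsilon> by (simp add: field_simps)
      have n': "n' \<le> \<epsilon> * t" "\<epsilon> * t / 2 \<le> n'" using et unfolding n'_def by linarith+
      have "n' \<le> 2 * \<epsilon> * n" using n' mult_left_mono[OF n(2), of \<epsilon>] \<epsilon> by linarith
      moreover have "\<kappa> n / 2 \<le> \<kappa> n'"
        using mono[OF n(1)] mono[OF n'(2)] elim(1) by (simp add: field_simps)
      ultimately have "n' / \<kappa> n' \<le> 2 * \<epsilon> * n / (\<kappa> n / 2)"
        using \<epsilon> n k0[of n] by (intro frac_le) auto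
      also have "\<dots> = \<delta> * (n / \<kappa> n)" by (simp add: \<epsilon>_def)
      finally show ?case by (simp add: h_def n_def n'_def)
    qed
    then show "\<exists>\<epsilon>::real>0. \<forall>\<^sub>F t in at_top. h (nat \<lfloor>\<epsilon> * t\<rfloor>) \<le> \<delta> * h (nat \<lfloor>t\<rfloor>)" using \<epsilon> by blast
  qed (use c in auto)
  then show ?thesis by (simp add: h_def \<kappa>_def)
qed

end

section \<open>Moment functions of power type in the logarithm\<close>

context random_walk_setting
begin

text \<open>With \<open>K(u) = u\<^bsup>1/\<gamma>\<^esup> \<kappa>(u)\<close> in place of
\<open>\<rho>(e\<^sup>u)\<close>, the balance \<open>u K(u) = n\<close> is solved up to
constants by \<open>u = (n/\<kappa>(n))\<^sup>\<beta>\<close> with \<open>\<beta> =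
\<gamma>/(1+\<gamma>)\<close>, because \<open>\<kappa>(u)\<close> is comparable with
\<open>\<kappa>(n)\<close>. Monotonicity of \<open>\<rho>\<close> makes \<open>K\<close>
monotone up to a constant, and this provides the octave property of \<open>\<kappa>\<close>.\<close>

theorem Phi_slowly_varying:
  assumes sv: "slowly_varying \<rho>" and \<gamma>: "0 < \<gamma>" and ksv: "slowly_varying \<kappa>"
    and sim: "(\<lambda>u. \<rho> (exp u)) \<simeq>\<^sub>\<infinity> (\<lambda>u. u powr (1 / \<gamma>) * \<kappa> u)"
    and kpw: "\<And>a. 0 < a \<Longrightarrow> (\<lambda>t. \<kappa> (t powr a)) \<simeq>\<^sub>\<infinity> \<kappa>"
  shows "Phi_tilde G S \<rho> \<simeq>\<^sub>\<nat> (\<lambda>n. exp (- ((real n / \<kappa> (real n)) powr (\<gamma> / (1 + \<gamma>)))))"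
proof -
  define p where "p = 1 / \<gamma>"
  define \<beta> where "\<beta> = \<gamma> / (1 + \<gamma>)"
  have p: "0 < p" and \<beta>: "0 < \<beta>" using \<gamma> by (auto simp: p_def \<beta>_def)
  have "1 + p = (1 + \<gamma>) / \<gamma>" using \<gamma> by (simp add: p_def field_simps)
  then have p\<beta>: "\<beta> * (1 + p) = 1" using \<gamma> by (simp add: \<beta>_def)
  define K where "K u = u powr p * \<kappa> u" for u
  define k where "k u = \<rho> (exp u)" for u
  have k_mono: "k u \<le> k v" if "u \<le> v" for u v using that by (auto simp: k_def intro!: rho_mono)
  obtain c1 c2 c3 c4 T0 where c: "c1 > 0" "c2 > 0" "c3 > 0" "c4 > 0"
    and T0: "\<And>t. T0 \<le> t \<Longrightarrow> c1 * k (c2 * t) \<le> K t" "\<And>t. T0 \<le> t \<Longrightarrow> K t \<le> c3 * k (c4 * t)"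
    using sim unfolding sim_infinity_def eventually_at_top_linorder K_def k_def p_def by metis
  have near: "\<exists>T. \<forall>t\<ge>T. 0 < \<kappa> t \<and> \<kappa> (x * t) \<le> 2 * \<kappa> t \<and> \<kappa> t \<le> 2 * \<kappa> (x * t)" if "0 < x" for x
    using slowly_varying_eventually[OF ksv that, of 2] by (simp add: eventually_at_top_linorder)
  define x where "x = c4 / c2"
  have x: "0 < x" using c by (simp add: x_def)
  obtain Tx where Tx: "\<And>t. Tx \<le> t \<Longrightarrow> 0 < \<kappa> t \<and> \<kappa> (x * t) \<le> 2 * \<kappa> t" using near[OF x] by blast
  obtain T2 where T2: "\<And>t. T2 \<le> t \<Longrightarrow> 0 < \<kappa> t \<and> \<kappa> (2 * t) \<le> 2 * \<kappa> t" using near[of 2] by auto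
  obtain T3 where T3: "\<And>t. T3 \<le> t \<Longrightarrow> \<kappa> (1 / c2 * t) \<le> 2 * \<kappa> t" using near[of "1 / c2"] c by auto
  obtain T4 where T4: "\<And>t. T4 \<le> t \<Longrightarrow> \<kappa> t \<le> 2 * \<kappa> (1 / c4 * t)" using near[of "1 / c4"] c by auto

  define A where "A = 2 * c3 / c1 * x powr p"
  have A: "0 < A" using c x by (simp add: A_def)
  define U where "U = max (max 1 (max T0 (T0 / x))) (max Tx T2)"
  have U: "1 \<le> U" "T0 \<le> U" "T0 / x \<le> U" "Tx \<le> U" "T2 \<le> U" by (auto simp: U_def)
  have pos: "0 < \<kappa> u" if "U \<le> u" for u using T2[of u] that U by linarith
  have quasi_mono: "K v \<le> A * K u" if uv: "U \<le> v" "v \<le> u" for u v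
  proof -
    have "x * U \<le> x * u" using x uv by (intro mult_left_mono) auto
    moreover have "T0 \<le> x * U" using U(3) x by (simp add: field_simps)
    ultimately have u: "T0 \<le> x * u" "0 < u" using uv U by auto
    have "K v \<le> c3 * k (c4 * v)" using uv U by (intro T0) auto
    also have "\<dots> \<le> c3 * k (c4 * u)" using c uv by (intro mult_left_mono k_mono) auto
    also have "c4 * u = c2 * (x * u)" using c by (simp add: x_def)
    also have "c3 * k (c2 * (x * u)) \<le> c3 / c1 * K (x * u)"
      using mult_left_mono[OF T0(1)[OF u(1)], of "c3 / c1"] c by simp
    also have "\<dots> \<le> c3 / c1 * ((x * u) powr p * (2 * \<kappa> u))"
      unfolding K_def using Tx[of u] uv U c by (intro mult_left_mono) auto
    also have "(x * u) powr p = x powr p * u powr p" using x u by (subst powr_mult) auto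
    finally show ?thesis by (simp add: A_def K_def mult_ac)
  qed
  define B where "B = max 1 (2 * A * 4 powr p)"
  have octave: "\<kappa> v \<le> B * \<kappa> u" if uv: "U \<le> u" "U \<le> v" "u \<le> 2 * v" "v \<le> 2 * u" for u v
  proof -
    have u0: "0 < u" "0 < v" "0 < \<kappa> u" using uv U pos by auto
    have "v powr p * \<kappa> v \<le> A * K (2 * u)" using quasi_mono[of v "2 * u"] uv by (simp add: K_def)
    also have "\<dots> \<le> A * ((2 * u) powr p * (2 * \<kappa> u))"
      unfolding K_def using T2[of u] uv U A by (intro mult_left_mono) auto
    also have "\<dots> \<le> A * ((4 * v) powr p * (2 * \<kappa> u))"
      using uv u0 p A by (intro mult_left_mono mult_right_mono powr_mono2) auto
    also have "\<dots> = v powr p * (2 * A * 4 powr p * \<kappa> u)" using u0 by (simp add: powr_mult)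
    finally have "\<kappa> v \<le> 2 * A * 4 powr p * \<kappa> u" using u0 by simp
    also have "\<dots> \<le> B * \<kappa> u" using u0 by (intro mult_right_mono) (auto simp: B_def)
    finally show ?thesis .
  qed
  interpret L: log_slowly_varying \<kappa> B U
    by unfold_locales (use U pos octave ksv kpw in \<open>auto simp: B_def\<close>)

  have lim: "filterlim \<rho> at_top at_top"
  proof (rule rho_at_top_if_unbounded)
    fix Z :: real
    have p2: "0 < p / 2" using p by simp
    obtain C V where CV: "1 \<le> C" "U \<le> V" "\<And>u. V \<le> u \<Longrightarrow> u powr (-(p / 2)) \<le> C * \<kappa> u"
      by (rule L.kappa_Potter[OF p2]) (rule that)
    have "\<forall>\<^sub>F u in at_top. C * c3 * Z \<le> u powr (p / 2)"
      using real_powr_at_top[OF p2] by (simp add: filterlim_at_top)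
    then obtain u where u: "V \<le> u" "C * c3 * Z \<le> u powr (p / 2)"
      unfolding eventually_at_top_linorder by (meson max.cobounded1 max.cobounded2)
    have u0: "0 < u" using u CV U by linarith
    have "C * c3 * Z \<le> u powr p * u powr (-(p / 2))" using u(2) u0 by (simp add: powr_add[symmetric])
    also have "\<dots> \<le> u powr p * (C * \<kappa> u)" using CV(3)[OF u(1)] by (intro mult_left_mono) auto
    also have "\<dots> = C * K u" by (simp add: K_def)
    also have "\<dots> \<le> C * (c3 * k (c4 * u))" using T0(2)[of u] u CV U by (intro mult_left_mono) auto
    finally have "(C * c3) * Z \<le> (C * c3) * k (c4 * u)" by simp
    then have "Z \<le> k (c4 * u)" using CV(1) c by (simp add: mult_le_cancel_left)
    then show "\<exists>t\<ge>0. Z \<le> \<rho> t" by (intro exI[of _ "exp (c4 * u)"]) (simp add: k_def)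
  qed
  obtain Td where Td: "\<And>t. Td \<le> t \<Longrightarrow> \<rho> (2 * t) \<le> 2 * \<rho> t"
    using slowly_varying_eventually[OF sv, of 2 2] by (auto simp: eventually_at_top_linorder)

  obtain b T where bT: "1 \<le> b" "U \<le> T"
    "\<And>x. T \<le> x \<Longrightarrow> \<kappa> (L.scale \<beta> x) \<le> b * \<kappa> x" "\<And>x. T \<le> x \<Longrightarrow> \<kappa> x \<le> b * \<kappa> (L.scale \<beta> x)"
    "\<And>x. T \<le> x \<Longrightarrow> x powr (\<beta> / 2) \<le> L.scale \<beta> x"
    by (rule L.kappa_scale[OF \<beta>]) (rule that)
  define g where "g n = L.scale \<beta> (real n)" for n :: nat
  \<comment> \<open>All thresholds that \<open>u = g n\<close> must pass: the two dilations in the equivalence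
    of \<open>\<rho> \<circ> exp\<close> and \<open>K\<close> move the argument to
    \<open>u/c2\<close> and \<open>u/c4\<close>.\<close>
  define X where "X = max (max U (T0 * c2)) (max (max T3 T4) (T0 * c4))"
  have "LIM n sequentially. real n powr (\<beta> / 2) :> at_top"
    using \<beta> by (intro filterlim_compose[OF real_powr_at_top filterlim_real_sequentially]) simp
  then have "\<forall>\<^sub>F n in sequentially. X \<le> real n powr (\<beta> / 2)" by (simp add: filterlim_at_top)
  moreover have "\<forall>\<^sub>F n in sequentially. T \<le> real n"
    using filterlim_real_sequentially by (simp add: filterlim_at_top)
  ultimately have big: "\<forall>\<^sub>F n in sequentially. T \<le> real n \<and> X \<le> g n"
  proof eventually_elim
    case (elim n)
    then show ?case using bT(5)[of "real n"] by (simp add: g_def)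
  qed
  have facts: "0 < g n" "g n * K (g n) = real n * (\<kappa> (g n) / \<kappa> (real n))" "\<kappa> (g n) \<le> b * \<kappa> (real n)"
    "\<kappa> (real n) \<le> b * \<kappa> (g n)" "0 < \<kappa> (real n)" "0 < \<kappa> (g n)"
    "c1 * k (g n) \<le> K (1 / c2 * g n)" "K (1 / c4 * g n) \<le> c3 * k (g n)"
    "\<kappa> (1 / c2 * g n) \<le> 2 * \<kappa> (g n)" "\<kappa> (g n) \<le> 2 * \<kappa> (1 / c4 * g n)"
    if n: "T \<le> real n \<and> X \<le> g n" for n
  proof -
    have g: "U \<le> g n" "T0 * c2 \<le> g n" "T3 \<le> g n" "T4 \<le> g n" "T0 * c4 \<le> g n" using n by (auto simp: X_def)
    show g0: "0 < g n" using g U by linarith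
    show kn: "0 < \<kappa> (real n)" using n bT by (intro pos) auto
    show "0 < \<kappa> (g n)" using g by (intro pos) auto
    show "\<kappa> (g n) \<le> b * \<kappa> (real n)" "\<kappa> (real n) \<le> b * \<kappa> (g n)" using bT n by (auto simp: g_def)
    have n0: "0 < real n" using n bT U by linarith
    have "g n * g n powr p = g n powr (1 + p)" using g0 by (simp add: powr_add)
    also have "\<dots> = (real n / \<kappa> (real n)) powr (\<beta> * (1 + p))" by (simp add: g_def L.scale_def powr_powr)
    also have "\<dots> = real n / \<kappa> (real n)" using p\<beta> n0 kn by simp
    finally have "g n * g n powr p = real n / \<kappa> (real n)" .
    then show "g n * K (g n) = real n * (\<kappa> (g n) / \<kappa> (real n))" by (simp add: K_def mult.assoc[symmetric])
    show "c1 * k (g n) \<le> K (1 / c2 * g n)" using T0(1)[of "1 / c2 * g n"] g c by (simp add: field_simps)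
    show "K (1 / c4 * g n) \<le> c3 * k (g n)" using T0(2)[of "1 / c4 * g n"] g c by (simp add: field_simps)
    show "\<kappa> (1 / c2 * g n) \<le> 2 * \<kappa> (g n)" using T3 g by blast
    show "\<kappa> (g n) \<le> 2 * \<kappa> (1 / c4 * g n)" using T4 g by blast
  qed
  define b1 where "b1 = c1 / (2 * (1 / c2) powr p * b)"
  define b2 where "b2 = 2 * c3 * b / (1 / c4) powr p"
  have "Phi_tilde G S \<rho> \<simeq>\<^sub>\<nat> (\<lambda>n. exp (- g n))"
  proof (rule Phi_sim_exp[OF lim, where T = "max 1 Td" and b = b1 and b' = b2])
    show "\<rho> (2 * t) \<le> 2 * \<rho> t" if "max 1 Td \<le> t" for t using that by (intro Td) auto
    show "0 < b1" "0 < b2" using c bT by (auto simp: b1_def b2_def)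
    show "\<forall>\<^sub>F n in sequentially. 0 \<le> g n \<and> b1 * g n * \<rho> (exp (g n)) \<le> real n"
      using big
    proof eventually_elim
      case (elim n)
      note f = facts[OF elim]
      have "c1 * k (g n) \<le> (1 / c2) powr p * g n powr p * (2 * \<kappa> (g n))"
      proof -
        have "c1 * k (g n) \<le> (1 / c2 * g n) powr p * (2 * \<kappa> (g n))"
          using f(7) mult_left_mono[OF f(9), of "(1 / c2 * g n) powr p"] unfolding K_def by simp
        also have "(1 / c2 * g n) powr p = (1 / c2) powr p * g n powr p" using c f(1) by (subst powr_mult) auto
        finally show ?thesis .
      qed
      then have "g n * (c1 * k (g n)) \<le> g n * ((1 / c2) powr p * g n powr p * (2 * \<kappa> (g n)))"
        using f(1) by (intro mult_left_mono) auto
      also have "\<dots> = 2 * (1 / c2) powr p * (g n * K (g n))" by (simp add: K_def)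
      also have "\<dots> \<le> 2 * (1 / c2) powr p * (real n * b)"
        unfolding f(2) using f(3,5) by (intro mult_left_mono) (auto simp: field_simps)
      finally have "b1 * g n * k (g n) \<le> real n" using c bT by (simp add: b1_def field_simps)
      then show ?case using f(1) by (simp add: k_def)
    qed
    show "\<forall>\<^sub>F n in sequentially. real n \<le> b2 * g n * \<rho> (exp (g n))"
      using big
    proof eventually_elim
      case (elim n)
      note f = facts[OF elim]
      have "real n \<le> b * (g n * K (g n))"
        unfolding f(2) using mult_left_mono[OF f(4), of "real n"] f(5) by (simp add: field_simps)
      also have "\<dots> = b * g n * g n powr p * \<kappa> (g n)" by (simp add: K_def)
      also have "\<dots> \<le> b * g n * g n powr p * (2 * \<kappa> (1 / c4 * g n))"
        using f(1,10) bT by (intro mult_left_mono) auto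
      also have "\<dots> = 2 * b * g n / (1 / c4) powr p * ((1 / c4) powr p * g n powr p * \<kappa> (1 / c4 * g n))"
        using c by simp
      also have "(1 / c4) powr p * g n powr p * \<kappa> (1 / c4 * g n) = K (1 / c4 * g n)"
        unfolding K_def using c f(1) by (subst powr_mult) auto
      also have "2 * b * g n / (1 / c4) powr p * K (1 / c4 * g n) \<le> 2 * b * g n / (1 / c4) powr p * (c3 * k (g n))"
        using f(1,8) bT c by (intro mult_left_mono) auto
      also have "\<dots> = b2 * g n * k (g n)" by (simp add: b2_def)
      finally show ?case by (simp add: k_def)
    qed
    show "\<exists>\<epsilon>::real>0. \<forall>\<^sub>F t in at_top. g (nat \<lfloor>\<epsilon> * t\<rfloor>) \<le> \<delta> * g (nat \<lfloor>t\<rfloor>)" if "0 < \<delta>" for \<delta>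
      unfolding g_def by (rule L.scale_scaling[OF \<beta> that])
  qed auto
  then show ?thesis by (simp add: g_def L.scale_def \<beta>_def)
qed

end

section \<open>Asymptotics of the extremal return probability\<close>

theorem corollary3p3:
  fixes G :: "('a, 'b) monoid_scheme" (structure)
    and S :: "'a set" and D \<alpha> :: real and \<rho> \<l> :: "real \<Rightarrow> real"
  assumes "group G"
    and "finite S" and "symmetric_generating_set G S"
    and "D > 0" and "polynomial_growth G S D"
    and "continuous_on {0..} \<rho>" and "mono_on {0..} \<rho>" and "\<forall>t\<ge>0. \<rho> t \<ge> 1"
    and "continuous_on {0..} \<l>" and "mono_on {0..} \<l>" and "\<forall>t\<ge>0. \<l> t \<ge> 1"
    and "\<alpha> \<ge> 0" and "regularly_varying \<alpha> \<l>"
    and "(\<lambda>s. 1 / ((1 + s) * \<l> s)) integrable_on {0..}"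
    and "\<rho> \<simeq>\<^sub>\<infinity> (\<lambda>t. inverse (integral {t..} (\<lambda>s. 1 / ((1 + s) * \<l> s))))"
  shows
    "(\<alpha> > 0 \<longrightarrow>
        (\<forall>Minv. inverse_near_infinity (scale_M \<rho>) Minv \<longrightarrow>
           Phi_tilde G S \<rho> \<simeq>\<^sub>\<nat> (\<lambda>n. 1 / Minv (real n) powr D))) \<and>
     (\<forall>\<gamma> (\<kappa> :: real \<Rightarrow> real).
        slowly_varying \<rho> \<and> \<gamma> > 0 \<and> slowly_varying \<kappa> \<and>
        (\<lambda>u. \<rho> (exp u)) \<simeq>\<^sub>\<infinity> (\<lambda>u. u powr (1 / \<gamma>) * \<kappa> u) \<and>
        (\<forall>a>0. (\<lambda>t. \<kappa> (t powr a)) \<simeq>\<^sub>\<infinity> \<kappa>) \<longrightarrow>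
        Phi_tilde G S \<rho> \<simeq>\<^sub>\<nat> (\<lambda>n. exp (- ((real n / \<kappa> (real n)) powr (\<gamma> / (1 + \<gamma>)))))) \<and>
     (\<forall>\<kappa> \<kappa>inv.
        \<kappa> = (\<lambda>u. \<rho> (exp u)) \<and> slowly_varying \<kappa> \<and>
        inverse_near_infinity \<kappa> \<kappa>inv \<and>
        (\<lambda>s. s * \<kappa>inv s) \<simeq>\<^sub>\<infinity> \<kappa>inv \<longrightarrow>
        Phi_tilde G S \<rho> \<simeq>\<^sub>\<nat> (\<lambda>n. exp (- real n / \<kappa> (real n))))"
proof (intro conjI impI allI)
  interpret group G by fact
  interpret random_walk_setting G S D \<rho>
    by unfold_locales (use assms in auto)
  have kernel: "tail_kernel \<l>" by unfold_locales (use assms in auto)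
  {
    fix Minv assume \<alpha>: "0 < \<alpha>" and Minv: "inverse_near_infinity (scale_M \<rho>) Minv"
    obtain \<Lambda> T where \<Lambda>: "2 \<le> \<Lambda>" "1 \<le> T" "\<And>t. T \<le> t \<Longrightarrow> 4 * \<rho> t \<le> \<rho> (\<Lambda> * t)"
      by (rule rho_expanding[OF kernel \<alpha> \<open>regularly_varying \<alpha> \<l>\<close> assms(15)]) (rule that)
    show "Phi_tilde G S \<rho> \<simeq>\<^sub>\<nat> (\<lambda>n. 1 / Minv (real n) powr D)"
      by (rule Phi_regularly_varying[OF \<Lambda> Minv])
  next
    fix \<gamma> and \<kappa> :: "real \<Rightarrow> real"
    assume h: "slowly_varying \<rho> \<and> \<gamma> > 0 \<and> slowly_varying \<kappa> \<and>
        (\<lambda>u. \<rho> (exp u)) \<simeq>\<^sub>\<infinity> (\<lambda>u. u powr (1 / \<gamma>) * \<kappa> u) \<and>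
        (\<forall>a>0. (\<lambda>t. \<kappa> (t powr a)) \<simeq>\<^sub>\<infinity> \<kappa>)"
    show "Phi_tilde G S \<rho> \<simeq>\<^sub>\<nat> (\<lambda>n. exp (- ((real n / \<kappa> (real n)) powr (\<gamma> / (1 + \<gamma>)))))"
      by (rule Phi_slowly_varying) (use h in auto)
  next
    fix \<kappa> \<kappa>inv :: "real \<Rightarrow> real"
    assume h: "\<kappa> = (\<lambda>u. \<rho> (exp u)) \<and> slowly_varying \<kappa> \<and>
        inverse_near_infinity \<kappa> \<kappa>inv \<and> (\<lambda>s. s * \<kappa>inv s) \<simeq>\<^sub>\<infinity> \<kappa>inv"
    then show "Phi_tilde G S \<rho> \<simeq>\<^sub>\<nat> (\<lambda>n. exp (- real n / \<kappa> (real n)))"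
      using Phi_rapid_inverse[of \<kappa>inv] by auto
  }
qed

end
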